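(* Let $L$ be an $(m\mid n)$-dimensional non-abelian nilpotent Lie superalgebra over $\mathbb{F}$ with derived subalgebra $L'=[L,L]$ of dimension $(r\mid s)$. Then $$\dim\otimes^3L\le (m+n)\big(m+n-(r+s)\big)^2,$$ where $\dim\otimes^3L$ denotes the total dimension. In particular, for $r=1$, $s=0$ equality holds if and only if $L\cong H(1\mid 0)$.
   Context: All vector superspaces and Lie superalgebras are over a field $\mathbb{F}$ of characteristic $\neq 2,3$. $\dim L=(m\mid n)$ means $\dim L_{\bar0}=m$, $\dim L_{\bar1}=n$; the total dimension is $m+n$; $|x|\in\mathbb{Z}_2$ is the degree of a homogeneous element. $L$ is nilpotent if its descending central series $L^1=L$, $L^{k+1}=[L^k,L]$ reaches $0$. $H(1\mid 0)$ (also written $H(1,0)$) is the Heisenberg Lie (super)algebra of dimension $(3\mid 0)$ with even basis $x_1,x_2,z$ and only nonzero bracket $[x_1,x_2]=z$ (up to skew-symmetry). Tensor product: an action of $P$ on $M$ is an even bilinear map $(p,m)\mapsto{}^pm$ with ${}^{[p,p']}m={}^p({}^{p'}m)-(-1)^{|p||p'|}\,{}^{p'}({}^pm)$ and ${}^p[m,m']=[{}^pm,m']+(-1)^{|p||m|}[m,{}^pm']$. If $M,N$ act on each other, $M\otimes N$ is the Lie superalgebra generated by symbols $m\otimes n$ ($m,n$ homogeneous, $|m\otimes n|=|m|+|n|$) subject to: bilinearity; $[m,m']\otimes n=m\otimes{}^{m'}n-(-1)^{|m||m'|}m'\otimes{}^mn$; $m\otimes[n,n']=(-1)^{|n'|(|m|+|n|)}({}^{n'}m\otimes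 n)-(-1)^{|m||n|}({}^nm\otimes n')$; $[m\otimes n,m'\otimes n']=-(-1)^{|m||n|}({}^nm\otimes{}^{m'}n')$. For $L\otimes L$ the actions are by the bracket. $L$ acts on $L\otimes L$ by ${}^{l'}(l\otimes m)=[l',l]\otimes m+(-1)^{|l||l'|}l\otimes[l',m]$, and $L\otimes L$ acts on $L$ by ${}^tl=[\lambda(t),l]$, where $\lambda:L\otimes L\to L$, $a\otimes b\mapsto[a,b]$; with these compatible actions $\otimes^3L=(L\otimes L)\otimes L$. *)

theory Defs
  imports "Jordan_Normal_Form.VS_Connect" "HOL-Library.Z2"
begin

section \<open>Lie superalgebras\<close>

text \<open>
  Degrees live in \<^typ>\<open>bit\<close>, i.e. in the integers modulo 2.
  \<open>sg d\<close> is the sign \<open>(-1)^d\<close>; a product of degrees is computed in \<^typ>\<open>bit\<close>.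
\<close>

definition sg :: "bit \<Rightarrow> 'f::field" where
  "sg d = (if d = 1 then - 1 else 1)"

text \<open>
  A superspace with a product is a module record in the sense of HOL-Algebra, extended by its
  homogeneous parts. As for algebras in HOL-Algebra, the product (here the Lie bracket) is the field
  \<^const>\<open>monoid.mult\<close>; the field \<^const>\<open>monoid.one\<close> is not used.
\<close>

record ('f, 'a) superalgebra = "('f, 'a) module" +
  part :: "bit \<Rightarrow> 'a set"

abbreviation bracket :: "('f, 'a) superalgebra \<Rightarrow> 'a \<Rightarrow> 'a \<Rightarrow> 'a" where
  "bracket L \<equiv> monoid.mult L"

text \<open>
  No separate axioms on \<open>[x,x]\<close> for even \<open>x\<close> or \<open>[x,[x,x]]\<close> for odd \<open>x\<close>
  are needed: this is the definition used in characteristic different from 2 and 3.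
\<close>

locale lie_superalgebra = vectorspace "class_ring :: 'f ring" L
  for L :: "('f::field, 'a) superalgebra" +
  assumes part_subspace: "subspace class_ring (part L d) L"
    and part_disjoint: "part L 0 \<inter> part L 1 = {\<zero>\<^bsub>L\<^esub>}"
    and part_sum: "x \<in> carrier L \<Longrightarrow> \<exists>x0\<in>part L 0. \<exists>x1\<in>part L 1. x = x0 \<oplus>\<^bsub>L\<^esub> x1"
    and bracket_degree: "\<lbrakk>x \<in> part L a; y \<in> part L b\<rbrakk> \<Longrightarrow> bracket L x y \<in> part L (a + b)"
    and bracket_closed: "\<lbrakk>x \<in> carrier L; y \<in> carrier L\<rbrakk> \<Longrightarrow> bracket L x y \<in> carrier L"
    and bracket_add_left: "\<lbrakk>x \<in> carrier L; x' \<in> carrier L; y \<in> carrier L\<rbrakk> \<Longrightarrow>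
      bracket L (x \<oplus>\<^bsub>L\<^esub> x') y = bracket L x y \<oplus>\<^bsub>L\<^esub> bracket L x' y"
    and bracket_add_right: "\<lbrakk>x \<in> carrier L; y \<in> carrier L; y' \<in> carrier L\<rbrakk> \<Longrightarrow>
      bracket L x (y \<oplus>\<^bsub>L\<^esub> y') = bracket L x y \<oplus>\<^bsub>L\<^esub> bracket L x y'"
    and bracket_scale_left: "\<lbrakk>x \<in> carrier L; y \<in> carrier L\<rbrakk> \<Longrightarrow>
      bracket L (c \<odot>\<^bsub>L\<^esub> x) y = c \<odot>\<^bsub>L\<^esub> bracket L x y"
    and bracket_scale_right: "\<lbrakk>x \<in> carrier L; y \<in> carrier L\<rbrakk> \<Longrightarrow>
      bracket L x (c \<odot>\<^bsub>L\<^esub> y) = c \<odot>\<^bsub>L\<^esub> bracket L x y"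
    and super_skew: "\<lbrakk>x \<in> part L a; y \<in> part L b\<rbrakk> \<Longrightarrow>
      bracket L x y = (- sg (a * b)) \<odot>\<^bsub>L\<^esub> bracket L y x"
    and super_jacobi: "\<lbrakk>x \<in> part L a; y \<in> part L b; z \<in> part L d\<rbrakk> \<Longrightarrow>
      bracket L x (bracket L y z) =
        bracket L (bracket L x y) z \<oplus>\<^bsub>L\<^esub> sg (a * b) \<odot>\<^bsub>L\<^esub> bracket L y (bracket L x z)"

definition lie_hom ::
    "('f::field, 'a) superalgebra \<Rightarrow> ('f, 'b) superalgebra \<Rightarrow> ('a \<Rightarrow> 'b) set" where
  "lie_hom L M = {f \<in> LinearCombinations.module_hom class_ring L M.
     (\<forall>d. \<forall>x\<in>part L d. f x \<in> part M d) \<and>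
     (\<forall>x\<in>carrier L. \<forall>y\<in>carrier L. f (bracket L x y) = bracket M (f x) (f y))}"

definition lie_isomorphic ::
    "('f::field, 'a) superalgebra \<Rightarrow> ('f, 'b) superalgebra \<Rightarrow> bool" where
  "lie_isomorphic L M \<longleftrightarrow> (\<exists>f\<in>lie_hom L M. bij_betw f (carrier L) (carrier M))"

definition bracket_span :: "('f::field, 'a) superalgebra \<Rightarrow> 'a set \<Rightarrow> 'a set \<Rightarrow> 'a set" where
  "bracket_span L A B =
     LinearCombinations.module.span class_ring L {bracket L x y | x y. x \<in> A \<and> y \<in> B}"

text \<open>\<open>lower_central L k\<close> is the term \<open>L^(k+1)\<close> of the descending central series.\<close>

primrec lower_central :: "('f::field, 'a) superalgebra \<Rightarrow> nat \<Rightarrow> 'a set" where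
  "lower_central L 0 = carrier L"
| "lower_central L (Suc k) = bracket_span L (lower_central L k) (carrier L)"

definition nilpotent :: "('f::field, 'a) superalgebra \<Rightarrow> bool" where
  "nilpotent L \<longleftrightarrow> (\<exists>k. lower_central L k = {\<zero>\<^bsub>L\<^esub>})"

definition abelian :: "('f::field, 'a) superalgebra \<Rightarrow> bool" where
  "abelian L \<longleftrightarrow> (\<forall>x\<in>carrier L. \<forall>y\<in>carrier L. bracket L x y = \<zero>\<^bsub>L\<^esub>)"

definition derived :: "('f::field, 'a) superalgebra \<Rightarrow> ('f, 'a) superalgebra" where
  "derived L = (let D = bracket_span L (carrier L) (carrier L)
     in L\<lparr>carrier := D, part := \<lambda>d. D \<inter> part L d\<rparr>)"

text \<open>
  \<open>has_superdim L m n\<close> says \<open>dim L = (m | n)\<close>. Finite-dimensionality of the two parts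
  is stated separately, because \<^const>\<open>vectorspace.dim\<close> is unspecified otherwise.
\<close>

definition has_dim :: "('f::field, 'a) superalgebra \<Rightarrow> 'a set \<Rightarrow> nat \<Rightarrow> bool" where
  "has_dim L W k \<longleftrightarrow>
     vectorspace.fin_dim class_ring (L\<lparr>carrier := W\<rparr>) \<and>
     vectorspace.dim class_ring (L\<lparr>carrier := W\<rparr>) = k"

definition has_superdim :: "('f::field, 'a) superalgebra \<Rightarrow> nat \<Rightarrow> nat \<Rightarrow> bool" where
  "has_superdim L m n \<longleftrightarrow> has_dim L (part L 0) m \<and> has_dim L (part L 1) n"

text \<open>The Heisenberg algebra \<open>H(1 | 0)\<close>; \<open>(a, b, c)\<close> stands for
  \<open>a x\<^sub>1 + b x\<^sub>2 + c z\<close>.\<close>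

definition heisenberg :: "('f::field, 'f \<times> 'f \<times> 'f) superalgebra" where
  "heisenberg = \<lparr>
     carrier = UNIV,
     monoid.mult = (\<lambda>(a, b, c) (a', b', c'). (0, 0, a * b' - b * a')),
     one = undefined,
     zero = (0, 0, 0),
     add = (\<lambda>(a, b, c) (a', b', c'). (a + a', b + b', c + c')),
     smult = (\<lambda>k (a, b, c). (k * a, k * b, k * c)),
     part = (\<lambda>d. if d = 0 then UNIV else {(0, 0, 0)})\<rparr>"


section \<open>Actions\<close>

text \<open>\<open>act p m\<close> is the element written \<open>\<^sup>pm\<close>.\<close>

locale lie_action = P: lie_superalgebra P + M: lie_superalgebra M
  for P :: "('f::field, 'p) superalgebra" and M :: "('f, 'm) superalgebra" +
  fixes act :: "'p \<Rightarrow> 'm \<Rightarrow> 'm"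
  assumes act_closed: "\<lbrakk>p \<in> carrier P; m \<in> carrier M\<rbrakk> \<Longrightarrow> act p m \<in> carrier M"
    and act_degree: "\<lbrakk>p \<in> part P a; m \<in> part M b\<rbrakk> \<Longrightarrow> act p m \<in> part M (a + b)"
    and act_add_left: "\<lbrakk>p \<in> carrier P; p' \<in> carrier P; m \<in> carrier M\<rbrakk> \<Longrightarrow>
      act (p \<oplus>\<^bsub>P\<^esub> p') m = act p m \<oplus>\<^bsub>M\<^esub> act p' m"
    and act_add_right: "\<lbrakk>p \<in> carrier P; m \<in> carrier M; m' \<in> carrier M\<rbrakk> \<Longrightarrow>
      act p (m \<oplus>\<^bsub>M\<^esub> m') = act p m \<oplus>\<^bsub>M\<^esub> act p m'"
    and act_scale_left: "\<lbrakk>p \<in> carrier P; m \<in> carrier M\<rbrakk> \<Longrightarrow>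
      act (c \<odot>\<^bsub>P\<^esub> p) m = c \<odot>\<^bsub>M\<^esub> act p m"
    and act_scale_right: "\<lbrakk>p \<in> carrier P; m \<in> carrier M\<rbrakk> \<Longrightarrow>
      act p (c \<odot>\<^bsub>M\<^esub> m) = c \<odot>\<^bsub>M\<^esub> act p m"
    and act_bracket: "\<lbrakk>p \<in> part P a; p' \<in> part P b; m \<in> carrier M\<rbrakk> \<Longrightarrow>
      act (bracket P p p') m =
        act p (act p' m) \<oplus>\<^bsub>M\<^esub> (- sg (a * b)) \<odot>\<^bsub>M\<^esub> act p' (act p m)"
    and act_derivation: "\<lbrakk>p \<in> part P a; m \<in> part M b; m' \<in> carrier M\<rbrakk> \<Longrightarrow>
      act p (bracket M m m') =
        bracket M (act p m) m' \<oplus>\<^bsub>M\<^esub> sg (a * b) \<odot>\<^bsub>M\<^esub> bracket M m (act p m')"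


section \<open>Lie superalgebras given by generators and relations\<close>

text \<open>
  The Lie superalgebra generated by symbols subject to relations is the algebra of all formal
  expressions in the symbols modulo the least congruence that contains the given relations and the
  axioms of a Lie superalgebra. The symbols are graded by \<open>G :: bit \<Rightarrow> 'g set\<close>, and
  \<open>R s t\<close> is the relation \<open>s = t\<close>.
\<close>

datatype (scalars: 'f, gens: 'g) lie_term =
    Gen 'g
  | Zero
  | Add "('f, 'g) lie_term" "('f, 'g) lie_term"
  | Scale 'f "('f, 'g) lie_term"
  | Bracket "('f, 'g) lie_term" "('f, 'g) lie_term"

definition lie_terms :: "(bit \<Rightarrow> 'g set) \<Rightarrow> ('f, 'g) lie_term set" where
  "lie_terms G = {t. gens t \<subseteq> G 0 \<union> G 1}"

inductive homogeneous :: "(bit \<Rightarrow> 'g set) \<Rightarrow> bit \<Rightarrow> ('f, 'g) lie_term \<Rightarrow> bool"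
  for G :: "bit \<Rightarrow> 'g set" where
  "g \<in> G d \<Longrightarrow> homogeneous G d (Gen g)"
| "homogeneous G d Zero"
| "homogeneous G d s \<Longrightarrow> homogeneous G d t \<Longrightarrow> homogeneous G d (Add s t)"
| "homogeneous G d t \<Longrightarrow> homogeneous G d (Scale c t)"
| "homogeneous G a s \<Longrightarrow> homogeneous G b t \<Longrightarrow> homogeneous G (a + b) (Bracket s t)"

inductive lie_eq ::
    "(bit \<Rightarrow> 'g set) \<Rightarrow> (('f::field, 'g) lie_term \<Rightarrow> ('f, 'g) lie_term \<Rightarrow> bool) \<Rightarrow>
     ('f, 'g) lie_term \<Rightarrow> ('f, 'g) lie_term \<Rightarrow> bool"
  for G :: "bit \<Rightarrow> 'g set" and R :: "('f::field, 'g) lie_term \<Rightarrow> ('f, 'g) lie_term \<Rightarrow> bool" where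
  relation: "R s t \<Longrightarrow> lie_eq G R s t"
| refl: "t \<in> lie_terms G \<Longrightarrow> lie_eq G R t t"
| sym: "lie_eq G R s t \<Longrightarrow> lie_eq G R t s"
| trans: "lie_eq G R s t \<Longrightarrow> lie_eq G R t u \<Longrightarrow> lie_eq G R s u"
| Add_cong: "lie_eq G R s s' \<Longrightarrow> lie_eq G R t t' \<Longrightarrow> lie_eq G R (Add s t) (Add s' t')"
| Scale_cong: "lie_eq G R t t' \<Longrightarrow> lie_eq G R (Scale c t) (Scale c t')"
| Bracket_cong:
    "lie_eq G R s s' \<Longrightarrow> lie_eq G R t t' \<Longrightarrow> lie_eq G R (Bracket s t) (Bracket s' t')"
| Add_assoc: "{s, t, u} \<subseteq> lie_terms G \<Longrightarrow> lie_eq G R (Add (Add s t) u) (Add s (Add t u))"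
| Add_comm: "{s, t} \<subseteq> lie_terms G \<Longrightarrow> lie_eq G R (Add s t) (Add t s)"
| Add_Zero: "t \<in> lie_terms G \<Longrightarrow> lie_eq G R (Add Zero t) t"
| Add_inverse: "t \<in> lie_terms G \<Longrightarrow> lie_eq G R (Add (Scale (- 1) t) t) Zero"
| Scale_Add:
    "{s, t} \<subseteq> lie_terms G \<Longrightarrow> lie_eq G R (Scale c (Add s t)) (Add (Scale c s) (Scale c t))"
| Scale_plus:
    "t \<in> lie_terms G \<Longrightarrow> lie_eq G R (Scale (c + c') t) (Add (Scale c t) (Scale c' t))"
| Scale_times: "t \<in> lie_terms G \<Longrightarrow> lie_eq G R (Scale (c * c') t) (Scale c (Scale c' t))"
| Scale_one: "t \<in> lie_terms G \<Longrightarrow> lie_eq G R (Scale 1 t) t"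
| Bracket_Add_left: "{s, t, u} \<subseteq> lie_terms G \<Longrightarrow>
    lie_eq G R (Bracket (Add s t) u) (Add (Bracket s u) (Bracket t u))"
| Bracket_Add_right: "{s, t, u} \<subseteq> lie_terms G \<Longrightarrow>
    lie_eq G R (Bracket s (Add t u)) (Add (Bracket s t) (Bracket s u))"
| Bracket_Scale_left:
    "{s, t} \<subseteq> lie_terms G \<Longrightarrow> lie_eq G R (Bracket (Scale c s) t) (Scale c (Bracket s t))"
| Bracket_Scale_right:
    "{s, t} \<subseteq> lie_terms G \<Longrightarrow> lie_eq G R (Bracket s (Scale c t)) (Scale c (Bracket s t))"
| Bracket_skew: "homogeneous G a s \<Longrightarrow> homogeneous G b t \<Longrightarrow>
    lie_eq G R (Bracket s t) (Scale (- sg (a * b)) (Bracket t s))"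
| Bracket_jacobi: "homogeneous G a s \<Longrightarrow> homogeneous G b t \<Longrightarrow> homogeneous G d u \<Longrightarrow>
    lie_eq G R (Bracket s (Bracket t u))
      (Add (Bracket (Bracket s t) u) (Scale (sg (a * b)) (Bracket t (Bracket s u))))"

definition lie_class ::
    "(bit \<Rightarrow> 'g set) \<Rightarrow> (('f::field, 'g) lie_term \<Rightarrow> ('f, 'g) lie_term \<Rightarrow> bool) \<Rightarrow>
     ('f, 'g) lie_term \<Rightarrow> ('f, 'g) lie_term set" where
  "lie_class G R t = {t'. lie_eq G R t t'}"

definition presented ::
    "(bit \<Rightarrow> 'g set) \<Rightarrow> (('f::field, 'g) lie_term \<Rightarrow> ('f, 'g) lie_term \<Rightarrow> bool) \<Rightarrow>
     ('f, ('f, 'g) lie_term set) superalgebra" where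
  "presented G R = \<lparr>
     carrier = lie_class G R ` lie_terms G,
     monoid.mult = (\<lambda>X Y. \<Union>s\<in>X. \<Union>t\<in>Y. lie_class G R (Bracket s t)),
     one = undefined,
     zero = lie_class G R Zero,
     add = (\<lambda>X Y. \<Union>s\<in>X. \<Union>t\<in>Y. lie_class G R (Add s t)),
     smult = (\<lambda>c X. \<Union>t\<in>X. lie_class G R (Scale c t)),
     part = (\<lambda>d. lie_class G R ` {t. homogeneous G d t})\<rparr>"


section \<open>The non-abelian tensor product\<close>

text \<open>
  The symbol \<open>m \<otimes> n\<close> is \<open>Gen (m, n)\<close> for homogeneous \<open>m\<close>, \<open>n\<close>.
  In what follows \<open>\<mu> m n\<close> is the action \<open>\<^sup>mn\<close> of \<open>M\<close> on \<open>N\<close>, and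
  \<open>\<nu> n m\<close> is the action \<open>\<^sup>nm\<close> of \<open>N\<close> on \<open>M\<close>.
  Only \<open>0\<close> is homogeneous of both degrees; the symbols \<open>0 \<otimes> n\<close> and \<open>m \<otimes> 0\<close>
  vanish by bilinearity.
\<close>

definition tensor_gens ::
    "('f::field, 'm) superalgebra \<Rightarrow> ('f, 'n) superalgebra \<Rightarrow> bit \<Rightarrow> ('m \<times> 'n) set" where
  "tensor_gens M N d = (\<Union>(a, b)\<in>{(a, b). a + b = d}. part M a \<times> part N b)"

inductive tensor_rel ::
    "('f::field, 'm) superalgebra \<Rightarrow> ('f, 'n) superalgebra \<Rightarrow>
     ('m \<Rightarrow> 'n \<Rightarrow> 'n) \<Rightarrow> ('n \<Rightarrow> 'm \<Rightarrow> 'm) \<Rightarrow>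
     ('f, 'm \<times> 'n) lie_term \<Rightarrow> ('f, 'm \<times> 'n) lie_term \<Rightarrow> bool"
  for M :: "('f::field, 'm) superalgebra" and N :: "('f, 'n) superalgebra"
    and \<mu> :: "'m \<Rightarrow> 'n \<Rightarrow> 'n" and \<nu> :: "'n \<Rightarrow> 'm \<Rightarrow> 'm" where
  add_left: "\<lbrakk>m \<in> part M a; m' \<in> part M a; n \<in> part N b\<rbrakk> \<Longrightarrow>
    tensor_rel M N \<mu> \<nu> (Gen (m \<oplus>\<^bsub>M\<^esub> m', n)) (Add (Gen (m, n)) (Gen (m', n)))"
| add_right: "\<lbrakk>m \<in> part M a; n \<in> part N b; n' \<in> part N b\<rbrakk> \<Longrightarrow>
    tensor_rel M N \<mu> \<nu> (Gen (m, n \<oplus>\<^bsub>N\<^esub> n')) (Add (Gen (m, n)) (Gen (m, n')))"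
| scale_left: "\<lbrakk>m \<in> part M a; n \<in> part N b\<rbrakk> \<Longrightarrow>
    tensor_rel M N \<mu> \<nu> (Gen (c \<odot>\<^bsub>M\<^esub> m, n)) (Scale c (Gen (m, n)))"
| scale_right: "\<lbrakk>m \<in> part M a; n \<in> part N b\<rbrakk> \<Longrightarrow>
    tensor_rel M N \<mu> \<nu> (Gen (m, c \<odot>\<^bsub>N\<^esub> n)) (Scale c (Gen (m, n)))"
| bracket_left: "\<lbrakk>m \<in> part M a; m' \<in> part M a'; n \<in> part N b\<rbrakk> \<Longrightarrow>
    tensor_rel M N \<mu> \<nu> (Gen (bracket M m m', n))
      (Add (Gen (m, \<mu> m' n)) (Scale (- sg (a * a')) (Gen (m', \<mu> m n))))"
| bracket_right: "\<lbrakk>m \<in> part M a; n \<in> part N b; n' \<in> part N b'\<rbrakk> \<Longrightarrow>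
    tensor_rel M N \<mu> \<nu> (Gen (m, bracket N n n'))
      (Add (Scale (sg (b' * (a + b))) (Gen (\<nu> n' m, n)))
           (Scale (- sg (a * b)) (Gen (\<nu> n m, n'))))"
| bracket_tensor: "\<lbrakk>m \<in> part M a; n \<in> part N b; m' \<in> part M a'; n' \<in> part N b'\<rbrakk> \<Longrightarrow>
    tensor_rel M N \<mu> \<nu> (Bracket (Gen (m, n)) (Gen (m', n')))
      (Scale (- sg (a * b)) (Gen (\<nu> n m, \<mu> m' n')))"

definition tensor_product ::
    "('f::field, 'm) superalgebra \<Rightarrow> ('f, 'n) superalgebra \<Rightarrow>
     ('m \<Rightarrow> 'n \<Rightarrow> 'n) \<Rightarrow> ('n \<Rightarrow> 'm \<Rightarrow> 'm) \<Rightarrow> ('f, ('f, 'm \<times> 'n) lie_term set) superalgebra" where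
  "tensor_product M N \<mu> \<nu> = presented (tensor_gens M N) (tensor_rel M N \<mu> \<nu>)"

definition tensor ::
    "('f::field, 'm) superalgebra \<Rightarrow> ('f, 'n) superalgebra \<Rightarrow>
     ('m \<Rightarrow> 'n \<Rightarrow> 'n) \<Rightarrow> ('n \<Rightarrow> 'm \<Rightarrow> 'm) \<Rightarrow> 'm \<Rightarrow> 'n \<Rightarrow> ('f, 'm \<times> 'n) lie_term set" where
  "tensor M N \<mu> \<nu> m n = lie_class (tensor_gens M N) (tensor_rel M N \<mu> \<nu>) (Gen (m, n))"

abbreviation tensor_square ::
    "('f::field, 'a) superalgebra \<Rightarrow> ('f, ('f, 'a \<times> 'a) lie_term set) superalgebra" where
  "tensor_square L \<equiv> tensor_product L L (bracket L) (bracket L)"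

abbreviation tensor2 ::
    "('f::field, 'a) superalgebra \<Rightarrow> 'a \<Rightarrow> 'a \<Rightarrow> ('f, 'a \<times> 'a) lie_term set" where
  "tensor2 L \<equiv> tensor L L (bracket L) (bracket L)"

text \<open>
  Both maps below are determined on the carrier by their values on the generating
  symbols, so the choice operator only fixes irrelevant values outside the carrier.
\<close>

definition tensor_lambda ::
    "('f::field, 'a) superalgebra \<Rightarrow> ('f, 'a \<times> 'a) lie_term set \<Rightarrow> 'a" where
  "tensor_lambda L = (SOME f. f \<in> lie_hom (tensor_square L) L \<and>
     (\<forall>i j. \<forall>a\<in>part L i. \<forall>b\<in>part L j. f (tensor2 L a b) = bracket L a b))"

definition tensor_square_action ::
    "('f::field, 'a) superalgebra \<Rightarrow>
     'a \<Rightarrow> ('f, 'a \<times> 'a) lie_term set \<Rightarrow> ('f, 'a \<times> 'a) lie_term set" where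
  "tensor_square_action L = (SOME act. lie_action L (tensor_square L) act \<and>
     (\<forall>k i j. \<forall>l'\<in>part L k. \<forall>l\<in>part L i. \<forall>m\<in>part L j.
        act l' (tensor2 L l m) =
          tensor2 L (bracket L l' l) m \<oplus>\<^bsub>tensor_square L\<^esub>
          sg (i * k) \<odot>\<^bsub>tensor_square L\<^esub> tensor2 L l (bracket L l' m)))"

definition tensor_cube ::
    "('f::field, 'a) superalgebra \<Rightarrow>
     ('f, ('f, ('f, 'a \<times> 'a) lie_term set \<times> 'a) lie_term set) superalgebra" where
  "tensor_cube L = tensor_product (tensor_square L) L
     (\<lambda>t l. bracket L (tensor_lambda L t) l) (tensor_square_action L)"

end

(* Every relation bracket_right rewrites m (x) [n,n'] into symbols m' (x) n and m' (x) n', so for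
   nilpotent N, which is generated by a homogeneous complement X of [N,N], the tensor product of
   M and N is spanned linearly by the symbols b (x) x with b in a basis of M and x in a basis of X.
   Applied twice, this gives the bound. It is strict as soon as one symbol b (x) x vanishes in the
   tensor square.

   Let [L,L] be spanned by the even element z, which is then central. If [y,y] is nonzero for some
   odd y, then z (x) y = 0 because 3 is invertible. Otherwise pick even x, y with [x,y] nonzero; any
   homogeneous v outside [L,L] that commutes with x and y satisfies [x,y] (x) v = 0, and if there is
   no such v, then L is spanned by x, y and [x,y], a Heisenberg algebra. For the Heisenberg algebra
   itself, twelve independent linear functionals on the triple tensor product show that the bound
   12 is attained.

   That the triple tensor product is the intended one requires the action of L on the tensor
   square: an element of L acts as a superderivation, defined on formal expressions and shown to
   respect all relations. *)

theory Submission
  imports Defs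
begin

text \<open>The congruence \<open>lie_eq\<close> imposes skew symmetry and the Jacobi identity on
  homogeneous expressions and contains no rule that keeps even and odd classes apart. That the
  quotient is graded is the first obstacle; a parity operator, multiplying degree d by (-1)^d,
  overcomes it, since x = -x forces x = 0 when 2 is invertible. After that, every map out of a
  tensor product is an induction over the congruence: an evaluation, a superderivation, a
  functional.

  The spanning argument is asymmetric: it uses nilpotency and generators of the right factor. The
  right factor is L in both stages, so one set X of at most m + n - (r + s) elements serves twice,
  and the tensor square enters only through a spanning set. This is the origin of the square in the
  bound.

  For the Heisenberg algebra, functionals that vanish on all brackets are enough, because both
  tensor powers are abelian: brackets there are multiples of z \<otimes> z = 0, or symbols with a
  right factor [lambda t, l] = 0.\<close>

declare add_bit_eq_xor [simp del] mult_bit_eq_and [simp del]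

lemma sg_simps [simp]: "sg 0 = 1" "sg 1 = - 1"
  by (simp_all add: sg_def)

lemma sg_add: "sg (a + b) = sg a * sg b"
  by (cases a; cases b) simp_all

subsection \<open>Presented superalgebras\<close>

context
  fixes G :: "bit \<Rightarrow> 'g set"
    and R :: "('f::field, 'g) lie_term \<Rightarrow> ('f, 'g) lie_term \<Rightarrow> bool"
begin

lemma lie_terms_simps [simp]:
  "Zero \<in> lie_terms G"
  "Gen g \<in> lie_terms G \<longleftrightarrow> g \<in> G 0 \<union> G 1"
  "Add s t \<in> lie_terms G \<longleftrightarrow> s \<in> lie_terms G \<and> t \<in> lie_terms G"
  "Scale c t \<in> lie_terms G \<longleftrightarrow> t \<in> lie_terms G"
  "Bracket s t \<in> lie_terms G \<longleftrightarrow> s \<in> lie_terms G \<and> t \<in> lie_terms G"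
  by (auto simp: lie_terms_def)

lemma homogeneous_lie_terms: "homogeneous G d t \<Longrightarrow> t \<in> lie_terms G"
proof (induction rule: homogeneous.induct)
  case (1 g d)
  then show ?case by (cases d) auto
qed simp_all

lemma lie_terms_induct [consumes 1, case_names Gen Zero Add Scale Bracket]:
  assumes "t \<in> lie_terms G"
    and "\<And>g d. g \<in> G d \<Longrightarrow> P (Gen g)"
    and "P Zero"
    and "\<And>s t. s \<in> lie_terms G \<Longrightarrow> t \<in> lie_terms G \<Longrightarrow> P s \<Longrightarrow> P t \<Longrightarrow> P (Add s t)"
    and "\<And>c t. t \<in> lie_terms G \<Longrightarrow> P t \<Longrightarrow> P (Scale c t)"
    and "\<And>s t. s \<in> lie_terms G \<Longrightarrow> t \<in> lie_terms G \<Longrightarrow> P s \<Longrightarrow> P t \<Longrightarrow> P (Bracket s t)"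
  shows "P t"
  using assms(1) by (induction t) (auto intro: assms)

abbreviation cls :: "('f, 'g) lie_term \<Rightarrow> ('f, 'g) lie_term set" where
  "cls \<equiv> lie_class G R"

lemma cls_eqI: "lie_eq G R s t \<Longrightarrow> cls s = cls t"
  unfolding lie_class_def by (auto intro: lie_eq.sym lie_eq.trans)

lemma cls_self: "t \<in> lie_terms G \<Longrightarrow> t \<in> cls t"
  by (simp add: lie_class_def lie_eq.refl)

lemma cls_eq_iff: "t \<in> lie_terms G \<Longrightarrow> cls s = cls t \<longleftrightarrow> lie_eq G R s t"
  using cls_eqI cls_self unfolding lie_class_def by blast

text \<open>The operations of \<open>presented\<close> are unions over representatives. Such a union
  collapses to one class when the family is constant on \<open>cls t\<close>, and it is not empty
  because \<open>t\<close> is congruent to itself.\<close>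

lemma cls_UN:
  assumes "t \<in> lie_terms G" and "\<And>t'. lie_eq G R t t' \<Longrightarrow> f t' = f t"
  shows "(\<Union>t'\<in>cls t. f t') = f t"
  using assms cls_self unfolding lie_class_def by blast

lemma presented_ops:
  "carrier (presented G R) = cls ` lie_terms G"
  "\<zero>\<^bsub>presented G R\<^esub> = cls Zero"
  "part (presented G R) d = cls ` {t. homogeneous G d t}"
  by (simp_all add: presented_def)

lemma presented_add:
  assumes "s \<in> lie_terms G" "t \<in> lie_terms G"
  shows "cls s \<oplus>\<^bsub>presented G R\<^esub> cls t = cls (Add s t)"
proof -
  have "(\<Union>t'\<in>cls t. cls (Add s' t')) = cls (Add s' t)" if "lie_eq G R s s'" for s'
    using assms lie_eq.trans[OF lie_eq.sym[OF that] that]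
    by (intro cls_UN cls_eqI) (auto intro: lie_eq.sym lie_eq.Add_cong)
  moreover have "cls (Add s' t) = cls (Add s t)" if "lie_eq G R s s'" for s'
    using assms that by (intro cls_eqI lie_eq.Add_cong) (auto intro: lie_eq.sym lie_eq.refl)
  ultimately have "(\<Union>s'\<in>cls s. \<Union>t'\<in>cls t. cls (Add s' t')) = cls (Add s t)"
    using assms by (subst cls_UN) (auto intro: lie_eq.refl)
  then show ?thesis by (simp add: presented_def)
qed

lemma presented_bracket:
  assumes "s \<in> lie_terms G" "t \<in> lie_terms G"
  shows "bracket (presented G R) (cls s) (cls t) = cls (Bracket s t)"
proof -
  have "(\<Union>t'\<in>cls t. cls (Bracket s' t')) = cls (Bracket s' t)" if "lie_eq G R s s'" for s'
    using assms lie_eq.trans[OF lie_eq.sym[OF that] that]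
    by (intro cls_UN cls_eqI) (auto intro: lie_eq.sym lie_eq.Bracket_cong)
  moreover have "cls (Bracket s' t) = cls (Bracket s t)" if "lie_eq G R s s'" for s'
    using assms that by (intro cls_eqI lie_eq.Bracket_cong) (auto intro: lie_eq.sym lie_eq.refl)
  ultimately have "(\<Union>s'\<in>cls s. \<Union>t'\<in>cls t. cls (Bracket s' t')) = cls (Bracket s t)"
    using assms by (subst cls_UN) (auto intro: lie_eq.refl)
  then show ?thesis by (simp add: presented_def)
qed

lemma presented_smult:
  assumes "t \<in> lie_terms G"
  shows "c \<odot>\<^bsub>presented G R\<^esub> cls t = cls (Scale c t)"
proof -
  have "(\<Union>t'\<in>cls t. cls (Scale c t')) = cls (Scale c t)"
    using assms by (intro cls_UN cls_eqI) (auto intro: lie_eq.sym lie_eq.Scale_cong)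
  then show ?thesis by (simp add: presented_def)
qed

lemmas presented_simps = presented_ops presented_add presented_bracket presented_smult

lemma presented_vectorspace: "vectorspace class_ring (presented G R)"
proof (rule vs_criteria)
  show "field (class_ring :: 'f ring)"
    by (rule class_field)
  show "\<forall>v\<in>carrier (presented G R).
      \<exists>neg_v\<in>carrier (presented G R). v \<oplus>\<^bsub>presented G R\<^esub> neg_v = \<zero>\<^bsub>presented G R\<^esub>"
  proof
    fix v assume "v \<in> carrier (presented G R)"
    then obtain t where t: "t \<in> lie_terms G" "v = cls t"
      by (auto simp: presented_ops)
    have "lie_eq G R (Add t (Scale (- 1) t)) Zero"
      using t by (intro lie_eq.trans[OF lie_eq.Add_comm lie_eq.Add_inverse]) auto
    then show "\<exists>neg_v\<in>carrier (presented G R).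
        v \<oplus>\<^bsub>presented G R\<^esub> neg_v = \<zero>\<^bsub>presented G R\<^esub>"
      using t by (intro bexI[of _ "cls (Scale (- 1) t)"]) (auto simp: presented_simps cls_eqI)
  qed
  show "\<forall>v\<in>carrier (presented G R). v \<oplus>\<^bsub>presented G R\<^esub> \<zero>\<^bsub>presented G R\<^esub> = v"
  proof
    fix v assume "v \<in> carrier (presented G R)"
    then obtain t where t: "t \<in> lie_terms G" "v = cls t"
      by (auto simp: presented_ops)
    have "lie_eq G R (Add t Zero) t"
      using t by (intro lie_eq.trans[OF lie_eq.Add_comm lie_eq.Add_Zero]) auto
    then show "v \<oplus>\<^bsub>presented G R\<^esub> \<zero>\<^bsub>presented G R\<^esub> = v"
      using t by (auto simp: presented_simps cls_eqI)
  qed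
qed (auto simp: presented_simps simp del: Un_iff del: equalityI intro!: cls_eqI
      intro: lie_eq.Add_comm lie_eq.Add_assoc lie_eq.Scale_times lie_eq.Scale_one
        lie_eq.Scale_plus lie_eq.Scale_Add)

end

section \<open>The parity operator and the grading of a presented superalgebra\<close>

primrec parity_term :: "('g \<Rightarrow> 'f::field) \<Rightarrow> ('f, 'g) lie_term \<Rightarrow> ('f, 'g) lie_term" where
  "parity_term \<epsilon> (Gen g) = Scale (\<epsilon> g) (Gen g)"
| "parity_term \<epsilon> Zero = Zero"
| "parity_term \<epsilon> (Add s t) = Add (parity_term \<epsilon> s) (parity_term \<epsilon> t)"
| "parity_term \<epsilon> (Scale c t) = Scale c (parity_term \<epsilon> t)"
| "parity_term \<epsilon> (Bracket s t) = Bracket (parity_term \<epsilon> s) (parity_term \<epsilon> t)"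

text \<open>Conditions under which the parity operator descends to the quotient: a generator that
  survives must have one degree, and each relation must have the same degree on both sides. Symbols
  such as 0 \<otimes> n carry both degrees, so disjointness of \<open>G 0\<close> and
  \<open>G 1\<close> would be too much to ask.\<close>

locale graded_presentation =
  fixes G :: "bit \<Rightarrow> 'g set"
    and R :: "('f::field, 'g) lie_term \<Rightarrow> ('f, 'g) lie_term \<Rightarrow> bool"
  assumes two: "(2 :: 'f) \<noteq> 0"
    and gens_overlap: "\<lbrakk>g \<in> G 0; g \<in> G 1\<rbrakk> \<Longrightarrow> lie_eq G R (Gen g) Zero"
    and relation_homogeneous: "R s t \<Longrightarrow> \<exists>d. homogeneous G d s \<and> homogeneous G d t"
begin

abbreviation "A \<equiv> presented G R"

sublocale vectorspace class_ring A
  by (rule presented_vectorspace)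

lemma cls_carrier: "t \<in> lie_terms G \<Longrightarrow> cls G R t \<in> carrier A"
  by (simp add: presented_ops)

text \<open>A generator of both degrees gets the sign 1, an arbitrary choice: such a generator is
  congruent to \<open>Zero\<close> by \<open>gens_overlap\<close>.\<close>

definition degree_sign :: "'g \<Rightarrow> 'f" where
  "degree_sign g = (if g \<in> G 0 then 1 else - 1)"

lemma parity_lie_terms: "parity_term \<epsilon> t \<in> lie_terms G \<longleftrightarrow> t \<in> lie_terms G"
  by (induction t) auto

lemma parity_homogeneous: "homogeneous G d t \<Longrightarrow> homogeneous G d (parity_term \<epsilon> t)"
  by (induction rule: homogeneous.induct)
    (unfold parity_term.simps, (blast intro: homogeneous.intros)+)

lemma Scale_Zero_cong: "lie_eq G R t Zero \<Longrightarrow> lie_eq G R (Scale c t) Zero"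
proof -
  assume a: "lie_eq G R t Zero"
  have "lie_eq G R (Scale c t) (Scale c Zero)"
    using a by (rule lie_eq.Scale_cong)
  moreover have "cls G R (Scale c Zero) = cls G R Zero"
    using smult_r_null[of c] by (simp add: presented_simps)
  ultimately show ?thesis
    by (metis cls_eq_iff lie_terms_simps(1) lie_eq.trans)
qed

text \<open>The operator puts a sign at each generator. Bilinearity collects the signs in front of
  the whole expression, where \<open>sg_add\<close> turns their product into the sign of the
  degree.\<close>

lemma parity_eq_sign:
  "homogeneous G d t \<Longrightarrow> lie_eq G R (parity_term degree_sign t) (Scale (sg d) t)"
proof (induction rule: homogeneous.induct)
  case (1 g d)
  show ?case
  proof (cases "g \<in> G 0 \<and> g \<in> G 1")
    case True
    then have z: "lie_eq G R (Gen g) Zero" by (simp add: gens_overlap)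
    show ?thesis
      using Scale_Zero_cong[OF z] by (auto intro: lie_eq.sym lie_eq.trans)
  next
    case False
    with 1 have "degree_sign g = sg d"
      by (cases d) (auto simp: degree_sign_def)
    with 1 show ?thesis
      by (cases d) (auto intro!: lie_eq.refl)
  qed
next
  case (2 d)
  show ?case
    using Scale_Zero_cong[of Zero "sg d"] lie_eq.refl[of Zero G R] by (auto intro: lie_eq.sym)
next
  case (3 d s t)
  then have "lie_eq G R (parity_term degree_sign (Add s t)) (Add (Scale (sg d) s) (Scale (sg d) t))"
    by (auto intro: lie_eq.Add_cong)
  then show ?case
    using 3 by (elim lie_eq.trans) (auto intro!: lie_eq.sym[OF lie_eq.Scale_Add] homogeneous_lie_terms)
next
  case (4 d t c)
  then have t: "t \<in> lie_terms G" by (auto intro: homogeneous_lie_terms)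
  have "lie_eq G R (Scale c (Scale (sg d) t)) (Scale (sg d) (Scale c t))"
    using lie_eq.Scale_times[OF t, of R c "sg d"] lie_eq.Scale_times[OF t, of R "sg d" c]
    by (auto simp: mult.commute intro: lie_eq.sym lie_eq.trans)
  moreover have "lie_eq G R (parity_term degree_sign (Scale c t)) (Scale c (Scale (sg d) t))"
    using 4 by (auto intro: lie_eq.Scale_cong)
  ultimately show ?case
    by (rule lie_eq.trans[rotated])
next
  case (5 a s b t)
  then have st: "s \<in> lie_terms G" "t \<in> lie_terms G" by (auto intro: homogeneous_lie_terms)
  have "lie_eq G R (parity_term degree_sign (Bracket s t)) (Bracket (Scale (sg a) s) (Scale (sg b) t))"
    using 5 by (auto intro: lie_eq.Bracket_cong)
  also have "lie_eq G R \<dots> (Scale (sg a) (Bracket s (Scale (sg b) t)))"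
    using st by (auto intro: lie_eq.Bracket_Scale_left)
  also (lie_eq.trans) have "lie_eq G R \<dots> (Scale (sg a) (Scale (sg b) (Bracket s t)))"
    using st by (auto intro: lie_eq.Bracket_Scale_right lie_eq.Scale_cong)
  also (lie_eq.trans) have "lie_eq G R \<dots> (Scale (sg a * sg b) (Bracket s t))"
    using st by (intro lie_eq.sym[OF lie_eq.Scale_times]) simp
  finally (lie_eq.trans) show ?case by (simp only: sg_add)
qed

text \<open>A relation has one degree \<open>d\<close> on both sides, so both are multiplied by the
  same \<open>sg d\<close>. The graded axioms survive because the operator keeps the shape and the
  degree of an expression.\<close>

lemma parity_cong:
  "lie_eq G R s t \<Longrightarrow> lie_eq G R (parity_term degree_sign s) (parity_term degree_sign t)"
proof (induction rule: lie_eq.induct)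
  case (relation s t)
  then obtain d where d: "homogeneous G d s" "homogeneous G d t"
    using relation_homogeneous by blast
  have "lie_eq G R (parity_term degree_sign s) (Scale (sg d) s)"
    using d by (simp add: parity_eq_sign)
  also have "lie_eq G R \<dots> (Scale (sg d) t)"
    using relation by (auto intro: lie_eq.relation lie_eq.Scale_cong)
  also (lie_eq.trans) have "lie_eq G R \<dots> (parity_term degree_sign t)"
    using d by (auto intro: lie_eq.sym parity_eq_sign)
  finally (lie_eq.trans) show ?case .
next
  case (Bracket_skew a s b t)
  then show ?case
    by (simp only: parity_term.simps) (intro lie_eq.Bracket_skew parity_homogeneous)
next
  case (Bracket_jacobi a s b t d u)
  then show ?case
    by (simp only: parity_term.simps) (intro lie_eq.Bracket_jacobi parity_homogeneous)
qed (auto simp: parity_lie_terms intro: lie_eq.intros)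

text \<open>A class with an even and an odd representative is both fixed and negated by the parity
  operator, so twice the class is zero.\<close>

lemma part_disjoint_presented: "part A 0 \<inter> part A 1 = {\<zero>\<^bsub>A\<^esub>}"
proof (intro equalityI subsetI)
  fix x assume "x \<in> part A 0 \<inter> part A 1"
  then obtain s t where x: "x = cls G R s" "x = cls G R t"
      "homogeneous G 0 s" "homogeneous G 1 t"
    by (auto simp: presented_ops)
  have st: "s \<in> lie_terms G" "t \<in> lie_terms G"
    using x by (auto intro: homogeneous_lie_terms)
  have "lie_eq G R (parity_term degree_sign s) (parity_term degree_sign t)"
    using x st by (intro parity_cong) (simp flip: cls_eq_iff)
  then have "lie_eq G R (Scale 1 s) (Scale (- 1) t)"
    using parity_eq_sign[OF x(3)] parity_eq_sign[OF x(4)] by (simp, meson lie_eq.sym lie_eq.trans)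
  then have e: "1 \<odot>\<^bsub>A\<^esub> x = (- 1) \<odot>\<^bsub>A\<^esub> x"
    using x st by (metis cls_eqI presented_smult)
  have xc: "x \<in> carrier A" using x st by (simp add: presented_ops)
  have "2 \<odot>\<^bsub>A\<^esub> x = 1 \<odot>\<^bsub>A\<^esub> x \<oplus>\<^bsub>A\<^esub> 1 \<odot>\<^bsub>A\<^esub> x"
    using smult_l_distr[of 1 1 x] xc by simp
  also have "\<dots> = 1 \<odot>\<^bsub>A\<^esub> x \<oplus>\<^bsub>A\<^esub> (- 1) \<odot>\<^bsub>A\<^esub> x"
    using e by simp
  also have "\<dots> = \<zero>\<^bsub>A\<^esub>"
    using smult_l_distr[of 1 "-1" x] smult_l_null[of x] xc by simp
  finally have "2 \<odot>\<^bsub>A\<^esub> x = \<zero>\<^bsub>A\<^esub>" .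
  then have "inverse 2 \<odot>\<^bsub>A\<^esub> (2 \<odot>\<^bsub>A\<^esub> x) = \<zero>\<^bsub>A\<^esub>"
    by simp
  then show "x \<in> {\<zero>\<^bsub>A\<^esub>}"
    using smult_assoc1[of "inverse 2" 2 x] smult_one[of x] xc two by simp
next
  fix x assume "x \<in> {\<zero>\<^bsub>A\<^esub>}"
  then show "x \<in> part A 0 \<inter> part A 1"
    by (auto simp: presented_ops intro: homogeneous.intros)
qed

lemma lie_terms_split:
  "t \<in> lie_terms G \<Longrightarrow> \<exists>t0 t1. homogeneous G 0 t0 \<and> homogeneous G 1 t1 \<and> lie_eq G R t (Add t0 t1)"
proof (induction rule: lie_terms_induct)
  case (Gen g d)
  have gl: "Gen g \<in> lie_terms G"
    using Gen by (cases d) auto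
  have z: "lie_eq G R (Gen g) (Add Zero (Gen g))" "lie_eq G R (Gen g) (Add (Gen g) Zero)"
    using gl by (auto intro!: lie_eq.sym[OF lie_eq.Add_Zero]
      lie_eq.trans[OF lie_eq.sym[OF lie_eq.Add_Zero] lie_eq.Add_comm])
  show ?case
    using Gen z by (cases d) (blast intro: homogeneous.intros)+
next
  case Zero
  show ?case
    by (intro exI[of _ Zero]) (auto intro!: homogeneous.intros lie_eq.sym[OF lie_eq.Add_Zero])
next
  case (Add s t)
  then obtain s0 s1 t0 t1 where st: "homogeneous G 0 s0" "homogeneous G 1 s1"
      "homogeneous G 0 t0" "homogeneous G 1 t1"
    and "lie_eq G R s (Add s0 s1)" "lie_eq G R t (Add t0 t1)"
    by blast
  then have e: "cls G R s = cls G R (Add s0 s1)" "cls G R t = cls G R (Add t0 t1)"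
    by (simp_all add: cls_eqI)
  have l: "s0 \<in> lie_terms G" "s1 \<in> lie_terms G" "t0 \<in> lie_terms G" "t1 \<in> lie_terms G"
    using st by (auto intro: homogeneous_lie_terms)
  have "cls G R (Add s t) = cls G R (Add (Add s0 t0) (Add s1 t1))"
    using e l Add by (simp add: cls_carrier a_ac flip: presented_add)
  then have "lie_eq G R (Add s t) (Add (Add s0 t0) (Add s1 t1))"
    using l by (simp add: cls_eq_iff)
  then show ?case
    using st by (blast intro: homogeneous.intros)
next
  case (Scale c t)
  then obtain t0 t1 where t: "homogeneous G 0 t0" "homogeneous G 1 t1"
    and "lie_eq G R t (Add t0 t1)"
    by blast
  then have "lie_eq G R (Scale c t) (Scale c (Add t0 t1))"
    by (auto intro: lie_eq.Scale_cong)
  also have "lie_eq G R \<dots> (Add (Scale c t0) (Scale c t1))"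
    using homogeneous_lie_terms[OF t(1)] homogeneous_lie_terms[OF t(2)]
    by (simp add: lie_eq.Scale_Add)
  finally (lie_eq.trans) show ?case
    using t by (meson homogeneous.intros(4))
next
  case (Bracket s t)
  then obtain s0 s1 t0 t1 where st: "homogeneous G 0 s0" "homogeneous G 1 s1"
      "homogeneous G 0 t0" "homogeneous G 1 t1"
    and e: "lie_eq G R s (Add s0 s1)" "lie_eq G R t (Add t0 t1)"
    by blast
  have l: "s0 \<in> lie_terms G" "s1 \<in> lie_terms G" "t0 \<in> lie_terms G" "t1 \<in> lie_terms G"
    using st by (auto intro: homogeneous_lie_terms)
  have d: "cls G R (Bracket u (Add v w)) = cls G R (Add (Bracket u v) (Bracket u w))"
     "cls G R (Bracket (Add v w) u) = cls G R (Add (Bracket v u) (Bracket w u))"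
    if "u \<in> lie_terms G" "v \<in> lie_terms G" "w \<in> lie_terms G" for u v w
    using that by (simp_all add: cls_eqI lie_eq.Bracket_Add_left lie_eq.Bracket_Add_right)
  have "cls G R (Bracket s t) = cls G R (Bracket (Add s0 s1) (Add t0 t1))"
    using e by (intro cls_eqI lie_eq.Bracket_cong)
  also have "\<dots> = cls G R (Bracket s0 (Add t0 t1)) \<oplus>\<^bsub>A\<^esub> cls G R (Bracket s1 (Add t0 t1))"
    using l d(2)[of "Add t0 t1" s0 s1] by (simp add: presented_add)
  also have "\<dots> = cls G R (Add (Add (Bracket s0 t0) (Bracket s1 t1)) (Add (Bracket s0 t1) (Bracket s1 t0)))"
    using l by (simp add: d cls_carrier a_ac flip: presented_add)
  finally have "lie_eq G R (Bracket s t)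
      (Add (Add (Bracket s0 t0) (Bracket s1 t1)) (Add (Bracket s0 t1) (Bracket s1 t0)))"
    using l by (simp add: cls_eq_iff)
  moreover have "homogeneous G 0 (Add (Bracket s0 t0) (Bracket s1 t1))"
    using st homogeneous.intros(5)[of G 0 s0 0 t0] homogeneous.intros(5)[of G 1 s1 1 t1]
    by (auto intro: homogeneous.intros(3))
  moreover have "homogeneous G 1 (Add (Bracket s0 t1) (Bracket s1 t0))"
    using st homogeneous.intros(5)[of G 0 s0 1 t1] homogeneous.intros(5)[of G 1 s1 0 t0]
    by (auto intro: homogeneous.intros(3))
  ultimately show ?case by blast
qed

lemma submodule_part_presented: "submodule class_ring (part A d) A"
proof (rule submodule.intro)
  show "module class_ring A" by (rule module_axioms)
  show "\<zero>\<^bsub>A\<^esub> \<in> part A d"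
    by (auto simp: presented_ops intro: homogeneous.intros)
  show "part A d \<subseteq> carrier A"
    by (auto simp: presented_ops intro: homogeneous_lie_terms)
  fix v w assume "v \<in> part A d" "w \<in> part A d"
  then show "v \<oplus>\<^bsub>A\<^esub> w \<in> part A d"
    by (auto simp: presented_ops presented_add homogeneous_lie_terms intro!: homogeneous.intros)
next
  fix c :: 'f and v assume "v \<in> part A d"
  then show "c \<odot>\<^bsub>A\<^esub> v \<in> part A d"
    by (auto simp: presented_ops presented_smult homogeneous_lie_terms intro!: homogeneous.intros)
qed

sublocale lie_superalgebra A
proof (intro lie_superalgebra.intro lie_superalgebra_axioms.intro vectorspace_axioms)
  show "subspace class_ring (part A d) A" for d
    by (intro subspace.intro vectorspace_axioms submodule_part_presented)
  show "part A 0 \<inter> part A 1 = {\<zero>\<^bsub>A\<^esub>}"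
    by (rule part_disjoint_presented)
  show "\<exists>x0\<in>part A 0. \<exists>x1\<in>part A 1. x = x0 \<oplus>\<^bsub>A\<^esub> x1" if x: "x \<in> carrier A" for x
  proof -
    obtain t where t: "t \<in> lie_terms G" "x = cls G R t"
      using x by (auto simp: presented_ops)
    from lie_terms_split[OF t(1)] t(2) show ?thesis
      by (force simp: presented_ops presented_add homogeneous_lie_terms cls_eqI)
  qed
  show "bracket A x y \<in> part A (a + b)" if "x \<in> part A a" "y \<in> part A b" for x y a b
    using that homogeneous.intros(5)[of G a _ b]
    by (force simp: presented_ops presented_bracket homogeneous_lie_terms)
  show "bracket A x y = (- sg (a * b)) \<odot>\<^bsub>A\<^esub> bracket A y x"
    if "x \<in> part A a" "y \<in> part A b" for x y a b
    using that lie_eq.Bracket_skew[of G a _ b]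
    by (auto simp: presented_ops presented_bracket presented_smult homogeneous_lie_terms
        simp del: mult_eq_if intro!: cls_eqI del: equalityI)
  show "bracket A x (bracket A y z) =
        bracket A (bracket A x y) z \<oplus>\<^bsub>A\<^esub> sg (a * b) \<odot>\<^bsub>A\<^esub> bracket A y (bracket A x z)"
    if "x \<in> part A a" "y \<in> part A b" "z \<in> part A d" for x y z a b d
    using that lie_eq.Bracket_jacobi[of G a _ b _ d]
    by (auto simp: presented_ops presented_add presented_bracket presented_smult homogeneous_lie_terms
        intro!: cls_eqI del: equalityI)
qed (auto simp: presented_simps intro!: cls_eqI del: equalityI
      intro: lie_eq.Bracket_Add_left lie_eq.Bracket_Add_right
        lie_eq.Bracket_Scale_left lie_eq.Bracket_Scale_right)

end

subsection \<open>Elementary facts on Lie superalgebras\<close>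

context lie_superalgebra
begin

lemma scale_closed [simp]: "x \<in> carrier L \<Longrightarrow> c \<odot>\<^bsub>L\<^esub> x \<in> carrier L"
  by (rule smult_closed) simp_all

lemma scale_0 [simp]: "x \<in> carrier L \<Longrightarrow> 0 \<odot>\<^bsub>L\<^esub> x = \<zero>\<^bsub>L\<^esub>"
  using smult_l_null[of x] by simp

lemma scale_1 [simp]: "x \<in> carrier L \<Longrightarrow> 1 \<odot>\<^bsub>L\<^esub> x = x"
  using smult_one[of x] by simp

lemma scale_zero [simp]: "c \<odot>\<^bsub>L\<^esub> \<zero>\<^bsub>L\<^esub> = \<zero>\<^bsub>L\<^esub>"
  using smult_r_null[of c] by simp

lemma scale_scale [simp]:
  "x \<in> carrier L \<Longrightarrow> c \<odot>\<^bsub>L\<^esub> (d \<odot>\<^bsub>L\<^esub> x) = (c * d) \<odot>\<^bsub>L\<^esub> x"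
  using smult_assoc1[of c d x] by simp

lemma scale_distrib_left:
  "x \<in> carrier L \<Longrightarrow> (c + d) \<odot>\<^bsub>L\<^esub> x = c \<odot>\<^bsub>L\<^esub> x \<oplus>\<^bsub>L\<^esub> d \<odot>\<^bsub>L\<^esub> x"
  using smult_l_distr[of c d x] by simp

lemma scale_distrib_right:
  "\<lbrakk>x \<in> carrier L; y \<in> carrier L\<rbrakk> \<Longrightarrow>
    c \<odot>\<^bsub>L\<^esub> (x \<oplus>\<^bsub>L\<^esub> y) = c \<odot>\<^bsub>L\<^esub> x \<oplus>\<^bsub>L\<^esub> c \<odot>\<^bsub>L\<^esub> y"
  using smult_r_distr[of c x y] by simp

lemma scale_cancel: "\<lbrakk>c \<odot>\<^bsub>L\<^esub> x = \<zero>\<^bsub>L\<^esub>; c \<noteq> 0; x \<in> carrier L\<rbrakk> \<Longrightarrow> x = \<zero>\<^bsub>L\<^esub>"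
  using scale_scale[of x "inverse c" c] by simp

lemma add_scale_minus [simp]:
  "x \<in> carrier L \<Longrightarrow> x \<oplus>\<^bsub>L\<^esub> (- 1) \<odot>\<^bsub>L\<^esub> x = \<zero>\<^bsub>L\<^esub>"
  using scale_distrib_left[of x 1 "- 1"] by simp

lemma neg_eq_scale: "x \<in> carrier L \<Longrightarrow> \<ominus>\<^bsub>L\<^esub> x = (- 1) \<odot>\<^bsub>L\<^esub> x"
  by (metis M.minus_equality M.add.m_comm add_scale_minus scale_closed)

lemma submoduleI:
  assumes "W \<subseteq> carrier L" "\<zero>\<^bsub>L\<^esub> \<in> W"
    and "\<And>v w. v \<in> W \<Longrightarrow> w \<in> W \<Longrightarrow> v \<oplus>\<^bsub>L\<^esub> w \<in> W"
    and "\<And>c v. v \<in> W \<Longrightarrow> c \<odot>\<^bsub>L\<^esub> v \<in> W"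
  shows "submodule class_ring W L"
  using assms by (intro submodule.intro module_axioms) auto

lemma part_submodule: "submodule class_ring (part L d) L"
  using part_subspace[of d] by (rule is_module)

lemma part_carrier: "x \<in> part L d \<Longrightarrow> x \<in> carrier L"
  using submodule.subset[OF part_submodule] by blast

lemma part_zero [simp]: "\<zero>\<^bsub>L\<^esub> \<in> part L d"
  using part_disjoint by (cases d) auto

lemma part_add [simp]: "\<lbrakk>x \<in> part L d; y \<in> part L d\<rbrakk> \<Longrightarrow> x \<oplus>\<^bsub>L\<^esub> y \<in> part L d"
  using submodule.m_closed[OF part_submodule] .

lemma part_scale [simp]: "x \<in> part L d \<Longrightarrow> c \<odot>\<^bsub>L\<^esub> x \<in> part L d"
  using submodule.smult_closed[OF part_submodule, of c x d] by simp

lemma part_both: "\<lbrakk>x \<in> part L a; x \<in> part L b; a \<noteq> b\<rbrakk> \<Longrightarrow> x = \<zero>\<^bsub>L\<^esub>"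
  using part_disjoint by (cases a; cases b) auto

lemma bracket_zero_left [simp]: "y \<in> carrier L \<Longrightarrow> bracket L \<zero>\<^bsub>L\<^esub> y = \<zero>\<^bsub>L\<^esub>"
  using bracket_scale_left[of "\<zero>\<^bsub>L\<^esub>" y 0] bracket_closed[of "\<zero>\<^bsub>L\<^esub>" y] by simp

lemma bracket_zero_right [simp]: "y \<in> carrier L \<Longrightarrow> bracket L y \<zero>\<^bsub>L\<^esub> = \<zero>\<^bsub>L\<^esub>"
  using bracket_scale_right[of y "\<zero>\<^bsub>L\<^esub>" 0] bracket_closed[of y "\<zero>\<^bsub>L\<^esub>"] by simp

lemma span_induct [consumes 2, case_names base zero add scale]:
  assumes "x \<in> span S" "S \<subseteq> carrier L"
    and "\<And>x. x \<in> S \<Longrightarrow> P x" "P \<zero>\<^bsub>L\<^esub>"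
    and "\<And>x y. \<lbrakk>x \<in> carrier L; y \<in> carrier L; P x; P y\<rbrakk> \<Longrightarrow> P (x \<oplus>\<^bsub>L\<^esub> y)"
    and "\<And>c x. \<lbrakk>x \<in> carrier L; P x\<rbrakk> \<Longrightarrow> P (c \<odot>\<^bsub>L\<^esub> x)"
  shows "P x"
proof -
  have "span S \<subseteq> {x \<in> carrier L. P x}"
    using assms(2-) by (intro span_is_subset submoduleI) auto
  with assms(1) show ?thesis by auto
qed

text \<open>In \<open>bit\<close>, \<open>d + 1\<close> is the degree other than \<open>d\<close>,
  so a single definition gives both homogeneous components.\<close>

definition proj :: "bit \<Rightarrow> 'a \<Rightarrow> 'a" where
  "proj d x = (SOME y. y \<in> part L d \<and> (\<exists>z\<in>part L (d + 1). x = y \<oplus>\<^bsub>L\<^esub> z))"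

lemma part_decomposition_unique:
  assumes "x \<oplus>\<^bsub>L\<^esub> y = x' \<oplus>\<^bsub>L\<^esub> y'" "x \<in> part L d" "x' \<in> part L d"
    "y \<in> part L (d + 1)" "y' \<in> part L (d + 1)"
  shows "x = x'"
proof -
  note c = assms(2-5)[THEN part_carrier]
  have "(x \<oplus>\<^bsub>L\<^esub> y) \<oplus>\<^bsub>L\<^esub> \<ominus>\<^bsub>L\<^esub> y = (x' \<oplus>\<^bsub>L\<^esub> y') \<oplus>\<^bsub>L\<^esub> \<ominus>\<^bsub>L\<^esub> y"
    by (simp only: assms(1))
  then have "x = x' \<oplus>\<^bsub>L\<^esub> (y' \<oplus>\<^bsub>L\<^esub> \<ominus>\<^bsub>L\<^esub> y)"
    using c by (simp add: a_assoc r_neg)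
  then have e: "\<ominus>\<^bsub>L\<^esub> x' \<oplus>\<^bsub>L\<^esub> x = y' \<oplus>\<^bsub>L\<^esub> \<ominus>\<^bsub>L\<^esub> y"
    using c by (simp add: r_neg1)
  have "\<ominus>\<^bsub>L\<^esub> x' \<oplus>\<^bsub>L\<^esub> x = \<zero>\<^bsub>L\<^esub>"
  proof (rule part_both[of _ d "d + 1"])
    show "\<ominus>\<^bsub>L\<^esub> x' \<oplus>\<^bsub>L\<^esub> x \<in> part L d"
      using assms c by (simp add: neg_eq_scale)
    show "\<ominus>\<^bsub>L\<^esub> x' \<oplus>\<^bsub>L\<^esub> x \<in> part L (d + 1)"
      unfolding e using assms c by (simp add: neg_eq_scale)
    show "d \<noteq> d + 1"
      by (cases d) simp_all
  qed
  then have "x' \<oplus>\<^bsub>L\<^esub> (\<ominus>\<^bsub>L\<^esub> x' \<oplus>\<^bsub>L\<^esub> x) = x'"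
    using c by simp
  then show ?thesis
    using c by (simp add: r_neg2)
qed

lemma proj_ex:
  assumes "x \<in> carrier L"
  shows "\<exists>y. y \<in> part L d \<and> (\<exists>z\<in>part L (d + 1). x = y \<oplus>\<^bsub>L\<^esub> z)"
proof -
  obtain x0 x1 where x: "x0 \<in> part L 0" "x1 \<in> part L 1" "x = x0 \<oplus>\<^bsub>L\<^esub> x1"
    using part_sum[OF assms] by blast
  then have "x = x1 \<oplus>\<^bsub>L\<^esub> x0"
    using a_comm part_carrier by blast
  with x show ?thesis
    by (intro exI[of _ "if d = 0 then x0 else x1"])
      (auto intro: bexI[of _ x1] bexI[of _ x0])
qed

lemma proj_part [simp]: "x \<in> carrier L \<Longrightarrow> proj d x \<in> part L d"
  unfolding proj_def using someI_ex[OF proj_ex[of x d]] by auto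

lemma proj_eqI:
  assumes "x = y \<oplus>\<^bsub>L\<^esub> z" "y \<in> part L d" "z \<in> part L (d + 1)"
  shows "proj d x = y"
  unfolding proj_def
proof (rule some_equality)
  show "y' = y" if "y' \<in> part L d \<and> (\<exists>z\<in>part L (d + 1). x = y' \<oplus>\<^bsub>L\<^esub> z)" for y'
    using that assms part_decomposition_unique[of y' _ y z d] by blast
qed (use assms in blast)

lemma proj_sum: "x \<in> carrier L \<Longrightarrow> proj 0 x \<oplus>\<^bsub>L\<^esub> proj 1 x = x"
proof -
  assume x: "x \<in> carrier L"
  obtain x0 x1 where h: "x0 \<in> part L 0" "x1 \<in> part L 1" "x = x0 \<oplus>\<^bsub>L\<^esub> x1"
    using part_sum[OF x] by blast
  have "proj 0 x = x0" "proj 1 x = x1"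
    using h part_carrier[of x0 0] part_carrier[of x1 1]
    by (auto intro!: proj_eqI[of _ x0 x1] proj_eqI[of _ x1 x0] simp: a_comm)
  with h show ?thesis by simp
qed

lemma proj_closed [simp]: "x \<in> carrier L \<Longrightarrow> proj d x \<in> carrier L"
  by (rule part_carrier[OF proj_part])

lemma proj_sum': "x \<in> carrier L \<Longrightarrow> x = proj d x \<oplus>\<^bsub>L\<^esub> proj (d + 1) x"
  using proj_sum[of x] a_comm[of "proj 0 x" "proj 1 x"] by (cases d) auto

lemma proj_add:
  assumes "x \<in> carrier L" "y \<in> carrier L"
  shows "proj d (x \<oplus>\<^bsub>L\<^esub> y) = proj d x \<oplus>\<^bsub>L\<^esub> proj d y"
proof (rule proj_eqI)
  show "x \<oplus>\<^bsub>L\<^esub> y = proj d x \<oplus>\<^bsub>L\<^esub> proj d y \<oplus>\<^bsub>L\<^esub> (proj (d + 1) x \<oplus>\<^bsub>L\<^esub> proj (d + 1) y)"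
    using assms proj_sum'[of x d] proj_sum'[of y d]
    by (metis M.add.m_assoc M.add.m_lcomm proj_closed a_closed)
qed (use assms in auto)

lemma proj_scale:
  assumes "x \<in> carrier L"
  shows "proj d (c \<odot>\<^bsub>L\<^esub> x) = c \<odot>\<^bsub>L\<^esub> proj d x"
proof (rule proj_eqI)
  show "c \<odot>\<^bsub>L\<^esub> x = c \<odot>\<^bsub>L\<^esub> proj d x \<oplus>\<^bsub>L\<^esub> c \<odot>\<^bsub>L\<^esub> proj (d + 1) x"
    using assms proj_sum'[of x d] by (simp flip: scale_distrib_right)
qed (use assms in auto)

lemma proj_homogeneous: "x \<in> part L a \<Longrightarrow> proj d x = (if d = a then x else \<zero>\<^bsub>L\<^esub>)"
  using part_carrier[of x a] by (cases a; cases d)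
    (auto intro: proj_eqI[of x x "\<zero>\<^bsub>L\<^esub>"] proj_eqI[of x "\<zero>\<^bsub>L\<^esub>" x])

lemma carrier_induct [consumes 1, case_names part add]:
  assumes "x \<in> carrier L"
    and "\<And>d x. x \<in> part L d \<Longrightarrow> P x"
    and "\<And>x y. \<lbrakk>x \<in> carrier L; y \<in> carrier L; P x; P y\<rbrakk> \<Longrightarrow> P (x \<oplus>\<^bsub>L\<^esub> y)"
  shows "P x"
  by (metis assms proj_closed proj_part proj_sum)

text \<open>The Koszul sign (-1)^(a|x|), extended linearly to inhomogeneous \<open>x\<close>. It
  lets a Leibniz rule be written down before the degree of the factor that is passed is
  known.\<close>

definition twist :: "bit \<Rightarrow> 'a \<Rightarrow> 'a" where
  "twist a x = proj 0 x \<oplus>\<^bsub>L\<^esub> sg a \<odot>\<^bsub>L\<^esub> proj 1 x"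

lemma twist_closed [simp]: "x \<in> carrier L \<Longrightarrow> twist a x \<in> carrier L"
  by (simp add: twist_def)

lemma twist_add:
  "\<lbrakk>x \<in> carrier L; y \<in> carrier L\<rbrakk> \<Longrightarrow> twist a (x \<oplus>\<^bsub>L\<^esub> y) = twist a x \<oplus>\<^bsub>L\<^esub> twist a y"
  by (simp add: twist_def proj_add scale_distrib_right a_ac)

lemma twist_scale: "x \<in> carrier L \<Longrightarrow> twist a (c \<odot>\<^bsub>L\<^esub> x) = c \<odot>\<^bsub>L\<^esub> twist a x"
  by (simp add: twist_def proj_scale scale_distrib_right mult.commute)

lemma twist_homogeneous: "x \<in> part L d \<Longrightarrow> twist a x = sg (a * d) \<odot>\<^bsub>L\<^esub> x"
  using part_carrier[of x d] by (cases d) (simp_all add: twist_def proj_homogeneous)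

end

subsection \<open>Evaluation of formal expressions\<close>

primrec lie_eval :: "('f, 'a) superalgebra \<Rightarrow> ('g \<Rightarrow> 'a) \<Rightarrow> ('f, 'g) lie_term \<Rightarrow> 'a" where
  "lie_eval L f (Gen g) = f g"
| "lie_eval L f Zero = \<zero>\<^bsub>L\<^esub>"
| "lie_eval L f (Add s t) = lie_eval L f s \<oplus>\<^bsub>L\<^esub> lie_eval L f t"
| "lie_eval L f (Scale c t) = c \<odot>\<^bsub>L\<^esub> lie_eval L f t"
| "lie_eval L f (Bracket s t) = bracket L (lie_eval L f s) (lie_eval L f t)"

context lie_superalgebra
begin

lemma lie_eval_part:
  assumes "\<And>g d. g \<in> G d \<Longrightarrow> f g \<in> part L d" "homogeneous G d t"
  shows "lie_eval L f t \<in> part L d"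
  using assms(2) by (induction rule: homogeneous.induct) (auto intro: assms(1) bracket_degree)

lemma lie_eval_carrier:
  assumes "\<And>g d. g \<in> G d \<Longrightarrow> f g \<in> part L d" "t \<in> lie_terms G"
  shows "lie_eval L f t \<in> carrier L"
  using assms(2)
  by (induction rule: lie_terms_induct) (auto dest: assms(1) intro: part_carrier bracket_closed)

text \<open>The universal property of a presentation: once the relations hold in \<open>L\<close>,
  the value of an expression depends on its class alone, since every other rule of the congruence is
  an equivalence or compatibility rule or an axiom of \<open>L\<close>.\<close>

lemma lie_eval_cong:
  assumes f: "\<And>g d. g \<in> G d \<Longrightarrow> f g \<in> part L d"
    and R: "\<And>s t. R s t \<Longrightarrow> lie_eval L f s = lie_eval L f t"
    and "lie_eq G R s t"
  shows "lie_eval L f s = lie_eval L f t"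
  using assms(3)
proof (induction rule: lie_eq.induct)
  case (Bracket_skew a s b t)
  then show ?case
    using super_skew[of "lie_eval L f s" a "lie_eval L f t" b] lie_eval_part[of G f, OF f] by simp
next
  case (Bracket_jacobi a s b t d u)
  then show ?case
    using super_jacobi[of "lie_eval L f s" a "lie_eval L f t" b "lie_eval L f u" d]
      lie_eval_part[of G f, OF f] by simp
qed (auto simp: R lie_eval_carrier[of G f, OF f] scale_distrib_right scale_distrib_left
      bracket_add_left bracket_add_right bracket_scale_left bracket_scale_right a_ac)

end

subsection \<open>The non-abelian tensor product\<close>

text \<open>A common frame for the tensor square and the triple tensor product. The two degree
  conditions make the relations homogeneous, which is what turns the quotient into a Lie
  superalgebra.\<close>

locale tensor_setup = M: lie_superalgebra M + N: lie_superalgebra N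
  for M :: "('f::field, 'm) superalgebra" and N :: "('f, 'n) superalgebra" +
  fixes \<mu> :: "'m \<Rightarrow> 'n \<Rightarrow> 'n" and \<nu> :: "'n \<Rightarrow> 'm \<Rightarrow> 'm"
  assumes two: "(2 :: 'f) \<noteq> 0"
    and mu_degree: "\<lbrakk>m \<in> part M a; n \<in> part N b\<rbrakk> \<Longrightarrow> \<mu> m n \<in> part N (a + b)"
    and nu_degree: "\<lbrakk>n \<in> part N b; m \<in> part M a\<rbrakk> \<Longrightarrow> \<nu> n m \<in> part M (b + a)"
begin

abbreviation T where "T \<equiv> tensor_product M N \<mu> \<nu>"
abbreviation tensor_eq where "tensor_eq \<equiv> lie_eq (tensor_gens M N) (tensor_rel M N \<mu> \<nu>)"
abbreviation ten (infix \<open>\<otimes>\<^sub>t\<close> 75) where "ten \<equiv> tensor M N \<mu> \<nu>"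

lemma tensor_gensI: "\<lbrakk>m \<in> part M a; n \<in> part N b\<rbrakk> \<Longrightarrow> (m, n) \<in> tensor_gens M N (a + b)"
  by (auto simp: tensor_gens_def)

lemma tensor_gensE:
  assumes "g \<in> tensor_gens M N d"
  obtains a b m n where "m \<in> part M a" "n \<in> part N b" "d = a + b" "g = (m, n)"
  using assms by (auto simp: tensor_gens_def)

lemma homogeneous_Gen:
  "\<lbrakk>m \<in> part M a; n \<in> part N b; d = a + b\<rbrakk> \<Longrightarrow> homogeneous (tensor_gens M N) d (Gen (m, n) :: ('f, _) lie_term)"
  by (auto intro: homogeneous.intros tensor_gensI)

lemma Gen_lie_terms:
  "\<lbrakk>m \<in> part M a; n \<in> part N b\<rbrakk> \<Longrightarrow> (Gen (m, n) :: ('f, _) lie_term) \<in> lie_terms (tensor_gens M N)"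
  by (rule homogeneous_lie_terms[OF homogeneous_Gen]) auto

lemma tensor_relI: "tensor_rel M N \<mu> \<nu> s t \<Longrightarrow> tensor_eq s t"
  by (rule lie_eq.relation)

lemma Scale_0_Gen:
  assumes "m \<in> part M a" "n \<in> part N b"
  shows "tensor_eq (Scale 0 (Gen (m, n))) Zero"
proof -
  interpret V: vectorspace class_ring "presented (tensor_gens M N) (tensor_rel M N \<mu> \<nu>)"
    by (rule presented_vectorspace)
  show ?thesis
    using Gen_lie_terms[OF assms] V.smult_l_null[of "lie_class (tensor_gens M N) (tensor_rel M N \<mu> \<nu>) (Gen (m, n))"]
    by (simp add: presented_simps cls_eq_iff del: lie_terms_simps(2))
qed

lemma Gen_zero:
  assumes "m \<in> part M a" "n \<in> part N b" "m = \<zero>\<^bsub>M\<^esub> \<or> n = \<zero>\<^bsub>N\<^esub>"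
  shows "tensor_eq (Gen (m, n)) Zero"
proof -
  have "m = 0 \<odot>\<^bsub>M\<^esub> m \<or> n = 0 \<odot>\<^bsub>N\<^esub> n"
    using assms M.part_carrier N.part_carrier by fastforce
  then have "tensor_eq (Gen (m, n)) (Scale 0 (Gen (m, n)))"
    using tensor_relI[OF tensor_rel.scale_left[OF assms(1,2)], of 0]
      tensor_relI[OF tensor_rel.scale_right[OF assms(1,2)], of 0]
    by auto
  then show ?thesis
    using Scale_0_Gen[OF assms(1,2)] by (rule lie_eq.trans)
qed

sublocale pres: graded_presentation "tensor_gens M N" "tensor_rel M N \<mu> \<nu>"
proof
  show "(2 :: 'f) \<noteq> 0" by (rule two)
next
  fix g assume g: "g \<in> tensor_gens M N 0" "g \<in> tensor_gens M N 1"
  from g(1) obtain a b m n where 1: "m \<in> part M a" "n \<in> part N b" "0 = a + b" "g = (m, n)"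
    by (rule tensor_gensE)
  from g(2) obtain a' b' where 2: "m \<in> part M a'" "n \<in> part N b'" "1 = a' + b'"
    by (rule tensor_gensE) (use 1 in auto)
  \<comment> \<open>The two degree sums differ, so one factor is homogeneous of two different
    degrees and is therefore 0.\<close>
  have "a \<noteq> a' \<or> b \<noteq> b'"
    using 1(3) 2(3) by auto
  then have "m = \<zero>\<^bsub>M\<^esub> \<or> n = \<zero>\<^bsub>N\<^esub>"
    using 1 2 M.part_both[of m a a'] N.part_both[of n b b'] by blast
  with 1 show "tensor_eq (Gen g) Zero"
    by (auto intro: Gen_zero)
next
  fix s t assume "tensor_rel M N \<mu> \<nu> s t"
  then show "\<exists>d. homogeneous (tensor_gens M N) d s \<and> homogeneous (tensor_gens M N) d t"
  proof cases
    case (add_left m a m' n b)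
    then show ?thesis
      by (intro exI[of _ "a + b"]) (auto intro!: homogeneous.intros(3) intro: homogeneous_Gen M.part_add N.part_add)
  next
    case (add_right m a n b n')
    then show ?thesis
      by (intro exI[of _ "a + b"]) (auto intro!: homogeneous.intros(3) intro: homogeneous_Gen M.part_add N.part_add)
  next
    case (scale_left m a n b c)
    then show ?thesis
      by (intro exI[of _ "a + b"]) (auto intro!: homogeneous.intros(4) intro: homogeneous_Gen M.part_scale N.part_scale)
  next
    case (scale_right m a n b c)
    then show ?thesis
      by (intro exI[of _ "a + b"]) (auto intro!: homogeneous.intros(4) intro: homogeneous_Gen M.part_scale N.part_scale)
  next
    case (bracket_left m a m' a' n b)
    then show ?thesis
      by (intro exI[of _ "a + a' + b"])
        (auto intro!: homogeneous.intros(3,4) intro: homogeneous_Gen mu_degree M.bracket_degree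
          simp: add_ac)
  next
    case (bracket_right m a n b n' b')
    then show ?thesis
      by (intro exI[of _ "a + b + b'"])
        (auto intro!: homogeneous.intros(3,4) intro: homogeneous_Gen nu_degree N.bracket_degree
          simp: add_ac)
  next
    case (bracket_tensor m a n b m' a' n' b')
    then have "homogeneous (tensor_gens M N) ((a + b) + (a' + b')) s"
      by (auto intro!: homogeneous.intros(5) homogeneous_Gen)
    moreover have "homogeneous (tensor_gens M N) ((a + b) + (a' + b')) t"
      using bracket_tensor
      by (auto intro!: homogeneous.intros(4) intro: homogeneous_Gen mu_degree nu_degree simp: add_ac)
    ultimately show ?thesis by blast
  qed
qed

sublocale T: lie_superalgebra T
  unfolding tensor_product_def by (rule pres.lie_superalgebra_axioms)

lemma T_simps:
  "carrier T = lie_class (tensor_gens M N) (tensor_rel M N \<mu> \<nu>) ` lie_terms (tensor_gens M N)"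
  "part T d = lie_class (tensor_gens M N) (tensor_rel M N \<mu> \<nu>) ` {t. homogeneous (tensor_gens M N) d t}"
  "\<zero>\<^bsub>T\<^esub> = lie_class (tensor_gens M N) (tensor_rel M N \<mu> \<nu>) Zero"
  by (simp_all add: presented_simps tensor_product_def)

lemma tensor_part: "\<lbrakk>m \<in> part M a; n \<in> part N b\<rbrakk> \<Longrightarrow> m \<otimes>\<^sub>t n \<in> part T (a + b)"
  by (auto simp: tensor_product_def tensor_def presented_simps homogeneous_Gen)

lemma tensor_carrier: "\<lbrakk>m \<in> part M a; n \<in> part N b\<rbrakk> \<Longrightarrow> m \<otimes>\<^sub>t n \<in> carrier T"
  by (rule T.part_carrier[OF tensor_part])

lemma tensor_add_left:
  assumes "m \<in> part M a" "m' \<in> part M a" "n \<in> part N b"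
  shows "(m \<oplus>\<^bsub>M\<^esub> m') \<otimes>\<^sub>t n = m \<otimes>\<^sub>t n \<oplus>\<^bsub>T\<^esub> m' \<otimes>\<^sub>t n"
  using Gen_lie_terms[OF assms(1,3)] Gen_lie_terms[OF assms(2,3)] cls_eqI[OF tensor_relI[OF tensor_rel.add_left[OF assms]]]
  by (simp add: tensor_product_def tensor_def presented_simps del: lie_terms_simps(2))

lemma tensor_add_right:
  assumes "m \<in> part M a" "n \<in> part N b" "n' \<in> part N b"
  shows "m \<otimes>\<^sub>t (n \<oplus>\<^bsub>N\<^esub> n') = m \<otimes>\<^sub>t n \<oplus>\<^bsub>T\<^esub> m \<otimes>\<^sub>t n'"
  using Gen_lie_terms[OF assms(1,2)] Gen_lie_terms[OF assms(1,3)] cls_eqI[OF tensor_relI[OF tensor_rel.add_right[OF assms]]]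
  by (simp add: tensor_product_def tensor_def presented_simps del: lie_terms_simps(2))

lemma tensor_scale_left:
  assumes "m \<in> part M a" "n \<in> part N b"
  shows "(c \<odot>\<^bsub>M\<^esub> m) \<otimes>\<^sub>t n = c \<odot>\<^bsub>T\<^esub> m \<otimes>\<^sub>t n"
  using Gen_lie_terms[OF assms] cls_eqI[OF tensor_relI[OF tensor_rel.scale_left[OF assms]]]
  by (simp add: tensor_product_def tensor_def presented_simps del: lie_terms_simps(2))

lemma tensor_scale_right:
  assumes "m \<in> part M a" "n \<in> part N b"
  shows "m \<otimes>\<^sub>t (c \<odot>\<^bsub>N\<^esub> n) = c \<odot>\<^bsub>T\<^esub> m \<otimes>\<^sub>t n"
  using Gen_lie_terms[OF assms] cls_eqI[OF tensor_relI[OF tensor_rel.scale_right[OF assms]]]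
  by (simp add: tensor_product_def tensor_def presented_simps del: lie_terms_simps(2))

lemma tensor_zero_left: "n \<in> part N b \<Longrightarrow> \<zero>\<^bsub>M\<^esub> \<otimes>\<^sub>t n = \<zero>\<^bsub>T\<^esub>"
  using cls_eqI[OF Gen_zero[of "\<zero>\<^bsub>M\<^esub>" 0 n b]] by (simp add: tensor_def T_simps)

lemma tensor_zero_right: "m \<in> part M a \<Longrightarrow> m \<otimes>\<^sub>t \<zero>\<^bsub>N\<^esub> = \<zero>\<^bsub>T\<^esub>"
  using cls_eqI[OF Gen_zero[of m a "\<zero>\<^bsub>N\<^esub>" 0]] by (simp add: tensor_def T_simps)

lemma tensor_bracket_left:
  assumes "m \<in> part M a" "m' \<in> part M a'" "n \<in> part N b"
  shows "bracket M m m' \<otimes>\<^sub>t n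
    = m \<otimes>\<^sub>t \<mu> m' n \<oplus>\<^bsub>T\<^esub> (- sg (a * a')) \<odot>\<^bsub>T\<^esub> m' \<otimes>\<^sub>t \<mu> m n"
  using Gen_lie_terms[OF assms(1) mu_degree[OF assms(2,3)]]
    Gen_lie_terms[OF assms(2) mu_degree[OF assms(1,3)]]
    cls_eqI[OF tensor_relI[OF tensor_rel.bracket_left[OF assms]]]
  by (simp add: tensor_product_def tensor_def presented_simps del: lie_terms_simps(2))

lemma tensor_bracket_right:
  assumes "m \<in> part M a" "n \<in> part N b" "n' \<in> part N b'"
  shows "m \<otimes>\<^sub>t bracket N n n'
    = sg (b' * (a + b)) \<odot>\<^bsub>T\<^esub> \<nu> n' m \<otimes>\<^sub>t n \<oplus>\<^bsub>T\<^esub> (- sg (a * b)) \<odot>\<^bsub>T\<^esub> \<nu> n m \<otimes>\<^sub>t n'"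
  using Gen_lie_terms[OF nu_degree[OF assms(3,1)] assms(2)]
    Gen_lie_terms[OF nu_degree[OF assms(2,1)] assms(3)]
    cls_eqI[OF tensor_relI[OF tensor_rel.bracket_right[OF assms]]]
  by (simp add: tensor_product_def tensor_def presented_simps del: lie_terms_simps(2))

lemma bracket_tensor:
  assumes "m \<in> part M a" "n \<in> part N b" "m' \<in> part M a'" "n' \<in> part N b'"
  shows "bracket T (m \<otimes>\<^sub>t n) (m' \<otimes>\<^sub>t n') = (- sg (a * b)) \<odot>\<^bsub>T\<^esub> \<nu> n m \<otimes>\<^sub>t \<mu> m' n'"
  using Gen_lie_terms[OF assms(1,2)] Gen_lie_terms[OF assms(3,4)]
    Gen_lie_terms[OF nu_degree[OF assms(2,1)] mu_degree[OF assms(3,4)]]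
    cls_eqI[OF tensor_relI[OF tensor_rel.bracket_tensor[OF assms]]]
  by (simp add: tensor_product_def tensor_def presented_simps del: lie_terms_simps(2))

definition tensors :: "bit \<Rightarrow> ('f, 'm \<times> 'n) lie_term set set" where
  "tensors d = {m \<otimes>\<^sub>t n | a b m n. m \<in> part M a \<and> n \<in> part N b \<and> d = a + b}"

lemma tensors_part: "tensors d \<subseteq> part T d"
  by (auto simp: tensors_def tensor_part)

lemma tensors_carrier: "tensors d \<subseteq> carrier T"
  using tensors_part T.part_carrier by blast

lemma span_tensors_add: "\<lbrakk>x \<in> T.span (tensors d); y \<in> T.span (tensors d)\<rbrakk> \<Longrightarrow>
    x \<oplus>\<^bsub>T\<^esub> y \<in> T.span (tensors d)"
  by (rule T.span_add1[OF tensors_carrier])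

lemma span_tensors_scale: "x \<in> T.span (tensors d) \<Longrightarrow> c \<odot>\<^bsub>T\<^esub> x \<in> T.span (tensors d)"
  using submodule.smult_closed[OF T.span_is_submodule[OF tensors_carrier], of c x d] by simp

lemma tensor_mem_span:
  "\<lbrakk>m \<in> part M a; n \<in> part N b; d = a + b\<rbrakk> \<Longrightarrow> m \<otimes>\<^sub>t n \<in> T.span (tensors d)"
  by (rule T.span_mem[OF tensors_carrier]) (auto simp: tensors_def)

text \<open>By \<open>bracket_tensor\<close> the bracket of two symbols is a multiple of a symbol,
  so the linear span of the symbols is already closed under brackets. Hence the generated algebra is
  nothing but this span.\<close>

lemma span_tensors_bracket:
  assumes "x \<in> T.span (tensors d)" "y \<in> T.span (tensors e)"
  shows "bracket T x y \<in> T.span (tensors (d + e))"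
  using assms(1) tensors_carrier
proof (induction rule: T.span_induct)
  case (base x)
  then obtain a b m n where x: "x = m \<otimes>\<^sub>t n" "m \<in> part M a" "n \<in> part N b" "d = a + b"
    by (auto simp: tensors_def)
  have xc: "x \<in> carrier T"
    using x tensor_carrier by blast
  show ?case
    using assms(2) tensors_carrier
  proof (induction rule: T.span_induct)
    case (base y)
    then obtain a' b' m' n' where y: "y = m' \<otimes>\<^sub>t n'" "m' \<in> part M a'" "n' \<in> part N b'" "e = a' + b'"
      by (auto simp: tensors_def)
    have "\<nu> n m \<otimes>\<^sub>t \<mu> m' n' \<in> T.span (tensors (d + e))"
      using x y by (intro tensor_mem_span[of _ "b + a" _ "a' + b'"] mu_degree nu_degree)
        (auto simp: add_ac)
    then show ?case
      using x y by (simp add: bracket_tensor span_tensors_scale)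
  qed (use xc in \<open>auto simp: T.bracket_add_right T.bracket_scale_right span_tensors_add
      span_tensors_scale T.span_zero\<close>)
next
  case zero
  have "y \<in> carrier T"
    using T.span_closed[OF tensors_carrier assms(2)] .
  then show ?case
    by (simp add: T.span_zero)
next
  case (add x x')
  moreover have "y \<in> carrier T"
    using T.span_closed[OF tensors_carrier assms(2)] .
  ultimately show ?case
    by (simp add: T.bracket_add_left span_tensors_add)
next
  case (scale c x)
  moreover have "y \<in> carrier T"
    using T.span_closed[OF tensors_carrier assms(2)] .
  ultimately show ?case
    by (simp add: T.bracket_scale_left span_tensors_scale)
qed

lemma part_eq_span_tensors: "part T d = T.span (tensors d)"
proof
  show "T.span (tensors d) \<subseteq> part T d"
    by (intro T.span_is_subset tensors_part T.part_submodule)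
  have "lie_class (tensor_gens M N) (tensor_rel M N \<mu> \<nu>) t \<in> T.span (tensors d)"
    if "homogeneous (tensor_gens M N) d t" for t
    using that
  proof (induction rule: homogeneous.induct)
    case (1 g d)
    then show ?case
      by (auto elim!: tensor_gensE intro: tensor_mem_span simp flip: tensor_def)
  next
    case (2 d)
    show ?case
      using T.span_zero by (simp add: T_simps)
  next
    case (3 d s t)
    then show ?case
      using span_tensors_add[OF 3(3,4)]
      by (simp add: homogeneous_lie_terms tensor_product_def presented_simps)
  next
    case (4 d t c)
    then show ?case
      using span_tensors_scale[OF 4(2), of c]
      by (simp add: homogeneous_lie_terms tensor_product_def presented_simps)
  next
    case (5 a s b t)
    then show ?case
      using span_tensors_bracket[OF 5(3,4)]
      by (simp add: homogeneous_lie_terms tensor_product_def presented_simps)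
  qed
  then show "part T d \<subseteq> T.span (tensors d)"
    by (auto simp: T_simps)
qed

text \<open>Since the symbols span linearly, an induction over the tensor product has no bracket
  case; linear statements are checked on symbols.\<close>

lemma tensor_induct [consumes 1, case_names tensor zero add scale]:
  assumes "t \<in> carrier T"
    and "\<And>m n a b. \<lbrakk>m \<in> part M a; n \<in> part N b\<rbrakk> \<Longrightarrow> P (m \<otimes>\<^sub>t n)"
    and "P \<zero>\<^bsub>T\<^esub>"
    and "\<And>x y. \<lbrakk>x \<in> carrier T; y \<in> carrier T; P x; P y\<rbrakk> \<Longrightarrow> P (x \<oplus>\<^bsub>T\<^esub> y)"
    and "\<And>c x. \<lbrakk>x \<in> carrier T; P x\<rbrakk> \<Longrightarrow> P (c \<odot>\<^bsub>T\<^esub> x)"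
  shows "P t"
  using assms(1)
proof (induction rule: T.carrier_induct)
  case (part d x)
  then show ?case
    unfolding part_eq_span_tensors using tensors_carrier
    by (induction rule: T.span_induct) (auto simp: tensors_def intro: assms)
qed (auto intro: assms)

text \<open>The symbols are only available for homogeneous arguments; the bilinear extension
  \<open>bitensor\<close> to arbitrary arguments makes all degree bookkeeping disappear from linear steps.\<close>

definition bitensor (infix \<open>\<otimes>\<^sub>b\<close> 75) where
  "m \<otimes>\<^sub>b n =
    (M.proj 0 m \<otimes>\<^sub>t N.proj 0 n \<oplus>\<^bsub>T\<^esub> M.proj 0 m \<otimes>\<^sub>t N.proj 1 n) \<oplus>\<^bsub>T\<^esub>
    (M.proj 1 m \<otimes>\<^sub>t N.proj 0 n \<oplus>\<^bsub>T\<^esub> M.proj 1 m \<otimes>\<^sub>t N.proj 1 n)"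

lemma tensor_proj_carrier [simp]:
  "\<lbrakk>m \<in> carrier M; n \<in> carrier N\<rbrakk> \<Longrightarrow> M.proj a m \<otimes>\<^sub>t N.proj b n \<in> carrier T"
  by (rule tensor_carrier[of _ a _ b]) auto

lemma bitensor_closed [simp]: "\<lbrakk>m \<in> carrier M; n \<in> carrier N\<rbrakk> \<Longrightarrow> m \<otimes>\<^sub>b n \<in> carrier T"
  by (simp add: bitensor_def)

lemma bitensor_add_left:
  assumes "m \<in> carrier M" "m' \<in> carrier M" "n \<in> carrier N"
  shows "(m \<oplus>\<^bsub>M\<^esub> m') \<otimes>\<^sub>b n = m \<otimes>\<^sub>b n \<oplus>\<^bsub>T\<^esub> m' \<otimes>\<^sub>b n"
proof -
  have "M.proj a (m \<oplus>\<^bsub>M\<^esub> m') \<otimes>\<^sub>t N.proj b n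
      = M.proj a m \<otimes>\<^sub>t N.proj b n \<oplus>\<^bsub>T\<^esub> M.proj a m' \<otimes>\<^sub>t N.proj b n" for a b
    using tensor_add_left[of "M.proj a m" a "M.proj a m'" "N.proj b n" b] assms
    by (simp add: M.proj_add)
  then show ?thesis
    using assms by (simp add: bitensor_def T.a_ac)
qed

lemma bitensor_add_right:
  assumes "m \<in> carrier M" "n \<in> carrier N" "n' \<in> carrier N"
  shows "m \<otimes>\<^sub>b (n \<oplus>\<^bsub>N\<^esub> n') = m \<otimes>\<^sub>b n \<oplus>\<^bsub>T\<^esub> m \<otimes>\<^sub>b n'"
proof -
  have "M.proj a m \<otimes>\<^sub>t N.proj b (n \<oplus>\<^bsub>N\<^esub> n')
      = M.proj a m \<otimes>\<^sub>t N.proj b n \<oplus>\<^bsub>T\<^esub> M.proj a m \<otimes>\<^sub>t N.proj b n'" for a b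
    using tensor_add_right[of "M.proj a m" a "N.proj b n" b "N.proj b n'"] assms
    by (simp add: N.proj_add)
  then show ?thesis
    using assms by (simp add: bitensor_def T.a_ac)
qed

lemma bitensor_scale_left:
  assumes "m \<in> carrier M" "n \<in> carrier N"
  shows "(c \<odot>\<^bsub>M\<^esub> m) \<otimes>\<^sub>b n = c \<odot>\<^bsub>T\<^esub> m \<otimes>\<^sub>b n"
proof -
  have "M.proj a (c \<odot>\<^bsub>M\<^esub> m) \<otimes>\<^sub>t N.proj b n = c \<odot>\<^bsub>T\<^esub> M.proj a m \<otimes>\<^sub>t N.proj b n" for a b
    using tensor_scale_left[of "M.proj a m" a "N.proj b n" b] assms by (simp add: M.proj_scale)
  then show ?thesis
    using assms by (simp add: bitensor_def T.scale_distrib_right)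
qed

lemma bitensor_scale_right:
  assumes "m \<in> carrier M" "n \<in> carrier N"
  shows "m \<otimes>\<^sub>b (c \<odot>\<^bsub>N\<^esub> n) = c \<odot>\<^bsub>T\<^esub> m \<otimes>\<^sub>b n"
proof -
  have "M.proj a m \<otimes>\<^sub>t N.proj b (c \<odot>\<^bsub>N\<^esub> n) = c \<odot>\<^bsub>T\<^esub> M.proj a m \<otimes>\<^sub>t N.proj b n" for a b
    using tensor_scale_right[of "M.proj a m" a "N.proj b n" b] assms by (simp add: N.proj_scale)
  then show ?thesis
    using assms by (simp add: bitensor_def T.scale_distrib_right)
qed

lemma bitensor_eq: "\<lbrakk>m \<in> part M a; n \<in> part N b\<rbrakk> \<Longrightarrow> m \<otimes>\<^sub>b n = m \<otimes>\<^sub>t n"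
  using tensor_zero_left[of _ 0] tensor_zero_left[of _ 1] tensor_zero_right[of _ 0]
    tensor_zero_right[of _ 1] tensor_carrier[of m a n b]
  by (cases a; cases b) (simp_all add: bitensor_def M.proj_homogeneous N.proj_homogeneous)

lemma bitensor_part: "\<lbrakk>m \<in> part M a; n \<in> part N b\<rbrakk> \<Longrightarrow> m \<otimes>\<^sub>b n \<in> part T (a + b)"
  by (simp add: bitensor_eq tensor_part)

lemma bitensor_zero_left [simp]: "n \<in> carrier N \<Longrightarrow> \<zero>\<^bsub>M\<^esub> \<otimes>\<^sub>b n = \<zero>\<^bsub>T\<^esub>"
  using bitensor_scale_left[of "\<zero>\<^bsub>M\<^esub>" n 0] by simp

lemma bitensor_zero_right [simp]: "m \<in> carrier M \<Longrightarrow> m \<otimes>\<^sub>b \<zero>\<^bsub>N\<^esub> = \<zero>\<^bsub>T\<^esub>"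
  using bitensor_scale_right[of m "\<zero>\<^bsub>N\<^esub>" 0] by simp

lemma bitensor_bracket_left:
  "\<lbrakk>m \<in> part M a; m' \<in> part M a'; n \<in> part N b\<rbrakk> \<Longrightarrow> bracket M m m' \<otimes>\<^sub>b n
    = m \<otimes>\<^sub>b \<mu> m' n \<oplus>\<^bsub>T\<^esub> (- sg (a * a')) \<odot>\<^bsub>T\<^esub> m' \<otimes>\<^sub>b \<mu> m n"
  using mu_degree[of m a n b] mu_degree[of m' a' n b] M.bracket_degree[of m a m' a']
  by (simp add: bitensor_eq tensor_bracket_left)

lemma bitensor_bracket_right:
  "\<lbrakk>m \<in> part M a; n \<in> part N b; n' \<in> part N b'\<rbrakk> \<Longrightarrow> m \<otimes>\<^sub>b bracket N n n'
    = sg (b' * (a + b)) \<odot>\<^bsub>T\<^esub> \<nu> n' m \<otimes>\<^sub>b n \<oplus>\<^bsub>T\<^esub> (- sg (a * b)) \<odot>\<^bsub>T\<^esub> \<nu> n m \<otimes>\<^sub>b n'"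
  using nu_degree[of n b m a] nu_degree[of n' b' m a] N.bracket_degree[of n b n' b']
  by (simp add: bitensor_eq tensor_bracket_right)

lemma bracket_bitensor:
  "\<lbrakk>m \<in> part M a; n \<in> part N b; m' \<in> part M a'; n' \<in> part N b'\<rbrakk> \<Longrightarrow>
    bracket T (m \<otimes>\<^sub>b n) (m' \<otimes>\<^sub>b n') = (- sg (a * b)) \<odot>\<^bsub>T\<^esub> \<nu> n m \<otimes>\<^sub>b \<mu> m' n'"
  using nu_degree[of n b m a] mu_degree[of m' a' n' b']
  by (simp add: bitensor_eq bracket_tensor)

end

section \<open>Homomorphisms out of presented superalgebras\<close>

lemma lie_hom_iff:
  "F \<in> lie_hom L M \<longleftrightarrow>
    (\<forall>x\<in>carrier L. F x \<in> carrier M) \<and>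
    (\<forall>x\<in>carrier L. \<forall>y\<in>carrier L. F (x \<oplus>\<^bsub>L\<^esub> y) = F x \<oplus>\<^bsub>M\<^esub> F y) \<and>
    (\<forall>c. \<forall>x\<in>carrier L. F (c \<odot>\<^bsub>L\<^esub> x) = c \<odot>\<^bsub>M\<^esub> F x) \<and>
    (\<forall>d. \<forall>x\<in>part L d. F x \<in> part M d) \<and>
    (\<forall>x\<in>carrier L. \<forall>y\<in>carrier L. F (bracket L x y) = bracket M (F x) (F y))"
  by (auto simp: lie_hom_def LinearCombinations.module_hom_def)

text \<open>Transports a function on expressions to classes through a chosen representative;
  \<open>on_class_cls\<close> shows that the choice is irrelevant when the function respects the
  congruence.\<close>

definition on_class :: "('t \<Rightarrow> 'b) \<Rightarrow> 't set \<Rightarrow> 'b" where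
  "on_class f X = f (SOME t. t \<in> X)"

lemma on_class_cls:
  assumes "\<And>s t. lie_eq G R s t \<Longrightarrow> f s = f t" "t \<in> lie_terms G"
  shows "on_class f (lie_class G R t) = f t"
proof -
  have "(SOME s. s \<in> lie_class G R t) \<in> lie_class G R t"
    using cls_self[OF assms(2)] by (rule someI)
  then show ?thesis
    using assms(1) by (auto simp: on_class_def lie_class_def dest: lie_eq.sym)
qed

lemma (in lie_superalgebra) add_scale_neg [simp]:
  "x \<in> carrier L \<Longrightarrow> c \<odot>\<^bsub>L\<^esub> x \<oplus>\<^bsub>L\<^esub> (- c) \<odot>\<^bsub>L\<^esub> x = \<zero>\<^bsub>L\<^esub>"
  by (simp flip: scale_distrib_left)

lemma (in lie_superalgebra) add_scale_neg' [simp]: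
  "\<lbrakk>x \<in> carrier L; y \<in> carrier L\<rbrakk> \<Longrightarrow> (y \<oplus>\<^bsub>L\<^esub> c \<odot>\<^bsub>L\<^esub> x) \<oplus>\<^bsub>L\<^esub> (- c) \<odot>\<^bsub>L\<^esub> x = y"
  by (simp add: a_assoc)

declare (in lie_superalgebra) bracket_closed [simp]

lemmas (in lie_superalgebra) bracket_linear =
  bracket_add_left bracket_add_right bracket_scale_left bracket_scale_right

text \<open>The form that the relation \<open>bracket_left\<close> of the tensor square takes when
  every symbol is replaced by the bracket of its factors. \<open>jacobi_right\<close> does the same
  for \<open>bracket_right\<close>, with the signs of that relation.\<close>

lemma (in lie_superalgebra) jacobi_left:
  assumes "x \<in> part L a" "y \<in> part L b" "z \<in> part L d"
  shows "bracket L (bracket L x y) z =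
    bracket L x (bracket L y z) \<oplus>\<^bsub>L\<^esub> (- sg (a * b)) \<odot>\<^bsub>L\<^esub> bracket L y (bracket L x z)"
  using assms[THEN part_carrier] by (simp add: super_jacobi[OF assms])

lemma (in lie_superalgebra) jacobi_right:
  assumes "x \<in> part L a" "y \<in> part L b" "z \<in> part L d"
  shows "bracket L x (bracket L y z) =
    sg (d * (a + b)) \<odot>\<^bsub>L\<^esub> bracket L (bracket L z x) y \<oplus>\<^bsub>L\<^esub>
    (- sg (a * b)) \<odot>\<^bsub>L\<^esub> bracket L (bracket L y x) z"
proof -
  note c = assms[THEN part_carrier]
  have "bracket L x (bracket L y z)
      = bracket L (bracket L x y) z \<oplus>\<^bsub>L\<^esub> sg (a * b) \<odot>\<^bsub>L\<^esub> bracket L y (bracket L x z)"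
    by (rule super_jacobi[OF assms])
  moreover have "bracket L y (bracket L x z)
      = (- sg (b * (a + d))) \<odot>\<^bsub>L\<^esub> bracket L (bracket L x z) y"
    using super_skew[OF assms(2) bracket_degree[OF assms(1,3)]] .
  moreover have "bracket L x z = (- sg (a * d)) \<odot>\<^bsub>L\<^esub> bracket L z x"
    using super_skew[OF assms(1,3)] .
  moreover have "bracket L x y = (- sg (a * b)) \<odot>\<^bsub>L\<^esub> bracket L y x"
    using super_skew[OF assms(1,2)] .
  ultimately show ?thesis
    using c by (cases a; cases b; cases d) (simp_all add: bracket_linear a_comm)
qed

lemma lie_hom_zero:
  assumes "lie_superalgebra L" "lie_superalgebra M" "F \<in> lie_hom L M"
  shows "F \<zero>\<^bsub>L\<^esub> = \<zero>\<^bsub>M\<^esub>"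
proof -
  interpret L: lie_superalgebra L by fact
  interpret M: lie_superalgebra M by fact
  have "F (0 \<odot>\<^bsub>L\<^esub> \<zero>\<^bsub>L\<^esub>) = 0 \<odot>\<^bsub>M\<^esub> F \<zero>\<^bsub>L\<^esub>"
    using assms(3) L.zero_closed unfolding lie_hom_iff by blast
  moreover have "F \<zero>\<^bsub>L\<^esub> \<in> carrier M"
    using assms(3) by (simp add: lie_hom_iff)
  ultimately show ?thesis by simp
qed

context tensor_setup
begin

lemma cls_simps:
  "\<lbrakk>s \<in> lie_terms (tensor_gens M N); t \<in> lie_terms (tensor_gens M N)\<rbrakk> \<Longrightarrow>
    lie_class (tensor_gens M N) (tensor_rel M N \<mu> \<nu>) (Add s t) =
      lie_class (tensor_gens M N) (tensor_rel M N \<mu> \<nu>) s \<oplus>\<^bsub>T\<^esub>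
      lie_class (tensor_gens M N) (tensor_rel M N \<mu> \<nu>) t"
  "t \<in> lie_terms (tensor_gens M N) \<Longrightarrow>
    lie_class (tensor_gens M N) (tensor_rel M N \<mu> \<nu>) (Scale c t) =
      c \<odot>\<^bsub>T\<^esub> lie_class (tensor_gens M N) (tensor_rel M N \<mu> \<nu>) t"
  "\<lbrakk>s \<in> lie_terms (tensor_gens M N); t \<in> lie_terms (tensor_gens M N)\<rbrakk> \<Longrightarrow>
    lie_class (tensor_gens M N) (tensor_rel M N \<mu> \<nu>) (Bracket s t) =
      bracket T (lie_class (tensor_gens M N) (tensor_rel M N \<mu> \<nu>) s)
        (lie_class (tensor_gens M N) (tensor_rel M N \<mu> \<nu>) t)"
  "lie_class (tensor_gens M N) (tensor_rel M N \<mu> \<nu>) Zero = \<zero>\<^bsub>T\<^esub>"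
  by (simp_all add: tensor_product_def presented_simps)

lemma cls_in_carrier:
  "t \<in> lie_terms (tensor_gens M N) \<Longrightarrow>
    lie_class (tensor_gens M N) (tensor_rel M N \<mu> \<nu>) t \<in> carrier T"
  by (simp add: T_simps)

lemma tensor_hom_exists:
  assumes A: "lie_superalgebra A"
    and f: "\<And>m n a b. \<lbrakk>m \<in> part M a; n \<in> part N b\<rbrakk> \<Longrightarrow> f (m, n) \<in> part A (a + b)"
    and R: "\<And>s t. tensor_rel M N \<mu> \<nu> s t \<Longrightarrow> lie_eval A f s = lie_eval A f t"
  shows "\<exists>F\<in>lie_hom T A. \<forall>a b. \<forall>m\<in>part M a. \<forall>n\<in>part N b. F (m \<otimes>\<^sub>t n) = f (m, n)"
proof -
  interpret A: lie_superalgebra A by (rule A)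
  have g: "f g \<in> part A d" if "g \<in> tensor_gens M N d" for g d
    using that f by (auto elim: tensor_gensE)
  have cong: "lie_eval A f s = lie_eval A f t" if "tensor_eq s t" for s t
    using A.lie_eval_cong[of "tensor_gens M N" f] g R that by blast
  have ev: "on_class (lie_eval A f) (lie_class (tensor_gens M N) (tensor_rel M N \<mu> \<nu>) t) = lie_eval A f t"
    if "t \<in> lie_terms (tensor_gens M N)" for t
    using on_class_cls[of "tensor_gens M N" "tensor_rel M N \<mu> \<nu>" "lie_eval A f" t] cong that by blast
  have ec: "lie_eval A f t \<in> carrier A" if "t \<in> lie_terms (tensor_gens M N)" for t
    using A.lie_eval_carrier[of "tensor_gens M N" f] g that by blast
  have ep: "lie_eval A f t \<in> part A d" if "homogeneous (tensor_gens M N) d t" for d t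
    using A.lie_eval_part[of "tensor_gens M N" f] g that by blast
  show ?thesis
  proof (intro bexI allI ballI)
    show "on_class (lie_eval A f) (m \<otimes>\<^sub>t n) = f (m, n)" if "m \<in> part M a" "n \<in> part N b" for a b m n
      using ev[OF Gen_lie_terms[OF that]] by (simp add: tensor_def)
    show "on_class (lie_eval A f) \<in> lie_hom T A"
      unfolding lie_hom_iff
      by (auto simp: T_simps ev ec ep homogeneous_lie_terms simp flip: cls_simps)
  qed
qed

end

subsection \<open>The homomorphism to the algebra and the action on the tensor square\<close>

locale lie_square = lie_superalgebra L for L :: "('f::field, 'a) superalgebra" +
  assumes two: "(2 :: 'f) \<noteq> 0"
begin

sublocale sq: tensor_setup L L "bracket L" "bracket L"
  by unfold_locales (rule two bracket_degree; assumption)+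

notation sq.bitensor (infix \<open>\<otimes>\<^sub>b\<close> 75)

abbreviation TS where "TS \<equiv> tensor_square L"
abbreviation clsS where
  "clsS \<equiv> lie_class (tensor_gens L L) (tensor_rel L L (bracket L) (bracket L))"

text \<open>\<open>tensor_lambda\<close> is a choice, so its properties are available only once a
  witness is known. The witness evaluates symbols as brackets; the bracket relations then become
  skew symmetry and two forms of the Jacobi identity.\<close>

lemma tensor_lambda_exists:
  "\<exists>f\<in>lie_hom TS L. \<forall>i j. \<forall>a\<in>part L i. \<forall>b\<in>part L j. f (tensor2 L a b) = bracket L a b"
proof -
  have "\<exists>F\<in>lie_hom TS L. \<forall>a b. \<forall>m\<in>part L a. \<forall>n\<in>part L b.
      F (tensor2 L m n) = (\<lambda>(m, n). bracket L m n) (m, n)"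
  proof (rule sq.tensor_hom_exists)
    fix s t assume "tensor_rel L L (bracket L) (bracket L) s t"
    then show "lie_eval L (\<lambda>(m, n). bracket L m n) s = lie_eval L (\<lambda>(m, n). bracket L m n) t"
    proof cases
      case (bracket_left m a m' a' n b)
      then show ?thesis by (simp add: jacobi_left)
    next
      case (bracket_right m a n b n' b')
      then show ?thesis by (simp add: jacobi_right)
    next
      case (bracket_tensor m a n b m' a' n' b')
      then show ?thesis
        using super_skew[of m a n b] by (simp add: bracket_linear part_carrier)
    qed (auto simp: bracket_linear part_carrier)
  qed (auto intro: lie_superalgebra_axioms bracket_degree)
  then show ?thesis by simp
qed

lemma tensor_lambda:
  "tensor_lambda L \<in> lie_hom TS L"
  "\<lbrakk>a \<in> part L i; b \<in> part L j\<rbrakk> \<Longrightarrow> tensor_lambda L (tensor2 L a b) = bracket L a b"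
  using someI_ex[of "\<lambda>f. f \<in> lie_hom TS L \<and>
     (\<forall>i j. \<forall>a\<in>part L i. \<forall>b\<in>part L j. f (tensor2 L a b) = bracket L a b)"]
    tensor_lambda_exists
  unfolding tensor_lambda_def by blast+

lemma tensor_lambda_part: "t \<in> part TS d \<Longrightarrow> tensor_lambda L t \<in> part L d"
  using tensor_lambda(1) by (simp add: lie_hom_def)

text \<open>The Leibniz rule on formal expressions for an element \<open>l\<close> of degree
  \<open>a\<close>. The values are elements of the tensor square and not expressions: the symbol
  clause needs the bilinear \<open>bitensor\<close>, and in the bracket clause the factor that is
  not differentiated enters through its class. The sign for passing it comes from
  \<open>twist\<close>, as an expression has no degree attached.\<close>

primrec deriv :: "'a \<Rightarrow> bit \<Rightarrow> ('f, 'a \<times> 'a) lie_term \<Rightarrow> ('f, 'a \<times> 'a) lie_term set" where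
  "deriv l a (Gen g) = bracket L l (fst g) \<otimes>\<^sub>b snd g \<oplus>\<^bsub>TS\<^esub> twist a (fst g) \<otimes>\<^sub>b bracket L l (snd g)"
| "deriv l a Zero = \<zero>\<^bsub>TS\<^esub>"
| "deriv l a (Add s t) = deriv l a s \<oplus>\<^bsub>TS\<^esub> deriv l a t"
| "deriv l a (Scale c t) = c \<odot>\<^bsub>TS\<^esub> deriv l a t"
| "deriv l a (Bracket s t) =
    bracket TS (deriv l a s) (clsS t) \<oplus>\<^bsub>TS\<^esub> bracket TS (sq.T.twist a (clsS s)) (deriv l a t)"

context
  fixes l a
  assumes l: "l \<in> part L a"
begin

lemma deriv_Gen:
  "\<lbrakk>m \<in> part L i; n \<in> part L j\<rbrakk> \<Longrightarrow> deriv l a (Gen (m, n)) =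
    bracket L l m \<otimes>\<^sub>b n \<oplus>\<^bsub>TS\<^esub> sg (a * i) \<odot>\<^bsub>TS\<^esub> m \<otimes>\<^sub>b bracket L l n"
  using l by (simp add: twist_homogeneous sq.bitensor_scale_left part_carrier)

lemma deriv_part:
  assumes "homogeneous (tensor_gens L L) d t"
  shows "deriv l a t \<in> part TS (a + d)"
  using assms
proof (induction rule: homogeneous.induct)
  case (1 g d)
  then obtain i j m n where g: "m \<in> part L i" "n \<in> part L j" "d = i + j" "g = (m, n)"
    by (auto elim: sq.tensor_gensE)
  have "bracket L l m \<otimes>\<^sub>b n \<in> part TS (a + d)" "m \<otimes>\<^sub>b bracket L l n \<in> part TS (a + d)"
    using sq.bitensor_part[OF bracket_degree[OF l g(1)] g(2)]
      sq.bitensor_part[OF g(1) bracket_degree[OF l g(2)]] g(3) by (simp_all add: add_ac)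
  then show ?case
    using g deriv_Gen[OF g(1,2)] by simp
next
  case (5 i s j t)
  have st: "clsS s \<in> part TS i" "clsS t \<in> part TS j"
    using 5 by (auto simp: sq.T_simps)
  have "bracket TS (deriv l a s) (clsS t) \<in> part TS (a + (i + j))"
    using sq.T.bracket_degree[OF 5(3) st(2)] by (simp add: add_ac)
  moreover have "bracket TS (clsS s) (deriv l a t) \<in> part TS (a + (i + j))"
    using sq.T.bracket_degree[OF st(1) 5(4)] by (simp add: add_ac)
  ultimately show ?case
    using st(1) 5(4)[THEN sq.T.part_carrier]
    by (simp add: sq.T.twist_homogeneous[OF st(1)] sq.T.bracket_scale_left sq.T.part_carrier[OF st(1)])
qed auto

lemma deriv_carrier: "t \<in> lie_terms (tensor_gens L L) \<Longrightarrow> deriv l a t \<in> carrier TS"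
proof (induction rule: lie_terms_induct)
  case (Gen g d)
  then show ?case
    using deriv_part[of d "Gen g"] sq.T.part_carrier by (auto intro: homogeneous.intros)
qed (auto simp: sq.cls_in_carrier)

text \<open>In each bracket relation \<open>l\<close> moves inside by the Jacobi identity. The
  summands in which \<open>l\<close> has reached one argument are then instances of the same
  relation, with that argument replaced by its bracket with \<open>l\<close>.\<close>

lemma deriv_relation:
  assumes "tensor_rel L L (bracket L) (bracket L) s t"
  shows "deriv l a s = deriv l a t"
  using assms
proof cases
  case (add_left m i m' n j)
  then show ?thesis
    using l by (simp add: part_carrier twist_add twist_scale bracket_linear sq.bitensor_add_left
        sq.T.scale_distrib_right sq.T.a_ac)
next
  case (add_right m i n j n')
  then show ?thesis
    using l by (simp add: part_carrier twist_add twist_scale bracket_linear sq.bitensor_add_right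
        sq.T.scale_distrib_right sq.T.a_ac)
next
  case (scale_left m i n j c)
  then show ?thesis
    using l by (simp add: part_carrier twist_add twist_scale bracket_linear sq.bitensor_scale_left
        sq.T.scale_distrib_right mult.commute)
next
  case (scale_right m i n j c)
  then show ?thesis
    using l by (simp add: part_carrier twist_add twist_scale bracket_linear sq.bitensor_scale_right
        sq.T.scale_distrib_right mult.commute)
next
  case (bracket_left m i m' i' n j)
  note c = l bracket_left(3-5)
  note b = bracket_degree[OF l bracket_left(3)] bracket_degree[OF l bracket_left(4)]
    bracket_degree[OF l bracket_left(5)]
    bracket_degree[OF bracket_left(3,5)] bracket_degree[OF bracket_left(4,5)]
    bracket_degree[OF bracket_left(3,4)]
  have D: "deriv l a s =
      bracket L l (bracket L m m') \<otimes>\<^sub>b n \<oplus>\<^bsub>TS\<^esub> sg (a * (i + i')) \<odot>\<^bsub>TS\<^esub> bracket L m m' \<otimes>\<^sub>b bracket L l n"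
      "deriv l a t = (bracket L l m \<otimes>\<^sub>b bracket L m' n \<oplus>\<^bsub>TS\<^esub>
          sg (a * i) \<odot>\<^bsub>TS\<^esub> m \<otimes>\<^sub>b bracket L l (bracket L m' n)) \<oplus>\<^bsub>TS\<^esub>
        (- sg (i * i')) \<odot>\<^bsub>TS\<^esub> (bracket L l m' \<otimes>\<^sub>b bracket L m n \<oplus>\<^bsub>TS\<^esub>
          sg (a * i') \<odot>\<^bsub>TS\<^esub> m' \<otimes>\<^sub>b bracket L l (bracket L m n))"
    unfolding bracket_left(1,2) deriv.simps(3,4)
    using deriv_Gen b c by simp_all
  have r: "bracket L (bracket L l m) m' \<otimes>\<^sub>b n = bracket L l m \<otimes>\<^sub>b bracket L m' n
        \<oplus>\<^bsub>TS\<^esub> (- sg ((a + i) * i')) \<odot>\<^bsub>TS\<^esub> m' \<otimes>\<^sub>b bracket L (bracket L l m) n"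
      "bracket L m (bracket L l m') \<otimes>\<^sub>b n = m \<otimes>\<^sub>b bracket L (bracket L l m') n
        \<oplus>\<^bsub>TS\<^esub> (- sg (i * (a + i'))) \<odot>\<^bsub>TS\<^esub> bracket L l m' \<otimes>\<^sub>b bracket L m n"
      "bracket L m m' \<otimes>\<^sub>b bracket L l n = m \<otimes>\<^sub>b bracket L m' (bracket L l n)
        \<oplus>\<^bsub>TS\<^esub> (- sg (i * i')) \<odot>\<^bsub>TS\<^esub> m' \<otimes>\<^sub>b bracket L m (bracket L l n)"
    by (rule sq.bitensor_bracket_left b c)+
  note j = super_jacobi[OF l bracket_left(3,4)] super_jacobi[OF l bracket_left(3,5)]
    super_jacobi[OF l bracket_left(4,5)]
  \<comment> \<open>The signs depend on the degrees of \<open>l\<close>, \<open>m\<close> and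
    \<open>m'\<close> alone; once these are fixed, every \<open>sg\<close> is 1 or -1 and the
    identity is purely linear.\<close>
  show ?thesis
    unfolding D using c[THEN part_carrier]
    by (cases a; cases i; cases i')
      (simp_all add: j r sq.bitensor_add_left sq.bitensor_add_right sq.bitensor_scale_left
        sq.bitensor_scale_right sq.T.scale_distrib_right sq.T.a_ac)
next
  case (bracket_right m i n j n' j')
  note c = l bracket_right(3-5)
  note b = bracket_degree[OF l bracket_right(3)] bracket_degree[OF l bracket_right(4)]
    bracket_degree[OF l bracket_right(5)]
    bracket_degree[OF bracket_right(4,3)] bracket_degree[OF bracket_right(5,3)]
    bracket_degree[OF bracket_right(4,5)]
  have D: "deriv l a s =
      bracket L l m \<otimes>\<^sub>b bracket L n n' \<oplus>\<^bsub>TS\<^esub> sg (a * i) \<odot>\<^bsub>TS\<^esub> m \<otimes>\<^sub>b bracket L l (bracket L n n')"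
      "deriv l a t = sg (j' * (i + j)) \<odot>\<^bsub>TS\<^esub> (bracket L l (bracket L n' m) \<otimes>\<^sub>b n \<oplus>\<^bsub>TS\<^esub>
          sg (a * (j' + i)) \<odot>\<^bsub>TS\<^esub> bracket L n' m \<otimes>\<^sub>b bracket L l n) \<oplus>\<^bsub>TS\<^esub>
        (- sg (i * j)) \<odot>\<^bsub>TS\<^esub> (bracket L l (bracket L n m) \<otimes>\<^sub>b n' \<oplus>\<^bsub>TS\<^esub>
          sg (a * (j + i)) \<odot>\<^bsub>TS\<^esub> bracket L n m \<otimes>\<^sub>b bracket L l n')"
    unfolding bracket_right(1,2) deriv.simps(3,4)
    using deriv_Gen b c by simp_all
  have r: "bracket L l m \<otimes>\<^sub>b bracket L n n' =
        sg (j' * ((a + i) + j)) \<odot>\<^bsub>TS\<^esub> bracket L n' (bracket L l m) \<otimes>\<^sub>b n \<oplus>\<^bsub>TS\<^esub>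
        (- sg ((a + i) * j)) \<odot>\<^bsub>TS\<^esub> bracket L n (bracket L l m) \<otimes>\<^sub>b n'"
      "m \<otimes>\<^sub>b bracket L (bracket L l n) n' =
        sg (j' * (i + (a + j))) \<odot>\<^bsub>TS\<^esub> bracket L n' m \<otimes>\<^sub>b bracket L l n \<oplus>\<^bsub>TS\<^esub>
        (- sg (i * (a + j))) \<odot>\<^bsub>TS\<^esub> bracket L (bracket L l n) m \<otimes>\<^sub>b n'"
      "m \<otimes>\<^sub>b bracket L n (bracket L l n') =
        sg ((a + j') * (i + j)) \<odot>\<^bsub>TS\<^esub> bracket L (bracket L l n') m \<otimes>\<^sub>b n \<oplus>\<^bsub>TS\<^esub>
        (- sg (i * j)) \<odot>\<^bsub>TS\<^esub> bracket L n m \<otimes>\<^sub>b bracket L l n'"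
    by (rule sq.bitensor_bracket_right b c)+
  note j = super_jacobi[OF l bracket_right(4,5)] super_jacobi[OF l bracket_right(4,3)]
    super_jacobi[OF l bracket_right(5,3)]
  show ?thesis
    unfolding D using c[THEN part_carrier]
    by (cases a; cases i; cases j; cases j')
      (simp_all add: j r sq.bitensor_add_left sq.bitensor_add_right sq.bitensor_scale_left
        sq.bitensor_scale_right sq.T.scale_distrib_right sq.T.a_ac)
next
  case (bracket_tensor m i n j m' i' n' j')
  note c = l bracket_tensor(3-6)
  note b = bracket_degree[OF l bracket_tensor(3)] bracket_degree[OF l bracket_tensor(4)]
    bracket_degree[OF l bracket_tensor(5)] bracket_degree[OF l bracket_tensor(6)]
    bracket_degree[OF bracket_tensor(4,3)] bracket_degree[OF bracket_tensor(5,6)]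
  have cl: "clsS (Gen (m, n)) = m \<otimes>\<^sub>b n" "clsS (Gen (m', n')) = m' \<otimes>\<^sub>b n'"
    using c by (simp_all add: sq.bitensor_eq tensor_def)
  have "m \<otimes>\<^sub>b n \<in> part TS (i + j)"
    using c by (simp add: sq.bitensor_part)
  then have D: "deriv l a s = bracket TS (bracket L l m \<otimes>\<^sub>b n \<oplus>\<^bsub>TS\<^esub> sg (a * i) \<odot>\<^bsub>TS\<^esub> m \<otimes>\<^sub>b bracket L l n)
        (m' \<otimes>\<^sub>b n') \<oplus>\<^bsub>TS\<^esub> bracket TS (sg (a * (i + j)) \<odot>\<^bsub>TS\<^esub> m \<otimes>\<^sub>b n)
        (bracket L l m' \<otimes>\<^sub>b n' \<oplus>\<^bsub>TS\<^esub> sg (a * i') \<odot>\<^bsub>TS\<^esub> m' \<otimes>\<^sub>b bracket L l n')"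
      "deriv l a t = (- sg (i * j)) \<odot>\<^bsub>TS\<^esub> (bracket L l (bracket L n m) \<otimes>\<^sub>b bracket L m' n' \<oplus>\<^bsub>TS\<^esub>
          sg (a * (j + i)) \<odot>\<^bsub>TS\<^esub> bracket L n m \<otimes>\<^sub>b bracket L l (bracket L m' n'))"
    unfolding bracket_tensor(1,2) deriv.simps(4,5)
    using deriv_Gen b c by (simp_all add: cl sq.T.twist_homogeneous del: deriv.simps)
  have r: "bracket TS (bracket L l m \<otimes>\<^sub>b n) (m' \<otimes>\<^sub>b n') =
        (- sg ((a + i) * j)) \<odot>\<^bsub>TS\<^esub> bracket L n (bracket L l m) \<otimes>\<^sub>b bracket L m' n'"
      "bracket TS (m \<otimes>\<^sub>b bracket L l n) (m' \<otimes>\<^sub>b n') =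
        (- sg (i * (a + j))) \<odot>\<^bsub>TS\<^esub> bracket L (bracket L l n) m \<otimes>\<^sub>b bracket L m' n'"
      "bracket TS (m \<otimes>\<^sub>b n) (bracket L l m' \<otimes>\<^sub>b n') =
        (- sg (i * j)) \<odot>\<^bsub>TS\<^esub> bracket L n m \<otimes>\<^sub>b bracket L (bracket L l m') n'"
      "bracket TS (m \<otimes>\<^sub>b n) (m' \<otimes>\<^sub>b bracket L l n') =
        (- sg (i * j)) \<odot>\<^bsub>TS\<^esub> bracket L n m \<otimes>\<^sub>b bracket L m' (bracket L l n')"
    by (rule sq.bracket_bitensor b c)+
  note j = super_jacobi[OF l bracket_tensor(4,3)] super_jacobi[OF l bracket_tensor(5,6)]
  show ?thesis
    unfolding D using c[THEN part_carrier]
    by (cases a; cases i; cases j; cases i')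
      (simp_all add: j r sq.bitensor_add_left sq.bitensor_add_right sq.bitensor_scale_left
        sq.bitensor_scale_right sq.T.bracket_linear sq.T.scale_distrib_right sq.T.a_ac)
qed

end

end

section \<open>The Leibniz rule against skew symmetry and the Jacobi identity\<close>

context lie_superalgebra
begin

text \<open>\<open>dx\<close> and \<open>dy\<close> stand for the values at \<open>x\<close> and
  \<open>y\<close> of a superderivation of degree \<open>a\<close>. They are arbitrary elements of
  the right degree, because in \<open>deriv_cong\<close> the derivation is not yet a function on
  classes.\<close>

lemma skew_derivation:
  assumes "x \<in> part L i" "y \<in> part L j" "dx \<in> part L (a + i)" "dy \<in> part L (a + j)"
  shows "bracket L dx y \<oplus>\<^bsub>L\<^esub> sg (a * i) \<odot>\<^bsub>L\<^esub> bracket L x dy =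
    (- sg (i * j)) \<odot>\<^bsub>L\<^esub> (bracket L dy x \<oplus>\<^bsub>L\<^esub> sg (a * j) \<odot>\<^bsub>L\<^esub> bracket L y dx)"
proof -
  note e = super_skew[OF assms(3,2)] super_skew[OF assms(1,4)]
  show ?thesis
    using assms[THEN part_carrier]
    by (cases a; cases i; cases j) (simp_all add: e scale_distrib_right a_comm)
qed

text \<open>A derivation applied to the Jacobi identity replaces one of the three arguments at a
  time by its derivative; each of the three results is a Jacobi identity again.\<close>

lemma jacobi_derivation:
  assumes h: "x \<in> part L i" "y \<in> part L j" "z \<in> part L k"
    and d: "dx \<in> part L (a + i)" "dy \<in> part L (a + j)" "dz \<in> part L (a + k)"
  shows "bracket L dx (bracket L y z) \<oplus>\<^bsub>L\<^esub> sg (a * i) \<odot>\<^bsub>L\<^esub>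
      bracket L x (bracket L dy z \<oplus>\<^bsub>L\<^esub> sg (a * j) \<odot>\<^bsub>L\<^esub> bracket L y dz) =
    (bracket L (bracket L dx y \<oplus>\<^bsub>L\<^esub> sg (a * i) \<odot>\<^bsub>L\<^esub> bracket L x dy) z \<oplus>\<^bsub>L\<^esub>
      sg (a * (i + j)) \<odot>\<^bsub>L\<^esub> bracket L (bracket L x y) dz) \<oplus>\<^bsub>L\<^esub>
    sg (i * j) \<odot>\<^bsub>L\<^esub> (bracket L dy (bracket L x z) \<oplus>\<^bsub>L\<^esub> sg (a * j) \<odot>\<^bsub>L\<^esub>
      bracket L y (bracket L dx z \<oplus>\<^bsub>L\<^esub> sg (a * i) \<odot>\<^bsub>L\<^esub> bracket L x dz))"
proof -
  note e = super_jacobi[OF d(1) h(2) h(3)] super_jacobi[OF h(1) d(2) h(3)]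
    super_jacobi[OF h(1) h(2) d(3)]
  show ?thesis
    using h[THEN part_carrier] d[THEN part_carrier]
    by (cases a; cases i; cases j) (simp_all add: e bracket_linear scale_distrib_right a_ac)
qed

end

section \<open>The derivation on classes and the action on the tensor square\<close>

context lie_square
begin

context
  fixes l a
  assumes l: "l \<in> part L a"
begin

lemma deriv_cong:
  "lie_eq (tensor_gens L L) (tensor_rel L L (bracket L) (bracket L)) s t \<Longrightarrow> deriv l a s = deriv l a t"
proof (induction rule: lie_eq.induct)
  case (relation s t)
  then show ?case by (rule deriv_relation[OF l])
next
  case (Bracket_cong s s' t t')
  then show ?case by (simp add: cls_eqI)
next
  case (Bracket_skew i s j t)
  have st: "clsS s \<in> part TS i" "clsS t \<in> part TS j"
    using Bracket_skew by (auto simp: sq.T_simps)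
  show ?case
    using sq.T.skew_derivation[OF st deriv_part[OF l Bracket_skew(1)] deriv_part[OF l Bracket_skew(2)]]
      st[THEN sq.T.part_carrier] Bracket_skew[THEN deriv_part[OF l], THEN sq.T.part_carrier]
    by (simp add: st[THEN sq.T.twist_homogeneous] sq.T.bracket_linear)
next
  case (Bracket_jacobi i s j t k u)
  have h: "clsS s \<in> part TS i" "clsS t \<in> part TS j" "clsS u \<in> part TS k"
    using Bracket_jacobi by (auto simp: sq.T_simps)
  note lt = Bracket_jacobi[THEN homogeneous_lie_terms]
  note d = Bracket_jacobi[THEN deriv_part[OF l]]
  show ?case
    using sq.T.jacobi_derivation[OF h d] h[THEN sq.T.part_carrier] d[THEN sq.T.part_carrier]
    by (simp add: lt sq.cls_simps h[THEN sq.T.twist_homogeneous]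
        sq.T.bracket_degree[OF h(1,2), THEN sq.T.twist_homogeneous] sq.T.bracket_scale_left)
qed (auto simp: deriv_carrier[OF l] sq.cls_in_carrier sq.cls_simps sq.T.bracket_linear
      sq.T.twist_add sq.T.twist_scale sq.T.scale_distrib_left sq.T.scale_distrib_right sq.T.a_ac
      mult.commute)

lemma on_class_deriv: "t \<in> lie_terms (tensor_gens L L) \<Longrightarrow> on_class (deriv l a) (clsS t) = deriv l a t"
  by (rule on_class_cls) (rule deriv_cong)

lemma on_class_deriv_closed [simp]: "x \<in> carrier TS \<Longrightarrow> on_class (deriv l a) x \<in> carrier TS"
  by (auto simp: sq.T_simps(1) on_class_deriv) (simp add: deriv_carrier[OF l] flip: sq.T_simps(1))

lemma on_class_deriv_part: "x \<in> part TS d \<Longrightarrow> on_class (deriv l a) x \<in> part TS (a + d)"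
  using deriv_part[OF l] by (auto simp: sq.T_simps(2)[of d] on_class_deriv homogeneous_lie_terms)

lemma on_class_deriv_add:
  "\<lbrakk>x \<in> carrier TS; y \<in> carrier TS\<rbrakk> \<Longrightarrow>
    on_class (deriv l a) (x \<oplus>\<^bsub>TS\<^esub> y) = on_class (deriv l a) x \<oplus>\<^bsub>TS\<^esub> on_class (deriv l a) y"
  by (auto simp: sq.T_simps(1) on_class_deriv simp flip: sq.cls_simps(1))

lemma on_class_deriv_scale:
  "x \<in> carrier TS \<Longrightarrow> on_class (deriv l a) (c \<odot>\<^bsub>TS\<^esub> x) = c \<odot>\<^bsub>TS\<^esub> on_class (deriv l a) x"
  by (auto simp: sq.T_simps(1) on_class_deriv simp flip: sq.cls_simps(2))

lemma on_class_deriv_zero [simp]: "on_class (deriv l a) \<zero>\<^bsub>TS\<^esub> = \<zero>\<^bsub>TS\<^esub>"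
  using on_class_deriv[of Zero] by (simp add: sq.T_simps(3))

lemma on_class_deriv_bracket:
  "\<lbrakk>x \<in> part TS d; y \<in> carrier TS\<rbrakk> \<Longrightarrow> on_class (deriv l a) (bracket TS x y) =
    bracket TS (on_class (deriv l a) x) y \<oplus>\<^bsub>TS\<^esub>
    sg (a * d) \<odot>\<^bsub>TS\<^esub> bracket TS x (on_class (deriv l a) y)"
proof -
  assume x: "x \<in> part TS d" and y: "y \<in> carrier TS"
  obtain s t where st: "s \<in> lie_terms (tensor_gens L L)" "t \<in> lie_terms (tensor_gens L L)"
    "x = clsS s" "y = clsS t"
    using sq.T.part_carrier[OF x] y by (auto simp: sq.T_simps(1))
  have "on_class (deriv l a) (bracket TS x y) = deriv l a (Bracket s t)"
    using st by (simp add: on_class_deriv flip: sq.cls_simps(3) del: deriv.simps)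
  then show ?thesis
    using st sq.T.twist_homogeneous[OF x, of a] x
    by (simp add: on_class_deriv sq.T.bracket_linear deriv_carrier[OF l] sq.cls_in_carrier)
qed

lemma on_class_deriv_bitensor:
  "\<lbrakk>m \<in> part L i; n \<in> part L j\<rbrakk> \<Longrightarrow> on_class (deriv l a) (m \<otimes>\<^sub>b n) =
    bracket L l m \<otimes>\<^sub>b n \<oplus>\<^bsub>TS\<^esub> sg (a * i) \<odot>\<^bsub>TS\<^esub> m \<otimes>\<^sub>b bracket L l n"
  using on_class_deriv[OF sq.Gen_lie_terms] deriv_Gen[OF l]
  by (simp add: sq.bitensor_eq tensor_def del: deriv.simps)

end

lemma on_class_deriv_add_left:
  assumes "l \<in> part L a" "l' \<in> part L a" "t \<in> carrier TS"
  shows "on_class (deriv (l \<oplus>\<^bsub>L\<^esub> l') a) t = on_class (deriv l a) t \<oplus>\<^bsub>TS\<^esub> on_class (deriv l' a) t"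
proof -
  have ll: "l \<oplus>\<^bsub>L\<^esub> l' \<in> part L a"
    using assms by simp
  note s = on_class_deriv_closed on_class_deriv_add on_class_deriv_scale on_class_deriv_zero
  note s = s[OF assms(1)] s[OF assms(2)] s[OF ll]
  note c = assms(1,2)[THEN part_carrier]
  show ?thesis
    using assms(3)
  proof (induction rule: sq.tensor_induct)
    case (tensor m n i j)
    then show ?case
      using c on_class_deriv_bitensor[OF assms(1) tensor] on_class_deriv_bitensor[OF assms(2) tensor]
        on_class_deriv_bitensor[OF ll tensor] tensor[THEN part_carrier]
      by (simp add: sq.bitensor_eq[symmetric] bracket_linear sq.bitensor_add_left
          sq.bitensor_add_right sq.T.scale_distrib_right sq.T.a_ac)
  qed (simp_all add: s sq.T.scale_distrib_right sq.T.a_ac)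
qed

lemma on_class_deriv_scale_left:
  assumes "l \<in> part L a" "t \<in> carrier TS"
  shows "on_class (deriv (c \<odot>\<^bsub>L\<^esub> l) a) t = c \<odot>\<^bsub>TS\<^esub> on_class (deriv l a) t"
proof -
  have cl: "c \<odot>\<^bsub>L\<^esub> l \<in> part L a"
    using assms by simp
  note s = on_class_deriv_closed on_class_deriv_add on_class_deriv_scale on_class_deriv_zero
  note s = s[OF assms(1)] s[OF cl]
  show ?thesis
    using assms(2)
  proof (induction rule: sq.tensor_induct)
    case (tensor m n i j)
    then show ?case
      using on_class_deriv_bitensor[OF assms(1) tensor] on_class_deriv_bitensor[OF cl tensor]
        tensor[THEN part_carrier] assms(1)[THEN part_carrier]
      by (simp add: sq.bitensor_eq[symmetric] bracket_linear sq.bitensor_scale_left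
          sq.bitensor_scale_right sq.T.scale_distrib_right mult.commute)
  qed (simp_all add: s sq.T.scale_distrib_right mult.commute)
qed

text \<open>\<open>deriv\<close> takes the degree of \<open>l\<close> as a separate argument, so a
  general \<open>l\<close> acts through its even and its odd component.\<close>

definition square_action where
  "square_action l t = on_class (deriv (proj 0 l) 0) t \<oplus>\<^bsub>TS\<^esub> on_class (deriv (proj 1 l) 1) t"

lemma square_action_homogeneous:
  assumes "l \<in> part L a" "t \<in> carrier TS"
  shows "square_action l t = on_class (deriv l a) t"
proof -
  have "on_class (deriv \<zero>\<^bsub>L\<^esub> b) t = \<zero>\<^bsub>TS\<^esub>" for b
    using on_class_deriv_scale_left[of "\<zero>\<^bsub>L\<^esub>" b t 0] on_class_deriv_closed[of "\<zero>\<^bsub>L\<^esub>" b t]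
      assms(2) by simp
  then show ?thesis
    using assms on_class_deriv_closed[OF assms]
    by (cases a) (simp_all add: square_action_def proj_homogeneous)
qed

text \<open>Both sides are linear in \<open>t\<close>, so symbols suffice. There the terms with both
  elements on one factor match by the Jacobi identity, and the mixed terms, one element on each
  factor, occur in both orders of application.\<close>

lemma square_action_bracket:
  assumes p: "p \<in> part L a" "p' \<in> part L b" and t: "t \<in> carrier TS"
  shows "on_class (deriv p a) (on_class (deriv p' b) t) =
    on_class (deriv (bracket L p p') (a + b)) t \<oplus>\<^bsub>TS\<^esub>
    sg (a * b) \<odot>\<^bsub>TS\<^esub> on_class (deriv p' b) (on_class (deriv p a) t)"
proof -
  note pp = bracket_degree[OF p]
  note s = on_class_deriv_closed on_class_deriv_add on_class_deriv_scale on_class_deriv_zero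
  note s = s[OF p(1)] s[OF p(2)] s[OF pp]
  show ?thesis
    using t
  proof (induction rule: sq.tensor_induct)
    case (tensor m n i j)
    note c = p[THEN part_carrier] tensor[THEN part_carrier]
    note b = bracket_degree[OF p(1) tensor(1)] bracket_degree[OF p(1) tensor(2)]
      bracket_degree[OF p(2) tensor(1)] bracket_degree[OF p(2) tensor(2)]
    note d = on_class_deriv_bitensor[OF pp tensor] on_class_deriv_bitensor[OF p(1) tensor]
      on_class_deriv_bitensor[OF p(2) tensor]
      on_class_deriv_bitensor[OF p(1) b(3) tensor(2)] on_class_deriv_bitensor[OF p(1) tensor(1) b(4)]
      on_class_deriv_bitensor[OF p(2) b(1) tensor(2)] on_class_deriv_bitensor[OF p(2) tensor(1) b(2)]
    note j = super_jacobi[OF p tensor(1)] super_jacobi[OF p tensor(2)]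
    show ?case
      unfolding sq.bitensor_eq[OF tensor, symmetric]
      using c
      by (simp add: d s j bracket_linear sq.bitensor_add_left sq.bitensor_add_right
          sq.bitensor_scale_left sq.bitensor_scale_right sq.T.scale_distrib_right,
        (cases a; cases b; cases i; simp add: sq.T.a_ac))
  qed (simp_all add: s sq.T.scale_distrib_right sq.T.a_ac mult.commute)
qed

lemma square_action_lie_action: "lie_action L TS square_action"
proof (intro lie_action.intro lie_action_axioms.intro lie_superalgebra_axioms
    sq.T.lie_superalgebra_axioms)
  fix p p' m m' c
  show "square_action p m \<in> carrier TS" if "p \<in> carrier L" "m \<in> carrier TS"
    using that by (simp add: square_action_def on_class_deriv_closed)
  show "square_action (p \<oplus>\<^bsub>L\<^esub> p') m = square_action p m \<oplus>\<^bsub>TS\<^esub> square_action p' m"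
    if "p \<in> carrier L" "p' \<in> carrier L" "m \<in> carrier TS"
    using that by (simp add: square_action_def proj_add on_class_deriv_add_left
        on_class_deriv_closed sq.T.a_ac)
  show "square_action p (m \<oplus>\<^bsub>TS\<^esub> m') = square_action p m \<oplus>\<^bsub>TS\<^esub> square_action p m'"
    if "p \<in> carrier L" "m \<in> carrier TS" "m' \<in> carrier TS"
    using that by (simp add: square_action_def on_class_deriv_add on_class_deriv_closed sq.T.a_ac)
  show "square_action (c \<odot>\<^bsub>L\<^esub> p) m = c \<odot>\<^bsub>TS\<^esub> square_action p m"
    if "p \<in> carrier L" "m \<in> carrier TS"
    using that by (simp add: square_action_def proj_scale on_class_deriv_scale_left
        on_class_deriv_closed sq.T.scale_distrib_right)
  show "square_action p (c \<odot>\<^bsub>TS\<^esub> m) = c \<odot>\<^bsub>TS\<^esub> square_action p m"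
    if "p \<in> carrier L" "m \<in> carrier TS"
    using that by (simp add: square_action_def on_class_deriv_scale
        on_class_deriv_closed sq.T.scale_distrib_right)
next
  fix p m a b assume h: "p \<in> part L a" "m \<in> part TS b"
  show "square_action p m \<in> part TS (a + b)"
    unfolding square_action_homogeneous[OF h(1) sq.T.part_carrier[OF h(2)]]
    by (rule on_class_deriv_part[OF h])
next
  fix p p' a b m assume h: "p \<in> part L a" "p' \<in> part L b" "m \<in> carrier TS"
  note c = on_class_deriv_closed[OF h(1)] on_class_deriv_closed[OF h(2)]
    on_class_deriv_closed[OF bracket_degree[OF h(1,2)]]
  show "square_action (bracket L p p') m = square_action p (square_action p' m) \<oplus>\<^bsub>TS\<^esub>
      (- sg (a * b)) \<odot>\<^bsub>TS\<^esub> square_action p' (square_action p m)"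
    using h(3) c square_action_bracket[OF h]
    by (simp add: square_action_homogeneous[OF h(1)] square_action_homogeneous[OF h(2)]
        square_action_homogeneous[OF bracket_degree[OF h(1,2)]])
next
  fix p m m' a b assume h: "p \<in> part L a" "m \<in> part TS b" "m' \<in> carrier TS"
  note c = sq.T.part_carrier[OF h(2)]
  show "square_action p (bracket TS m m') = bracket TS (square_action p m) m' \<oplus>\<^bsub>TS\<^esub>
      sg (a * b) \<odot>\<^bsub>TS\<^esub> bracket TS m (square_action p m')"
    using c h(3) square_action_homogeneous[OF h(1)] on_class_deriv_bracket[OF h]
    by (simp del: sq.T.twist_homogeneous)
qed

text \<open>\<open>square_action\<close> is the witness that gives the choice in
  \<open>tensor_square_action\<close> its meaning; later arguments use the chosen action through
  these two properties.\<close>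

lemma tensor_square_action:
  "lie_action L TS (tensor_square_action L)"
  "\<lbrakk>l' \<in> part L k; l \<in> part L i; m \<in> part L j\<rbrakk> \<Longrightarrow> tensor_square_action L l' (tensor2 L l m) =
    tensor2 L (bracket L l' l) m \<oplus>\<^bsub>TS\<^esub> sg (i * k) \<odot>\<^bsub>TS\<^esub> tensor2 L l (bracket L l' m)"
proof -
  have "square_action l' (tensor2 L l m) =
      tensor2 L (bracket L l' l) m \<oplus>\<^bsub>TS\<^esub> sg (i * k) \<odot>\<^bsub>TS\<^esub> tensor2 L l (bracket L l' m)"
    if "l' \<in> part L k" "l \<in> part L i" "m \<in> part L j" for l' l m k i j
    using that on_class_deriv_bitensor[OF that] bracket_degree[of l' k l i]
      bracket_degree[of l' k m j] sq.tensor_carrier[of l i m j]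
    by (simp add: square_action_homogeneous sq.bitensor_eq mult.commute)
  with square_action_lie_action have "\<exists>act. lie_action L TS act \<and>
     (\<forall>k i j. \<forall>l'\<in>part L k. \<forall>l\<in>part L i. \<forall>m\<in>part L j. act l' (tensor2 L l m) =
        tensor2 L (bracket L l' l) m \<oplus>\<^bsub>TS\<^esub> sg (i * k) \<odot>\<^bsub>TS\<^esub> tensor2 L l (bracket L l' m))"
    by blast
  note * = someI_ex[OF this, folded tensor_square_action_def]
  show "lie_action L TS (tensor_square_action L)"
    using * by blast
  show "\<lbrakk>l' \<in> part L k; l \<in> part L i; m \<in> part L j\<rbrakk> \<Longrightarrow> tensor_square_action L l' (tensor2 L l m) =
    tensor2 L (bracket L l' l) m \<oplus>\<^bsub>TS\<^esub> sg (i * k) \<odot>\<^bsub>TS\<^esub> tensor2 L l (bracket L l' m)"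
    using * by blast
qed

sublocale cube: tensor_setup TS L
  "\<lambda>t l. bracket L (tensor_lambda L t) l" "tensor_square_action L"
proof
  show "(2 :: 'f) \<noteq> 0" by (rule two)
  show "bracket L (tensor_lambda L m) n \<in> part L (a + b)" if "m \<in> part TS a" "n \<in> part L b" for m n a b
    using that by (intro bracket_degree tensor_lambda_part)
  show "tensor_square_action L n m \<in> part TS (b + a)" if "n \<in> part L b" "m \<in> part TS a" for n b m a
    using lie_action.act_degree[OF tensor_square_action(1) that] .
qed

end

subsection \<open>Dimensions\<close>

context lie_superalgebra
begin

lemma submodule_subspace: "submodule class_ring W L \<Longrightarrow> subspace class_ring W L"
  by (intro subspace.intro vectorspace_axioms)

lemma has_dim_basis:
  assumes "has_dim L W k" "submodule class_ring W L"
  shows "\<exists>B. finite B \<and> B \<subseteq> W \<and> card B = k \<and> lin_indpt B \<and> span B = W"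
proof -
  interpret V: vectorspace class_ring "L\<lparr>carrier := W\<rparr>"
    by (rule subspace_is_vs[OF submodule_subspace[OF assms(2)]])
  obtain B where B: "finite B" "V.basis B"
    using V.finite_basis_exists assms(1) by (auto simp: has_dim_def)
  then have "card B = k"
    using V.dim_basis assms(1) by (auto simp: has_dim_def)
  moreover have "B \<subseteq> W"
    using B(2) by (simp add: V.basis_def)
  moreover have "lin_indpt B" "span B = W"
    using B(2) span_li_not_depend[OF \<open>B \<subseteq> W\<close> assms(2)] by (simp_all add: V.basis_def)
  ultimately show ?thesis
    using B(1) by blast
qed

lemma has_dim_span:
  assumes "submodule class_ring W L" "finite S" "S \<subseteq> W" "W \<subseteq> span S"
  shows "\<exists>k \<le> card S. has_dim L W k"
proof -
  interpret V: vectorspace class_ring "L\<lparr>carrier := W\<rparr>"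
    by (rule subspace_is_vs[OF submodule_subspace[OF assms(1)]])
  have "span S = W"
    using assms span_is_subset by blast
  then have "V.gen_set S"
    using span_li_not_depend[OF assms(3,1)] by simp
  then have "V.fin_dim" "V.dim \<le> card S"
    using assms V.gen_ge_dim[of S] by (auto simp: V.fin_dim_def)
  then show ?thesis
    by (auto simp: has_dim_def)
qed

lemma has_dim_lin_indpt:
  assumes "has_dim L W k" "submodule class_ring W L" "S \<subseteq> W" "lin_indpt S"
  shows "card S \<le> k"
proof -
  interpret V: vectorspace class_ring "L\<lparr>carrier := W\<rparr>"
    by (rule subspace_is_vs[OF submodule_subspace[OF assms(2)]])
  have "\<not> V.lin_dep S"
    using assms(4) span_li_not_depend[OF assms(3,2)] by simp
  then show ?thesis
    using assms V.li_le_dim(2)[of S] by (auto simp: has_dim_def)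
qed

text \<open>Steinitz exchange, with the bound on \<open>card X\<close> in the form in which
  \<open>replacement\<close> provides it.\<close>

lemma has_dim_extend:
  assumes "has_dim L W k" "submodule class_ring W L" "finite A" "A \<subseteq> W" "lin_indpt A"
  shows "\<exists>X. finite X \<and> X \<subseteq> W \<and> X \<inter> A = {} \<and> card A + card X \<le> k \<and> span (A \<union> X) = W"
proof -
  obtain B where B: "finite B" "B \<subseteq> W" "card B = k" "span B = W"
    using has_dim_basis[OF assms(1,2)] by blast
  have "B \<subseteq> carrier L"
    using B submodule.subset[OF assms(2)] by blast
  from replacement[OF assms(3) B(1) this assms(5)] assms(4) B(4)
  obtain C where C: "finite C" "C \<subseteq> span B" "C \<inter> A = {}"
    "int (card C) \<le> int (card B) - int (card A)" "span (A \<union> C) = span B"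
    by auto
  show ?thesis
    using B C by (intro exI[of _ C]) auto
qed

text \<open>Applying \<open>h\<close> to a vanishing linear combination isolates the coefficient of
  \<open>x\<close>.\<close>

lemma lin_indptI:
  assumes "finite S" "S \<subseteq> carrier L"
    and "\<And>x. x \<in> S \<Longrightarrow> \<exists>h. (\<forall>c y. y \<in> carrier L \<longrightarrow> h (c \<odot>\<^bsub>L\<^esub> y) = c * h y) \<and>
      (\<forall>y z. y \<in> carrier L \<longrightarrow> z \<in> carrier L \<longrightarrow> h (y \<oplus>\<^bsub>L\<^esub> z) = h y + h z) \<and>
      h x \<noteq> 0 \<and> (\<forall>y\<in>S - {x}. h y = 0)"
  shows "lin_indpt S"
proof (rule finite_lin_indpt2[OF assms(1,2)])
  fix a assume z: "lincomb a S = \<zero>\<^bsub>L\<^esub>"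
  show "\<forall>v\<in>S. a v = \<zero>\<^bsub>class_ring\<^esub>"
  proof
    fix x assume x: "x \<in> S"
    obtain h :: "'a \<Rightarrow> 'f" where h: "\<And>c y. y \<in> carrier L \<Longrightarrow> h (c \<odot>\<^bsub>L\<^esub> y) = c * h y"
      "\<And>y z. \<lbrakk>y \<in> carrier L; z \<in> carrier L\<rbrakk> \<Longrightarrow> h (y \<oplus>\<^bsub>L\<^esub> z) = h y + h z"
      "h x \<noteq> 0" "\<And>y. y \<in> S - {x} \<Longrightarrow> h y = 0"
      using assms(3)[OF x] by blast
    have h0: "h \<zero>\<^bsub>L\<^esub> = 0"
      using h(1)[of "\<zero>\<^bsub>L\<^esub>" 0] by simp
    have sum: "h (lincomb a F) = (\<Sum>y\<in>F. a y * h y)" if "F \<subseteq> S" for F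
      using finite_subset[OF that assms(1)] that
    proof (induction F rule: finite_induct)
      case empty
      then show ?case by (simp add: h0)
    next
      case (insert y F)
      then have "F \<subseteq> carrier L" "y \<in> carrier L"
        using assms(2) by auto
      with insert show ?case
        by (simp add: lincomb_insert2 h(1,2))
    qed
    have "0 = (\<Sum>y\<in>S. a y * h y)"
      using sum[of S] z h0 by simp
    also have "\<dots> = a x * h x"
      using assms(1) x h(4) by (subst sum.remove[of _ x]) (auto intro!: sum.neutral)
    finally show "a x = \<zero>\<^bsub>class_ring\<^esub>"
      using h(3) by simp
  qed
qed

end

text \<open>With the carrier overwritten by \<open>W\<close>, the records of
  \<open>derived L\<close> and \<open>L\<close> differ in \<open>part\<close> alone. No notion of
  linear algebra reads that field, yet the records are different, so their dimensions are compared
  through their linear combinations.\<close>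

lemma has_dim_derived: 
  assumes "lie_superalgebra L" "submodule class_ring W L"
  shows "has_dim (derived L) W k \<longleftrightarrow> has_dim L W k"
proof -
  interpret lie_superalgebra L by fact
  define P where "P = (\<lambda>d. bracket_span L (carrier L) (carrier L) \<inter> part L d)"
  define L' where "L' = L\<lparr>carrier := W, part := P\<rparr>"
  interpret V: vectorspace class_ring "L\<lparr>carrier := W\<rparr>"
    by (rule subspace_is_vs[OF submodule_subspace[OF assms(2)]])
  have D: "(derived L)\<lparr>carrier := W\<rparr> = L'"
    by (simp add: derived_def Let_def L'_def P_def)
  interpret V': vectorspace class_ring L'
  proof (rule vs_criteria)
    show "\<forall>v\<in>carrier L'. \<exists>w\<in>carrier L'. v \<oplus>\<^bsub>L'\<^esub> w = \<zero>\<^bsub>L'\<^esub>"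
    proof
      fix v assume "v \<in> carrier L'"
      then show "\<exists>w\<in>carrier L'. v \<oplus>\<^bsub>L'\<^esub> w = \<zero>\<^bsub>L'\<^esub>"
        using submodule.smult_closed[OF assms(2), of "- 1" v] submodule.subset[OF assms(2)]
        by (intro bexI[of _ "(- 1) \<odot>\<^bsub>L\<^esub> v"]) (auto simp: L'_def)
    qed
  qed (use assms(2) submodule.subset[OF assms(2)] submodule.m_closed[OF assms(2)]
      submodule.smult_closed[OF assms(2)] submodule.zero_closed[OF assms(2)] in
      \<open>auto simp: L'_def class_field a_ac scale_distrib_left scale_distrib_right subset_iff\<close>)
  have lc: "V'.lincomb a A = V.lincomb a A" for a A
    unfolding V'.lincomb_def V.lincomb_def finsum_def by (simp add: L'_def)
  have "V'.fin_dim = V.fin_dim" "V'.dim = V.dim"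
    by (simp_all add: V'.fin_dim_def V.fin_dim_def V'.dim_def V.dim_def V'.span_def V.span_def lc)
      (simp_all add: L'_def)
  then show ?thesis
    by (simp add: has_dim_def D)
qed

subsection \<open>Generation of nilpotent algebras\<close>

context lie_superalgebra
begin

lemma lower_central_submodule: "submodule class_ring (lower_central L k) L"
proof (induction k)
  case 0
  show ?case by (simp add: submoduleI)
next
  case (Suc k)
  have "{bracket L x y |x y. x \<in> lower_central L k \<and> y \<in> carrier L} \<subseteq> carrier L"
    using submodule.subset[OF Suc] by auto
  then show ?case
    by (simp add: bracket_span_def span_is_submodule)
qed

lemma lower_central_carrier: "x \<in> lower_central L k \<Longrightarrow> x \<in> carrier L"
  using submodule.subset[OF lower_central_submodule] by blast

lemma lower_central_zero [simp]: "\<zero>\<^bsub>L\<^esub> \<in> lower_central L k"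
  by (rule submodule.zero_closed[OF lower_central_submodule])

lemma lower_central_add:
  "\<lbrakk>x \<in> lower_central L k; y \<in> lower_central L k\<rbrakk> \<Longrightarrow> x \<oplus>\<^bsub>L\<^esub> y \<in> lower_central L k"
  by (rule submodule.m_closed[OF lower_central_submodule])

lemma lower_central_scale: "x \<in> lower_central L k \<Longrightarrow> c \<odot>\<^bsub>L\<^esub> x \<in> lower_central L k"
  using submodule.smult_closed[OF lower_central_submodule, of c x k] by simp

lemma lower_central_gens:
  "{bracket L x y |x y. x \<in> lower_central L k \<and> y \<in> carrier L} \<subseteq> carrier L"
  using lower_central_carrier by auto

lemma lower_central_bracket:
  "\<lbrakk>x \<in> lower_central L k; y \<in> carrier L\<rbrakk> \<Longrightarrow> bracket L x y \<in> lower_central L (Suc k)"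
  unfolding lower_central.simps bracket_span_def
  by (rule span_mem[OF lower_central_gens]) auto

text \<open>The terms of the series are graded: a bracket splits into four brackets of homogeneous
  components, and a projection keeps or kills each of them.\<close>

lemma lower_central_proj: "x \<in> lower_central L k \<Longrightarrow> proj d x \<in> lower_central L k"
proof (induction k arbitrary: x d)
  case 0
  then show ?case by simp
next
  case (Suc k)
  from Suc.prems have "x \<in> span {bracket L x y |x y. x \<in> lower_central L k \<and> y \<in> carrier L}"
    by (simp add: bracket_span_def)
  then show ?case
    using lower_central_gens
  proof (induction rule: span_induct)
    case (base x)
    then obtain y z where x: "x = bracket L y z" "y \<in> lower_central L k" "z \<in> carrier L"
      by blast
    have y: "y \<in> carrier L"
      using x lower_central_carrier by blast
    have "proj d (bracket L (proj a y) (proj b z)) \<in> lower_central L (Suc k)" for a b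
    proof -
      have "bracket L (proj a y) (proj b z) \<in> part L (a + b)"
        using x y by (intro bracket_degree) auto
      then show ?thesis
        using lower_central_bracket[OF Suc.IH[OF x(2)] proj_closed[OF x(3)], of a b]
        by (simp add: proj_homogeneous del: lower_central.simps)
    qed
    then have "proj d (bracket L (proj 0 y \<oplus>\<^bsub>L\<^esub> proj 1 y) (proj 0 z \<oplus>\<^bsub>L\<^esub> proj 1 z))
        \<in> lower_central L (Suc k)"
      using x y by (simp add: bracket_linear proj_add lower_central_add del: lower_central.simps)
    then show ?case
      using x y by (simp add: proj_sum del: lower_central.simps)
  next
    case zero
    show ?case
      using proj_homogeneous[of "\<zero>\<^bsub>L\<^esub>" 0 d] by (simp del: lower_central.simps)
  qed (simp_all add: proj_add proj_scale lower_central_add lower_central_scale del: lower_central.simps)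
qed

text \<open>The series brackets with \<open>L\<close> on the right. Skew symmetry changes sides for
  homogeneous elements only, hence the detour through components.\<close>

lemma bracket_lower_central:
  assumes "x \<in> lower_central L k" "y \<in> carrier L"
  shows "bracket L y x \<in> lower_central L (Suc k)"
proof -
  note x = lower_central_carrier[OF assms(1)]
  have "bracket L (proj a y) (proj b x) \<in> lower_central L (Suc k)" for a b
    using super_skew[OF proj_part proj_part, of y x a b] assms x
      lower_central_scale[OF lower_central_bracket[OF lower_central_proj[OF assms(1)]], of "proj a y"]
    by (simp del: lower_central.simps)
  then have "bracket L (proj 0 y \<oplus>\<^bsub>L\<^esub> proj 1 y) (proj 0 x \<oplus>\<^bsub>L\<^esub> proj 1 x) \<in> lower_central L (Suc k)"
    using assms x by (simp add: bracket_linear lower_central_add del: lower_central.simps)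
  then show ?thesis
    using assms x by (simp add: proj_sum del: lower_central.simps)
qed

text \<open>A subalgebra that covers L modulo [L,L] is all of L. The induction shows L = U +
  L^(k+1), where \<open>lower_central L k\<close> is L^(k+1): a bracket of two such sums is a
  bracket inside \<open>U\<close> up to terms of L^(k+2), so [L,L] lies in U + L^(k+2), and L = U +
  [L,L] gives the next step.\<close>

lemma nilpotent_generated:
  assumes "nilpotent L" "submodule class_ring U L"
    and bracket_U: "\<And>x y. \<lbrakk>x \<in> U; y \<in> U\<rbrakk> \<Longrightarrow> bracket L x y \<in> U"
    and gen: "\<And>x. x \<in> carrier L \<Longrightarrow> \<exists>u\<in>U. \<exists>c\<in>lower_central L 1. x = u \<oplus>\<^bsub>L\<^esub> c"
  shows "carrier L \<subseteq> U"
proof -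
  note U = submodule.subset[OF assms(2), THEN subsetD] submodule.m_closed[OF assms(2)]
    submodule.zero_closed[OF assms(2)]
  have Us: "c \<odot>\<^bsub>L\<^esub> x \<in> U" if "x \<in> U" for c x
    using submodule.smult_closed[OF assms(2), of c x] that by simp
  have "\<exists>u\<in>U. \<exists>c\<in>lower_central L k. x = u \<oplus>\<^bsub>L\<^esub> c" if "x \<in> carrier L" for k x
    using that
  proof (induction k arbitrary: x)
    case 0
    then show ?case
      using U(3) by (intro bexI[of _ "\<zero>\<^bsub>L\<^esub>"] bexI[of _ x]) auto
  next
    case (Suc k)
    let ?P = "\<lambda>x. \<exists>u\<in>U. \<exists>c\<in>lower_central L (Suc k). x = u \<oplus>\<^bsub>L\<^esub> c"
    have P_add: "?P (x \<oplus>\<^bsub>L\<^esub> y)" if "?P x" "?P y" for x y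
    proof -
      from that obtain u c v d where *: "u \<in> U" "c \<in> lower_central L (Suc k)" "x = u \<oplus>\<^bsub>L\<^esub> c"
        "v \<in> U" "d \<in> lower_central L (Suc k)" "y = v \<oplus>\<^bsub>L\<^esub> d"
        by blast
      then have "x \<oplus>\<^bsub>L\<^esub> y = (u \<oplus>\<^bsub>L\<^esub> v) \<oplus>\<^bsub>L\<^esub> (c \<oplus>\<^bsub>L\<^esub> d)"
        using U(1) lower_central_carrier[of _ "Suc k"]
        by (simp add: a_ac del: lower_central.simps)
      with * show ?thesis
        using U(2) lower_central_add by blast
    qed
    have P_U: "?P u" if "u \<in> U" for u
      using that U(1) by (intro bexI[of _ u] bexI[of _ "\<zero>\<^bsub>L\<^esub>"])
        (auto simp del: lower_central.simps)
    have P_lc: "?P c" if "c \<in> lower_central L (Suc k)" for c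
      using that U(3) lower_central_carrier[OF that] by (intro bexI[of _ "\<zero>\<^bsub>L\<^esub>"] bexI[of _ c])
        (auto simp del: lower_central.simps)
    have P_bracket: "?P (bracket L y z)" if yz: "y \<in> carrier L" "z \<in> carrier L" for y z
    proof -
      obtain u c v d where *: "u \<in> U" "c \<in> lower_central L k" "y = u \<oplus>\<^bsub>L\<^esub> c"
        "v \<in> U" "d \<in> lower_central L k" "z = v \<oplus>\<^bsub>L\<^esub> d"
        using Suc.IH[OF yz(1)] Suc.IH[OF yz(2)] by blast
      \<comment> \<open>The factor \<open>z\<close> stays whole in the last term, so only the
        bracket of \<open>u\<close> and \<open>v\<close> lies outside the next term of the
        series.\<close>
      have "bracket L y z = bracket L u v \<oplus>\<^bsub>L\<^esub> (bracket L u d \<oplus>\<^bsub>L\<^esub> bracket L c z)"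
        using * yz U(1) lower_central_carrier[of _ k] by (simp add: bracket_linear a_ac)
      moreover have "?P (bracket L u v)"
        using * by (intro P_U bracket_U)
      moreover have "?P (bracket L u d)" "?P (bracket L c z)"
        using P_lc[OF bracket_lower_central[OF *(5) U(1)[OF *(1)]]]
          P_lc[OF lower_central_bracket[OF *(2) yz(2)]] by blast+
      ultimately show ?thesis
        by (simp only: P_add)
    qed
    have P_one: "?P c" if "c \<in> lower_central L 1" for c
    proof -
      have "c \<in> span {bracket L x y |x y. x \<in> carrier L \<and> y \<in> carrier L}"
        using that by (simp add: bracket_span_def)
      moreover have "{bracket L x y |x y. x \<in> carrier L \<and> y \<in> carrier L} \<subseteq> carrier L"
        by auto
      ultimately show ?thesis
      proof (induction rule: span_induct)
        case (scale b x)
        then obtain u c where *: "u \<in> U" "c \<in> lower_central L (Suc k)" "x = u \<oplus>\<^bsub>L\<^esub> c"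
          by blast
        then have "b \<odot>\<^bsub>L\<^esub> x = b \<odot>\<^bsub>L\<^esub> u \<oplus>\<^bsub>L\<^esub> b \<odot>\<^bsub>L\<^esub> c"
          using U(1) lower_central_carrier[OF *(2)] by (simp add: scale_distrib_right)
        with * Us show ?case
          using lower_central_scale by blast
      qed (use P_bracket P_add P_U[OF U(3)] in auto)
    qed
    obtain u c where "u \<in> U" "c \<in> lower_central L 1" "x = u \<oplus>\<^bsub>L\<^esub> c"
      using gen[OF Suc.prems] by blast
    then show ?case
      using P_add[OF P_U[of u] P_one[of c]] by simp
  qed
  note * = this
  obtain k where k: "lower_central L k = {\<zero>\<^bsub>L\<^esub>}"
    using assms(1) by (auto simp: nilpotent_def)
  show ?thesis
  proof
    fix x assume "x \<in> carrier L"
    from *[OF this, of k] show "x \<in> U"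
      using k U(1) by auto
  qed
qed

end

subsection \<open>Spanning sets of tensor products\<close>

context tensor_setup
begin

text \<open>In \<open>bit\<close> every degree is its own negative, so \<open>d + a\<close> is the
  degree that complements \<open>a\<close> to \<open>d\<close>. Removing zero is what lets a
  vanishing symbol lower the cardinality.\<close>

definition tensor_set :: "(bit \<Rightarrow> 'm set) \<Rightarrow> (bit \<Rightarrow> 'n set) \<Rightarrow> bit \<Rightarrow> _" where
  "tensor_set B X d = (\<Union>a. (\<lambda>(m, n). m \<otimes>\<^sub>b n) ` (B a \<times> X (d + a))) - {\<zero>\<^bsub>T\<^esub>}"

lemma tensor_set_part:
  assumes "\<And>a. B a \<subseteq> part M a" "\<And>b. X b \<subseteq> part N b"
  shows "tensor_set B X d \<subseteq> part T d"
proof -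
  have "m \<otimes>\<^sub>b n \<in> part T d" if "m \<in> B a" "n \<in> X (d + a)" for m n a
    using that assms bitensor_part[of m a n "d + a"]
    by (auto simp: subset_iff add.left_commute[of a d])
  then show ?thesis
    by (auto simp: tensor_set_def)
qed

text \<open>The elements n with m \<otimes> n in \<open>W\<close> for all m form a subalgebra of
  \<open>N\<close> by \<open>bracket_right\<close>, and \<open>X\<close> covers \<open>N\<close>
  modulo [N,N], so \<open>nilpotent_generated\<close> applies. The quantifier over all m matters,
  since \<open>bracket_right\<close> lets elements of \<open>N\<close> act on the left
  factor.\<close>

lemma tensor_set_span:
  assumes nil: "nilpotent N"
    and B: "\<And>a. B a \<subseteq> part M a" "\<And>a. part M a \<subseteq> M.span (B a)"
    and X: "\<And>b. X b \<subseteq> part N b"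
      "\<And>b n. n \<in> part N b \<Longrightarrow> \<exists>x\<in>N.span (X b). \<exists>c\<in>lower_central N 1. n = x \<oplus>\<^bsub>N\<^esub> c"
  shows "part T d \<subseteq> T.span (tensor_set B X d)"
proof -
  let ?S = "tensor_set B X"
  have Sc: "?S d \<subseteq> carrier T" for d
    using tensor_set_part[of B X d] B X T.part_carrier by blast
  have Bc: "B a \<subseteq> carrier M" for a
    using B(1) M.part_carrier by blast
  have Xc: "X b \<subseteq> carrier N" for b
    using X(1) N.part_carrier by blast
  have span_add: "x \<oplus>\<^bsub>T\<^esub> y \<in> T.span (?S d)" if "x \<in> T.span (?S d)" "y \<in> T.span (?S d)" for x y d
    using T.span_add1[OF Sc that] .
  have span_scale: "c \<odot>\<^bsub>T\<^esub> x \<in> T.span (?S d)" if "x \<in> T.span (?S d)" for c x d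
    using submodule.smult_closed[OF T.span_is_submodule[OF Sc], of c x d] that by simp
  \<comment> \<open>The claim concerns each degree separately; \<open>W\<close> collects the
    elements all of whose homogeneous components satisfy it, which makes it a single
    submodule.\<close>
  define W where "W = {t \<in> carrier T. \<forall>d. T.proj d t \<in> T.span (?S d)}"
  have proj0: "T.proj d \<zero>\<^bsub>T\<^esub> = \<zero>\<^bsub>T\<^esub>" for d
    using T.proj_homogeneous[of "\<zero>\<^bsub>T\<^esub>" 0 d] by simp
  have W: "submodule class_ring W T"
    by (rule T.submoduleI)
      (auto simp: W_def T.proj_add T.proj_scale span_add span_scale T.span_zero proj0)
  have W0: "\<zero>\<^bsub>T\<^esub> \<in> W" and Wa: "\<And>x y. \<lbrakk>x \<in> W; y \<in> W\<rbrakk> \<Longrightarrow> x \<oplus>\<^bsub>T\<^esub> y \<in> W"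
    and Ws: "\<And>c x. x \<in> W \<Longrightarrow> c \<odot>\<^bsub>T\<^esub> x \<in> W"
    using submodule.zero_closed[OF W] submodule.m_closed[OF W] submodule.smult_closed[OF W]
    by auto
  have BX: "m \<otimes>\<^sub>b x \<in> W" if "m \<in> B a" "x \<in> X b" for m x a b
  proof -
    have p: "m \<otimes>\<^sub>b x \<in> part T (a + b)"
      using that B X bitensor_part by blast
    have "m \<otimes>\<^sub>b x \<in> T.span (?S (a + b))"
    proof (cases "m \<otimes>\<^sub>b x = \<zero>\<^bsub>T\<^esub>")
      case False
      \<comment> \<open>\<open>a + b + a\<close> equals \<open>b\<close> in
        \<open>bit\<close>.\<close>
      have "x \<in> X (a + b + a)"
        using that by (cases a) simp_all
      then have "m \<otimes>\<^sub>b x \<in> (\<lambda>(m, n). m \<otimes>\<^sub>b n) ` (B a \<times> X (a + b + a))"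
        using that(1) by force
      then have "m \<otimes>\<^sub>b x \<in> (\<Union>c. (\<lambda>(m, n). m \<otimes>\<^sub>b n) ` (B c \<times> X (a + b + c)))"
        by (rule UN_I[OF UNIV_I])
      with False have "m \<otimes>\<^sub>b x \<in> ?S (a + b)"
        unfolding tensor_set_def by simp
      then show ?thesis
        by (rule T.span_mem[OF Sc])
    qed (simp add: T.span_zero)
    then show ?thesis
      using T.part_carrier[OF p] by (simp add: W_def T.proj_homogeneous[OF p] T.span_zero)
  qed
  have MX: "m \<otimes>\<^sub>b x \<in> W" if "m \<in> carrier M" "x \<in> X b" for m x b
    using that(1)
  proof (induction rule: M.carrier_induct)
    case (part a m)
    then have "m \<in> M.span (B a)"
      using B(2) by blast
    then show ?case
      using Bc
    proof (induction rule: M.span_induct)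
      case (base m)
      then show ?case using BX that(2) by blast
    qed (use Xc that(2) in \<open>auto simp: bitensor_add_left bitensor_scale_left W0 Wa Ws subset_iff\<close>)
  qed (use Xc that(2) in \<open>auto simp: bitensor_add_left Wa subset_iff\<close>)
  \<comment> \<open>\<open>bracket_right\<close> holds for homogeneous arguments, so the condition
    is put on the components of \<open>n\<close>; in this form it defines a submodule that also
    contains inhomogeneous elements.\<close>
  define U where "U = {n \<in> carrier N. \<forall>d. \<forall>m\<in>carrier M. m \<otimes>\<^sub>b N.proj d n \<in> W}"
  have projN0: "N.proj d \<zero>\<^bsub>N\<^esub> = \<zero>\<^bsub>N\<^esub>" for d
    using N.proj_homogeneous[of "\<zero>\<^bsub>N\<^esub>" 0 d] by simp
  have U: "submodule class_ring U N"
    by (rule N.submoduleI)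
      (auto simp: U_def N.proj_add N.proj_scale bitensor_add_right bitensor_scale_right
        W0 Wa Ws projN0)
  have U_hom: "n \<in> U" if "n \<in> part N b" "\<And>m. m \<in> carrier M \<Longrightarrow> m \<otimes>\<^sub>b n \<in> W" for n b
    using that N.part_carrier[OF that(1)] by (auto simp: U_def N.proj_homogeneous[OF that(1)] W0)
  have U_proj: "m \<otimes>\<^sub>b N.proj d n \<in> W" if "n \<in> U" "m \<in> carrier M" for n m d
    using that by (simp add: U_def)
  have "carrier N \<subseteq> U"
  proof (rule N.nilpotent_generated[OF nil U])
    fix x y assume xy: "x \<in> U" "y \<in> U"
    then have c: "x \<in> carrier N" "y \<in> carrier N"
      by (auto simp: U_def)
    have "bracket N (N.proj a x) (N.proj b y) \<in> U" for a b
    proof (rule U_hom)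
      show "bracket N (N.proj a x) (N.proj b y) \<in> part N (a + b)"
        using c by (intro N.bracket_degree) auto
      show "m \<otimes>\<^sub>b bracket N (N.proj a x) (N.proj b y) \<in> W" if "m \<in> carrier M" for m
        using that
      proof (induction rule: M.carrier_induct)
        case (part d m)
        note pa = N.proj_part[OF c(1), of a] N.proj_part[OF c(2), of b]
        have "\<nu> (N.proj a x) m \<in> carrier M" "\<nu> (N.proj b y) m \<in> carrier M"
          using nu_degree[OF pa(1) part] nu_degree[OF pa(2) part] M.part_carrier by auto
        then show ?case
          using xy by (simp add: bitensor_bracket_right[OF part pa] Wa Ws U_proj)
      next
        case (add m m')
        then show ?case
          using c by (simp add: bitensor_add_left Wa)
      qed
    qed
    then have "bracket N (N.proj 0 x \<oplus>\<^bsub>N\<^esub> N.proj 1 x) (N.proj 0 y \<oplus>\<^bsub>N\<^esub> N.proj 1 y) \<in> U"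
      using c submodule.m_closed[OF U] by (simp add: N.bracket_linear)
    then show "bracket N x y \<in> U"
      using c by (simp add: N.proj_sum)
  next
    have span_U: "x \<in> U" if "x \<in> N.span (X b)" for x b
    proof -
      have "X b \<subseteq> U"
        using U_hom X(1) MX by blast
      then show ?thesis
        using N.span_is_subset[OF _ U] that by blast
    qed
    fix n assume "n \<in> carrier N"
    then show "\<exists>u\<in>U. \<exists>c\<in>lower_central N 1. n = u \<oplus>\<^bsub>N\<^esub> c"
    proof (induction rule: N.carrier_induct)
      case (part d x)
      then show ?case
        using X(2)[OF part] span_U by blast
    next
      case (add x y)
      then obtain u c v e where *: "u \<in> U" "c \<in> lower_central N 1" "x = u \<oplus>\<^bsub>N\<^esub> c"
        "v \<in> U" "e \<in> lower_central N 1" "y = v \<oplus>\<^bsub>N\<^esub> e"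
        by blast
      then have "u \<in> carrier N" "v \<in> carrier N" "c \<in> carrier N" "e \<in> carrier N"
        using submodule.subset[OF U] N.lower_central_carrier by blast+
      then have "x \<oplus>\<^bsub>N\<^esub> y = (u \<oplus>\<^bsub>N\<^esub> v) \<oplus>\<^bsub>N\<^esub> (c \<oplus>\<^bsub>N\<^esub> e)"
        using * by (simp add: N.a_ac)
      with * show ?case
        using submodule.m_closed[OF U] N.lower_central_add by blast
    qed
  qed
  have "t \<in> W" if "t \<in> carrier T" for t
    using that
  proof (induction rule: tensor_induct)
    case (tensor m n a b)
    have "n \<in> U"
      using \<open>carrier N \<subseteq> U\<close> N.part_carrier[OF tensor(2)] by blast
    then show ?case
      using U_proj[of n m b] N.proj_homogeneous[OF tensor(2), of b] M.part_carrier[OF tensor(1)]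
      by (simp add: bitensor_eq[OF tensor])
  qed (simp_all add: W0 Wa Ws)
  then have "T.proj d t \<in> T.span (?S d)" if "t \<in> part T d" for t
    using T.part_carrier[OF that] by (simp add: W_def)
  then show ?thesis
    using T.proj_homogeneous[of _ d d] by (metis subsetI)
qed

text \<open>\<open>P a b\<close> below holds the pairs whose symbol is nonzero. The two sets are
  images of its four cells, whose sizes add up to at most \<open>k\<close>; a vanishing symbol takes
  one pair out of its cell.\<close>

lemma card_tensor_set:
  fixes B X
  defines "c \<equiv> card (tensor_set B X 0) + card (tensor_set B X 1)"
    and "k \<equiv> (card (B 0) + card (B 1)) * (card (X 0) + card (X 1))"
  assumes fin: "\<And>a. finite (B a)" "\<And>b. finite (X b)"
  shows "finite (tensor_set B X d)" and "c \<le> k"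
    and "\<lbrakk>m \<in> B a; n \<in> X b; m \<otimes>\<^sub>b n = \<zero>\<^bsub>T\<^esub>\<rbrakk> \<Longrightarrow> c < k"
proof -
  define P where "P a b = {p \<in> B a \<times> X b. (\<lambda>(m, n). m \<otimes>\<^sub>b n) p \<noteq> \<zero>\<^bsub>T\<^esub>}" for a b
  have UN: "(\<Union>a. Q a) = Q 0 \<union> Q 1" for Q :: "bit \<Rightarrow> 'z set"
  proof -
    have "a = 0 \<or> a = 1" for a :: bit
      by (cases a) simp_all
    then have U: "UNIV = {0, 1 :: bit}"
      by blast
    show ?thesis
      unfolding U by auto
  qed
  have S: "tensor_set B X d = (\<lambda>(m, n). m \<otimes>\<^sub>b n) ` P 0 d \<union> (\<lambda>(m, n). m \<otimes>\<^sub>b n) ` P 1 (d + 1)" for d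
    unfolding tensor_set_def P_def UN by auto
  have fP: "finite (P a b)" for a b
    using fin by (simp add: P_def)
  show "finite (tensor_set B X d)"
    using fP by (simp add: S)
  have le: "card (tensor_set B X d) \<le> card (P 0 d) + card (P 1 (d + 1))" for d
    unfolding S using fP by (intro card_Un_le[THEN order_trans] add_mono card_image_le)
  have Pk: "card (P a b) \<le> card (B a) * card (X b)" for a b
    unfolding P_def card_cartesian_product[symmetric] using fin by (intro card_mono) auto
  have c: "c \<le> card (P 0 0) + card (P 1 1) + card (P 0 1) + card (P 1 0)"
    using le[of 0] le[of 1] by (simp add: c_def)
  have k: "k = card (B 0) * card (X 0) + card (B 1) * card (X 1) + card (B 0) * card (X 1)
      + card (B 1) * card (X 0)"
    by (simp add: k_def algebra_simps)
  show "c \<le> k"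
    using c Pk[of 0 0] Pk[of 1 1] Pk[of 0 1] Pk[of 1 0] unfolding k by linarith
  assume z: "m \<in> B a" "n \<in> X b" "m \<otimes>\<^sub>b n = \<zero>\<^bsub>T\<^esub>"
  have "P a b \<subset> B a \<times> X b"
    using z by (auto simp: P_def)
  then have "card (P a b) < card (B a) * card (X b)"
    unfolding card_cartesian_product[symmetric] using fin by (intro psubset_card_mono) auto
  then show "c < k"
    using c Pk[of 0 0] Pk[of 1 1] Pk[of 0 1] Pk[of 1 0] unfolding k
    by (cases a; cases b) simp_all
qed

end

subsection \<open>Linear functionals on presented superalgebras\<close>

text \<open>Formal brackets are sent to 0, so skew symmetry and the Jacobi identity hold trivially,
  and the relations of the presentation remain to be checked. The functionals obtained factor
  through the abelianization.\<close>

primrec term_functional :: "('g \<Rightarrow> 'f::field) \<Rightarrow> ('f, 'g) lie_term \<Rightarrow> 'f" where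
  "term_functional h (Gen g) = h g"
| "term_functional h Zero = 0"
| "term_functional h (Add s t) = term_functional h s + term_functional h t"
| "term_functional h (Scale c t) = c * term_functional h t"
| "term_functional h (Bracket s t) = 0"

lemma term_functional_cong:
  assumes "\<And>s t. R s t \<Longrightarrow> term_functional h s = term_functional h t" "lie_eq G R s t"
  shows "term_functional h s = term_functional h t"
  using assms(2) by (induction rule: lie_eq.induct) (auto simp: assms(1) algebra_simps)

definition (in lie_superalgebra) functional :: "('a \<Rightarrow> 'f) \<Rightarrow> bool" where
  "functional F \<longleftrightarrow> (\<forall>x\<in>carrier L. \<forall>y\<in>carrier L. F (x \<oplus>\<^bsub>L\<^esub> y) = F x + F y) \<and>
    (\<forall>c. \<forall>x\<in>carrier L. F (c \<odot>\<^bsub>L\<^esub> x) = c * F x) \<and>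
    (\<forall>x\<in>carrier L. \<forall>y\<in>carrier L. F (bracket L x y) = 0)"

context lie_superalgebra
begin

lemma functionalD:
  assumes "functional F"
  shows "\<lbrakk>x \<in> carrier L; y \<in> carrier L\<rbrakk> \<Longrightarrow> F (x \<oplus>\<^bsub>L\<^esub> y) = F x + F y"
    and "x \<in> carrier L \<Longrightarrow> F (c \<odot>\<^bsub>L\<^esub> x) = c * F x"
    and "\<lbrakk>x \<in> carrier L; y \<in> carrier L\<rbrakk> \<Longrightarrow> F (bracket L x y) = 0"
    and "F \<zero>\<^bsub>L\<^esub> = 0"
proof -
  show "F \<zero>\<^bsub>L\<^esub> = 0"
    using assms scale_0[OF zero_closed] unfolding functional_def by (metis mult_zero_left zero_closed)
qed (use assms in \<open>auto simp: functional_def\<close>)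

text \<open>The dual system separates the vectors, so it yields both independence and the
  injectivity of \<open>E\<close> that fixes the size of the image.\<close>

lemma lin_indpt_dual:
  assumes "finite I" and E: "\<And>i. i \<in> I \<Longrightarrow> E i \<in> carrier L"
    and F: "\<And>i. i \<in> I \<Longrightarrow> functional (F i)"
    and dual: "\<And>i j. \<lbrakk>i \<in> I; j \<in> I\<rbrakk> \<Longrightarrow> F i (E j) = (if i = j then 1 else 0)"
  shows "lin_indpt (E ` I)" and "card (E ` I) = card I"
proof -
  have inj: "inj_on E I"
  proof (rule inj_onI)
    fix i j assume "i \<in> I" "j \<in> I" "E i = E j"
    then show "i = j"
      using dual[of i i] dual[of i j] by (auto split: if_splits)
  qed
  then show "card (E ` I) = card I"
    by (rule card_image)
  show "lin_indpt (E ` I)"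
  proof (rule lin_indptI)
    fix x assume "x \<in> E ` I"
    then obtain i where i: "i \<in> I" "x = E i" by blast
    then show "\<exists>h. (\<forall>c y. y \<in> carrier L \<longrightarrow> h (c \<odot>\<^bsub>L\<^esub> y) = c * h y) \<and>
      (\<forall>y z. y \<in> carrier L \<longrightarrow> z \<in> carrier L \<longrightarrow> h (y \<oplus>\<^bsub>L\<^esub> z) = h y + h z) \<and>
      h x \<noteq> 0 \<and> (\<forall>y\<in>E ` I - {x}. h y = 0)"
      using functionalD[OF F[OF i(1)]] dual[OF i(1)]
      by (intro exI[of _ "F i"]) (auto split: if_splits)
  qed (use assms in auto)
qed

end

lemma (in tensor_setup) functional_exists:
  assumes "\<And>s t. tensor_rel M N \<mu> \<nu> s t \<Longrightarrow> term_functional h s = term_functional h t"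
  shows "\<exists>H. T.functional H \<and> (\<forall>a b. \<forall>m\<in>part M a. \<forall>n\<in>part N b. H (m \<otimes>\<^sub>t n) = h (m, n))"
proof -
  have ev: "on_class (term_functional h) (lie_class (tensor_gens M N) (tensor_rel M N \<mu> \<nu>) t)
      = term_functional h t" if "t \<in> lie_terms (tensor_gens M N)" for t
    using on_class_cls[of "tensor_gens M N" "tensor_rel M N \<mu> \<nu>" "term_functional h" t]
      term_functional_cong[of "tensor_rel M N \<mu> \<nu>" h] assms that by blast
  show ?thesis
  proof (intro exI conjI allI ballI)
    show "T.functional (on_class (term_functional h))"
      unfolding T.functional_def by (auto simp: T_simps ev simp flip: cls_simps)
    show "on_class (term_functional h) (m \<otimes>\<^sub>t n) = h (m, n)"
      if "m \<in> part M a" "n \<in> part N b" for a b m n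
      using ev[OF Gen_lie_terms[OF that]] by (simp add: tensor_def)
  qed
qed

subsection \<open>The Heisenberg algebra\<close>

text \<open>The isomorphism serves to pull the three coordinates back to \<open>L\<close>. All
  computations take place in the tensor powers of \<open>L\<close>, which spares a transport of
  \<open>tensor_cube\<close> along the isomorphism.\<close>

locale heisenberg_iso = lie_square L for L :: "('f::field, 'a) superalgebra" +
  fixes f :: "'a \<Rightarrow> 'f \<times> 'f \<times> 'f"
  assumes f_hom: "f \<in> lie_hom L heisenberg"
    and f_bij: "bij_betw f (carrier L) UNIV"
begin

definition "\<alpha> u = fst (f u)"
definition "\<beta> u = fst (snd (f u))"
definition "\<gamma> u = snd (snd (f u))"

lemma f_eq: "f u = (\<alpha> u, \<beta> u, \<gamma> u)"
  by (simp add: \<alpha>_def \<beta>_def \<gamma>_def)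

lemma coord_basis:
  obtains x y z where "x \<in> carrier L" "y \<in> carrier L" "z \<in> carrier L"
    "\<alpha> x = 1" "\<beta> x = 0" "\<gamma> x = 0" "\<alpha> y = 0" "\<beta> y = 1" "\<gamma> y = 0"
    "\<alpha> z = 0" "\<beta> z = 0" "\<gamma> z = 1"
proof -
  have "\<exists>x\<in>carrier L. f x = v" for v
    using f_bij by (metis UNIV_I bij_betw_def imageE)
  then obtain x y z where "x \<in> carrier L" "y \<in> carrier L" "z \<in> carrier L"
    "f x = (1, 0, 0)" "f y = (0, 1, 0)" "f z = (0, 0, 1)"
    by metis
  then show thesis
    using that by (simp add: \<alpha>_def \<beta>_def \<gamma>_def)
qed

lemma coord_add [simp]:
  assumes "u \<in> carrier L" "v \<in> carrier L"
  shows "\<alpha> (u \<oplus>\<^bsub>L\<^esub> v) = \<alpha> u + \<alpha> v" "\<beta> (u \<oplus>\<^bsub>L\<^esub> v) = \<beta> u + \<beta> v" "\<gamma> (u \<oplus>\<^bsub>L\<^esub> v) = \<gamma> u + \<gamma> v"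
proof -
  have "f (u \<oplus>\<^bsub>L\<^esub> v) = f u \<oplus>\<^bsub>heisenberg\<^esub> f v"
    using f_hom assms by (simp add: lie_hom_iff)
  then show "\<alpha> (u \<oplus>\<^bsub>L\<^esub> v) = \<alpha> u + \<alpha> v" "\<beta> (u \<oplus>\<^bsub>L\<^esub> v) = \<beta> u + \<beta> v" "\<gamma> (u \<oplus>\<^bsub>L\<^esub> v) = \<gamma> u + \<gamma> v"
    by (simp_all add: f_eq heisenberg_def)
qed

lemma coord_scale [simp]:
  assumes "u \<in> carrier L"
  shows "\<alpha> (c \<odot>\<^bsub>L\<^esub> u) = c * \<alpha> u" "\<beta> (c \<odot>\<^bsub>L\<^esub> u) = c * \<beta> u" "\<gamma> (c \<odot>\<^bsub>L\<^esub> u) = c * \<gamma> u"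
proof -
  have "f (c \<odot>\<^bsub>L\<^esub> u) = c \<odot>\<^bsub>heisenberg\<^esub> f u"
    using f_hom assms by (simp add: lie_hom_iff)
  then show "\<alpha> (c \<odot>\<^bsub>L\<^esub> u) = c * \<alpha> u" "\<beta> (c \<odot>\<^bsub>L\<^esub> u) = c * \<beta> u" "\<gamma> (c \<odot>\<^bsub>L\<^esub> u) = c * \<gamma> u"
    by (simp_all add: f_eq heisenberg_def)
qed

lemma coord_bracket [simp]:
  assumes "u \<in> carrier L" "v \<in> carrier L"
  shows "\<alpha> (bracket L u v) = 0" "\<beta> (bracket L u v) = 0"
    "\<gamma> (bracket L u v) = \<alpha> u * \<beta> v - \<beta> u * \<alpha> v"
proof -
  have "f (bracket L u v) = bracket heisenberg (f u) (f v)"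
    using f_hom assms by (simp add: lie_hom_iff)
  then show "\<alpha> (bracket L u v) = 0" "\<beta> (bracket L u v) = 0"
    "\<gamma> (bracket L u v) = \<alpha> u * \<beta> v - \<beta> u * \<alpha> v"
    by (simp_all add: f_eq heisenberg_def)
qed

lemma coord_zero [simp]: "\<alpha> \<zero>\<^bsub>L\<^esub> = 0" "\<beta> \<zero>\<^bsub>L\<^esub> = 0" "\<gamma> \<zero>\<^bsub>L\<^esub> = 0"
  using coord_scale[of "\<zero>\<^bsub>L\<^esub>" 0] by simp_all

lemma odd_zero [simp]: "part L 1 = {\<zero>\<^bsub>L\<^esub>}"
proof -
  have "x = \<zero>\<^bsub>L\<^esub>" if "x \<in> part L 1" for x
  proof -
    have "f x \<in> part heisenberg 1"
      using f_hom that by (simp add: lie_hom_iff)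
    then have "f x = f \<zero>\<^bsub>L\<^esub>"
      by (simp add: heisenberg_def f_eq[of "\<zero>\<^bsub>L\<^esub>"])
    then show ?thesis
      using f_bij part_carrier[OF that] by (auto simp: bij_betw_def dest: inj_onD)
  qed
  then show ?thesis by auto
qed

lemma even_eq_carrier: "part L 0 = carrier L"
proof -
  have "x \<in> part L 0" if "x \<in> carrier L" for x
    using proj_sum[OF that] proj_part[OF that, of 0] proj_part[OF that, of 1]
      proj_closed[OF that, of 0] by auto
  then show ?thesis
    using part_carrier by blast
qed

lemma square_odd_zero [simp]: "part TS 1 = {\<zero>\<^bsub>TS\<^esub>}"
proof -
  have "sq.tensors 1 \<subseteq> {\<zero>\<^bsub>TS\<^esub>}"
  proof
    fix t assume "t \<in> sq.tensors 1"
    then obtain a b m n where t: "t = tensor2 L m n" "m \<in> part L a" "n \<in> part L b" "1 = a + b"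
      by (auto simp: sq.tensors_def)
    then show "t \<in> {\<zero>\<^bsub>TS\<^esub>}"
      using sq.tensor_zero_left[of n b] sq.tensor_zero_right[of m a] by (cases a; cases b) auto
  qed
  moreover have "submodule class_ring {\<zero>\<^bsub>TS\<^esub>} TS"
    by (rule sq.T.submoduleI) auto
  ultimately have "sq.T.span (sq.tensors 1) \<subseteq> {\<zero>\<^bsub>TS\<^esub>}"
    by (rule sq.T.span_is_subset)
  then show ?thesis
    using sq.part_eq_span_tensors[of 1] sq.T.part_zero[of 1] by blast
qed

text \<open>Coordinates of \<open>L \<otimes> L\<close> with respect to \<open>x\<^sub>1 \<otimes> x\<^sub>1\<close>,
  \<open>x\<^sub>1 \<otimes> x\<^sub>2\<close>, \<open>x\<^sub>2 \<otimes> x\<^sub>1\<close>, \<open>x\<^sub>2 \<otimes> x\<^sub>2\<close>, \<open>x\<^sub>1 \<otimes> z\<close>, \<open>x\<^sub>2 \<otimes> z\<close>; note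
  \<open>z \<otimes> x\<^sub>i = - x\<^sub>i \<otimes> z\<close> and \<open>z \<otimes> z = 0\<close>.\<close>

definition \<phi> :: "nat \<Rightarrow> 'a \<times> 'a \<Rightarrow> 'f" where
  "\<phi> i p = (case p of (u, v) \<Rightarrow> [\<alpha> u * \<alpha> v, \<alpha> u * \<beta> v, \<beta> u * \<alpha> v, \<beta> u * \<beta> v,
    \<alpha> u * \<gamma> v - \<gamma> u * \<alpha> v, \<beta> u * \<gamma> v - \<gamma> u * \<beta> v] ! i)"

lemma less_six: "i < 6 \<longleftrightarrow> i = 0 \<or> i = 1 \<or> i = 2 \<or> i = 3 \<or> i = 4 \<or> i = (5::nat)"
  by auto

lemma \<phi>_simps:
  "\<phi> 0 (u, v) = \<alpha> u * \<alpha> v" "\<phi> (Suc 0) (u, v) = \<alpha> u * \<beta> v" "\<phi> 1 (u, v) = \<alpha> u * \<beta> v"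
  "\<phi> 2 (u, v) = \<beta> u * \<alpha> v"
  "\<phi> 3 (u, v) = \<beta> u * \<beta> v" "\<phi> 4 (u, v) = \<alpha> u * \<gamma> v - \<gamma> u * \<alpha> v"
  "\<phi> 5 (u, v) = \<beta> u * \<gamma> v - \<gamma> u * \<beta> v"
  by (simp_all add: \<phi>_def)

lemma \<phi>_relation:
  assumes "i < 6" "tensor_rel L L (bracket L) (bracket L) s t"
  shows "term_functional (\<phi> i) s = term_functional (\<phi> i) t"
  using assms(2)
proof cases
  case (add_left m a m' n b)
  then show ?thesis
    using assms(1) by (auto simp: less_six \<phi>_simps part_carrier algebra_simps)
next
  case (add_right m a n b n')
  then show ?thesis
    using assms(1) by (auto simp: less_six \<phi>_simps part_carrier algebra_simps)
next
  case (scale_left m a n b c)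
  then show ?thesis
    using assms(1) by (auto simp: less_six \<phi>_simps part_carrier algebra_simps)
next
  case (scale_right m a n b c)
  then show ?thesis
    using assms(1) by (auto simp: less_six \<phi>_simps part_carrier algebra_simps)
next
  case (bracket_left m a m' a' n b)
  then show ?thesis
    using assms(1) part_carrier[OF bracket_left(3)] part_carrier[OF bracket_left(4)]
      part_carrier[OF bracket_left(5)]
    \<comment> \<open>An odd argument is zero by \<open>odd_zero\<close>, so only the case without
      signs has content.\<close>
    by (cases a; cases a'; cases b) (auto simp: less_six \<phi>_simps algebra_simps)
next
  case (bracket_right m a n b n' b')
  then show ?thesis
    using assms(1) part_carrier[OF bracket_right(3)] part_carrier[OF bracket_right(4)]
      part_carrier[OF bracket_right(5)]
    by (cases a; cases b; cases b') (auto simp: less_six \<phi>_simps algebra_simps)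
next
  case (bracket_tensor m a n b m' a' n' b')
  then show ?thesis
    using assms(1) by (auto simp: less_six \<phi>_simps part_carrier)
qed

lemma square_functionals:
  "\<exists>\<Phi>. \<forall>i<6. sq.T.functional (\<Phi> i) \<and>
    (\<forall>m\<in>carrier L. \<forall>n\<in>carrier L. \<Phi> i (tensor2 L m n) = \<phi> i (m, n))"
proof -
  have "\<forall>i. \<exists>H. i < 6 \<longrightarrow> sq.T.functional H \<and>
    (\<forall>m\<in>carrier L. \<forall>n\<in>carrier L. H (tensor2 L m n) = \<phi> i (m, n))"
    using sq.functional_exists \<phi>_relation unfolding even_eq_carrier[symmetric] by meson
  from choice[OF this] show ?thesis by blast
qed

text \<open>The image of L \<otimes> L lies in [L,L], the line of z. Hence L \<otimes> L acts
  trivially on L, which makes \<open>bracket_left\<close> and \<open>bracket_tensor\<close> harmless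
  for the triple product.\<close>

lemma lambda_coord:
  assumes "t \<in> carrier TS"
  shows "\<alpha> (tensor_lambda L t) = 0" "\<beta> (tensor_lambda L t) = 0"
proof -
  note lam = tensor_lambda(1)[unfolded lie_hom_iff]
  have "\<alpha> (tensor_lambda L t) = 0 \<and> \<beta> (tensor_lambda L t) = 0"
    using assms
  proof (induction rule: sq.tensor_induct)
    case (tensor m n a b)
    then show ?case
      using tensor_lambda(2)[OF tensor] part_carrier by auto
  next
    case zero
    then show ?case
      using lie_hom_zero[OF sq.T.lie_superalgebra_axioms lie_superalgebra_axioms tensor_lambda(1)]
      by simp
  qed (use lam in auto)
  then show "\<alpha> (tensor_lambda L t) = 0" "\<beta> (tensor_lambda L t) = 0"
    by simp_all
qed

abbreviation act where "act \<equiv> tensor_square_action L"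

lemma act_simps [simp]:
  "\<lbrakk>l \<in> carrier L; t \<in> carrier TS\<rbrakk> \<Longrightarrow> act l t \<in> carrier TS"
  "\<lbrakk>l \<in> carrier L; t \<in> carrier TS; u \<in> carrier TS\<rbrakk> \<Longrightarrow>
    act l (t \<oplus>\<^bsub>TS\<^esub> u) = act l t \<oplus>\<^bsub>TS\<^esub> act l u"
  "\<lbrakk>l \<in> carrier L; t \<in> carrier TS\<rbrakk> \<Longrightarrow> act l (c \<odot>\<^bsub>TS\<^esub> t) = c \<odot>\<^bsub>TS\<^esub> act l t"
  "\<lbrakk>m \<in> carrier L; n \<in> carrier L; l \<in> carrier L\<rbrakk> \<Longrightarrow>
    act l (tensor2 L m n) = tensor2 L (bracket L l m) n \<oplus>\<^bsub>TS\<^esub> tensor2 L m (bracket L l n)"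
  using lie_action.act_closed[OF tensor_square_action(1), of l t]
    lie_action.act_add_right[OF tensor_square_action(1), of l t u]
    lie_action.act_scale_right[OF tensor_square_action(1), of l t c]
    tensor_square_action(2)[of l 0 m 0 n 0] sq.tensor_carrier[of m 0 "bracket L l n" 0]
  by (simp_all add: even_eq_carrier)

lemma act_zero [simp]:
  "l \<in> carrier L \<Longrightarrow> act l \<zero>\<^bsub>TS\<^esub> = \<zero>\<^bsub>TS\<^esub>"
  "t \<in> carrier TS \<Longrightarrow> act \<zero>\<^bsub>L\<^esub> t = \<zero>\<^bsub>TS\<^esub>"
  using act_simps(3)[of l "\<zero>\<^bsub>TS\<^esub>" 0] act_simps(1)[of l "\<zero>\<^bsub>TS\<^esub>"]
    lie_action.act_scale_left[OF tensor_square_action(1), of "\<zero>\<^bsub>L\<^esub>" t 0] act_simps(1)[of "\<zero>\<^bsub>L\<^esub>" t]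
  by simp_all

text \<open>The summand with \<open>\<gamma>\<close> in \<open>h\<close> comes from
  \<open>t \<otimes> z = (x\<^sub>2t) \<otimes> x\<^sub>1 - (x\<^sub>1t) \<otimes> x\<^sub>2\<close> (actions written as products), where \<open>\<Omega> t\<close> is the
  coefficient of \<open>z\<close> in the image of \<open>t\<close> in \<open>L\<close>.\<close>

lemma cube_relation:
  assumes F: "sq.T.functional F" and \<Omega>: "sq.T.functional \<Omega>"
    and \<delta>: "\<delta> = \<alpha> \<or> \<delta> = \<beta>"
    and \<Omega>_act: "\<And>l t. \<lbrakk>l \<in> carrier L; t \<in> carrier TS\<rbrakk> \<Longrightarrow> \<Omega> (act l t) = 0"
    and F_act: "\<And>l l' t. \<lbrakk>l \<in> carrier L; l' \<in> carrier L; t \<in> carrier TS\<rbrakk> \<Longrightarrow>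
      F (act l' t) * \<delta> l - F (act l t) * \<delta> l' = c * \<Omega> t * (\<alpha> l * \<beta> l' - \<beta> l * \<alpha> l')"
    and rel: "tensor_rel TS L (\<lambda>t l. bracket L (tensor_lambda L t) l) act s u"
  defines "h \<equiv> \<lambda>(t, u). F t * \<delta> u + c * \<Omega> t * \<gamma> u"
  shows "term_functional h s = term_functional h u"
proof -
  note F' = sq.T.functionalD[OF F] sq.T.functionalD[OF \<Omega>]
  have \<delta>' [simp]: "\<And>u v. \<lbrakk>u \<in> carrier L; v \<in> carrier L\<rbrakk> \<Longrightarrow> \<delta> (u \<oplus>\<^bsub>L\<^esub> v) = \<delta> u + \<delta> v"
    "\<And>c u. u \<in> carrier L \<Longrightarrow> \<delta> (c \<odot>\<^bsub>L\<^esub> u) = c * \<delta> u"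
    "\<And>u v. \<lbrakk>u \<in> carrier L; v \<in> carrier L\<rbrakk> \<Longrightarrow> \<delta> (bracket L u v) = 0" "\<delta> \<zero>\<^bsub>L\<^esub> = 0"
    using \<delta> by auto
  have lam: "tensor_lambda L t \<in> carrier L" if "t \<in> carrier TS" for t
    using tensor_lambda(1) that by (simp add: lie_hom_iff)
  show ?thesis
    using rel
  proof cases
    case (bracket_left m a m' a' n b)
    \<comment> \<open>Both sides are zero: \<open>F\<close> and \<Omega> vanish on brackets, and all
      coordinates of [lambda t, l] vanish.\<close>
    then show ?thesis
      using sq.T.part_carrier[OF bracket_left(3)] sq.T.part_carrier[OF bracket_left(4)]
        part_carrier[OF bracket_left(5)]
      by (simp add: h_def F' lam lambda_coord)
  next
    case (bracket_right m a n b n' b')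
    note c = sq.T.part_carrier[OF bracket_right(3)] part_carrier[OF bracket_right(4)]
      part_carrier[OF bracket_right(5)]
    \<comment> \<open>The bracket of \<open>n\<close> and \<open>n'\<close> has only a
      \<gamma>-coordinate, and \<Omega> kills elements of the form \<open>act l t\<close>, so the
      relation reads exactly as \<open>F_act\<close>.\<close>
    show ?thesis
      using bracket_right c F_act[OF c(2,3,1)]
      by (cases b; cases b') (auto simp: h_def F' \<Omega>_act algebra_simps)
  next
    case (bracket_tensor m a n b m' a' n' b')
    then show ?thesis
      using sq.T.part_carrier[OF bracket_tensor(3)] sq.T.part_carrier[OF bracket_tensor(5)]
        part_carrier[OF bracket_tensor(4)] part_carrier[OF bracket_tensor(6)]
      by (simp add: h_def lam lambda_coord)
  qed (auto simp: h_def F' sq.T.part_carrier part_carrier algebra_simps)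
qed

text \<open>Twelve is six times two: each of the six symbols whose coordinates on L \<otimes> L are
  the functions \<phi> is tensored with x and with y, and the resulting symbols get a dual system of
  functionals.\<close>

lemma heisenberg_cube_dim:
  assumes "has_dim (tensor_cube L) (part (tensor_cube L) 0) p"
  shows "12 \<le> p"
proof -
  obtain \<Phi> where \<Phi>: "\<And>i. i < 6 \<Longrightarrow> sq.T.functional (\<Phi> i)"
    "\<And>i m n. \<lbrakk>i < 6; m \<in> carrier L; n \<in> carrier L\<rbrakk> \<Longrightarrow> \<Phi> i (tensor2 L m n) = \<phi> i (m, n)"
    using square_functionals by blast
  note \<Phi>D = sq.T.functionalD[OF \<Phi>(1)]
  \<comment> \<open>The coefficient of z in the bracket of the factors: x \<otimes> y contributes z,
    and y \<otimes> x contributes -z.\<close>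
  define \<Omega> where "\<Omega> t = \<Phi> 1 t - \<Phi> 2 t" for t
  have \<Omega>: "sq.T.functional \<Omega>"
    unfolding sq.T.functional_def \<Omega>_def by (simp add: \<Phi>D algebra_simps)
  have tc: "tensor2 L m n \<in> carrier TS" if "m \<in> carrier L" "n \<in> carrier L" for m n
    using that sq.tensor_carrier[of m 0 n 0] by (simp add: even_eq_carrier)
  \<comment> \<open>All brackets are multiples of z, so \<open>act l\<close> produces symbols with
    one factor z; therefore only the coordinates 4 and 5 can be nonzero.\<close>
  have act: "\<Phi> i (act l t) = (if i = 4 then \<alpha> l * \<Omega> t else if i = 5 then \<beta> l * \<Omega> t else 0)"
    if i: "i < 6" and l: "l \<in> carrier L" and t: "t \<in> carrier TS" for i l t
    using t
  proof (induction rule: sq.tensor_induct)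
    case (tensor m n a b)
    note c = tensor[THEN part_carrier]
    have "\<Phi> i (act l (tensor2 L m n)) = \<phi> i (bracket L l m, n) + \<phi> i (m, bracket L l n)"
      using c l i by (simp add: \<Phi>D \<Phi>(2) tc)
    moreover have "\<Omega> (tensor2 L m n) = \<alpha> m * \<beta> n - \<beta> m * \<alpha> n"
      using c by (simp add: \<Omega>_def \<Phi>(2) \<phi>_simps)
    moreover have "\<phi> i (bracket L l m, n) + \<phi> i (m, bracket L l n) =
        (if i = 4 then \<alpha> l * (\<alpha> m * \<beta> n - \<beta> m * \<alpha> n)
         else if i = 5 then \<beta> l * (\<alpha> m * \<beta> n - \<beta> m * \<alpha> n) else 0)"
      using i c l by (auto simp: less_six \<phi>_simps algebra_simps)
    ultimately show ?case
      by (simp only:)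
  next
    case zero
    then show ?case
      using l i by (simp add: \<Phi>D \<Omega>_def)
  next
    case (add x y)
    then show ?case
      using l i by (simp add: \<Phi>D \<Omega>_def algebra_simps)
  next
    case (scale c x)
    then show ?case
      using l i by (simp add: \<Phi>D \<Omega>_def algebra_simps)
  qed
  have \<Omega>_act: "\<Omega> (act l t) = 0" if "l \<in> carrier L" "t \<in> carrier TS" for l t
    using that by (simp add: \<Omega>_def act)
  define \<delta> where "\<delta> j = (if j = 0 then \<alpha> else \<beta>)" for j :: nat
  \<comment> \<open>By \<open>act\<close>, the left side of \<open>F_act\<close> is a multiple of
    \<Omega> t times \<alpha> l * \<beta> l' - \<beta> l * \<alpha> l'. Coordinate 4 paired with
    \<beta> gives the factor -1, coordinate 5 paired with \<alpha> gives 1, and every other pair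
    gives 0.\<close>
  define c :: "nat \<times> nat \<Rightarrow> 'f" where "c p = (if p = (5, 0) then 1 else if p = (4, 1) then - 1 else 0)" for p
  define h where "h = (\<lambda>(i, j) (t, u). \<Phi> i t * \<delta> j u + c (i, j) * \<Omega> t * \<gamma> u)"
  have "\<exists>H. cube.T.functional H \<and>
      (\<forall>a b. \<forall>t\<in>part TS a. \<forall>u\<in>part L b. H (cube.ten t u) = h (i, j) (t, u))"
    if "i < 6" "j < 2" for i j
  proof (rule cube.functional_exists)
    fix s u assume rel: "tensor_rel TS L (\<lambda>t l. bracket L (tensor_lambda L t) l) act s u"
    have "\<Phi> i (act l' t) * \<delta> j l - \<Phi> i (act l t) * \<delta> j l' = c (i, j) * \<Omega> t * (\<alpha> l * \<beta> l' - \<beta> l * \<alpha> l')"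
      if "l \<in> carrier L" "l' \<in> carrier L" "t \<in> carrier TS" for l l' t
      using that \<open>i < 6\<close> \<open>j < 2\<close> by (auto simp: act c_def \<delta>_def algebra_simps)
    with cube_relation[OF \<Phi>(1)[OF \<open>i < 6\<close>] \<Omega>, of "\<delta> j" "c (i, j)" s u] \<Omega>_act rel
    show "term_functional (h (i, j)) s = term_functional (h (i, j)) u"
      by (simp add: h_def \<delta>_def)
  qed
  then have "\<forall>p. \<exists>H. p \<in> {..<6} \<times> {..<2} \<longrightarrow> cube.T.functional H \<and>
      (\<forall>a b. \<forall>t\<in>part TS a. \<forall>u\<in>part L b. H (cube.ten t u) = h p (t, u))"
    by auto
  from choice[OF this] obtain H where H: "\<And>p. p \<in> {..<6} \<times> {..<2} \<Longrightarrow> cube.T.functional (H p)"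
    "\<And>p a b t u. \<lbrakk>p \<in> {..<6} \<times> {..<2}; t \<in> part TS a; u \<in> part L b\<rbrakk> \<Longrightarrow> H p (cube.ten t u) = h p (t, u)"
    by blast
  obtain x y z where xyz: "x \<in> carrier L" "y \<in> carrier L" "z \<in> carrier L"
    and co: "\<alpha> x = 1" "\<beta> x = 0" "\<gamma> x = 0" "\<alpha> y = 0" "\<beta> y = 1" "\<gamma> y = 0"
      "\<alpha> z = 0" "\<beta> z = 0" "\<gamma> z = 1"
    by (rule coord_basis)
  define g where "g k = [(x, x), (x, y), (y, x), (y, y), (x, z), (y, z)] ! k" for k
  define e where "e k = tensor2 L (fst (g k)) (snd (g k))" for k
  have gc: "fst (g k) \<in> carrier L" "snd (g k) \<in> carrier L" if "k < 6" for k
    using that xyz by (auto simp: less_six g_def)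
  have \<Phi>e: "\<Phi> i (e k) = (if i = k then 1 else 0)" if "i < 6" "k < 6" for i k
  proof -
    have "\<phi> i (g k) = (if i = k then 1 else 0)"
      using that by (auto simp: less_six g_def \<phi>_simps co)
    then show ?thesis
      using that gc by (simp add: e_def \<Phi>(2))
  qed
  define E where "E = (\<lambda>(k, l::nat). cube.ten (e k) (if l = 0 then x else y))"
  have ep: "e k \<in> part TS 0" if "k < 6" for k
    using sq.tensor_part[of "fst (g k)" 0 "snd (g k)" 0] gc[OF that]
    by (simp add: e_def even_eq_carrier)
  have xy: "(if l = 0 then x else y) \<in> part L 0" for l :: nat
    using xyz by (simp add: even_eq_carrier)
  have Ep: "E q \<in> part (tensor_cube L) 0" if "q \<in> {..<6} \<times> {..<2}" for q
    using that cube.tensor_part[OF ep xy] by (auto simp: E_def tensor_cube_def)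
  have dual: "H q (E q') = (if q = q' then 1 else 0)"
    if q: "q \<in> {..<6} \<times> {..<2}" "q' \<in> {..<6} \<times> {..<2}" for q q'
  proof -
    obtain i j k l where *: "q = (i, j)" "q' = (k, l)" "i < 6" "k < 6" "j < 2" "l < 2"
      using q by auto
    have "H q (E q') = h q (e k, if l = 0 then x else y)"
      using H(2)[OF q(1) ep xy] * by (simp add: E_def)
    \<comment> \<open>x and y have \<gamma>-coordinate 0, so the correction term of \<open>h\<close>
      disappears and the values are products of dual coordinates.\<close>
    also have "\<dots> = (if q = q' then 1 else 0)"
      using * \<Phi>e co by (auto simp: h_def \<delta>_def)
    finally show ?thesis .
  qed
  have Ec: "E q \<in> carrier (tensor_product TS L (\<lambda>t l. bracket L (tensor_lambda L t) l) act)"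
    if "q \<in> {..<6} \<times> {..<2}" for q
    using cube.T.part_carrier Ep[OF that] unfolding tensor_cube_def by blast
  have fin: "finite ({..<6::nat} \<times> {..<2::nat})"
    by simp
  have "cube.T.lin_indpt (E ` ({..<6} \<times> {..<2}))"
    using fin Ec H(1) dual by (rule cube.T.lin_indpt_dual)
  moreover have "card (E ` ({..<6} \<times> {..<2})) = card ({..<6::nat} \<times> {..<2::nat})"
    using fin Ec H(1) dual by (rule cube.T.lin_indpt_dual)
  then have "card (E ` ({..<6} \<times> {..<2})) = 12"
    by simp
  moreover have "E ` ({..<6} \<times> {..<2}) \<subseteq> part (tensor_cube L) 0"
    using Ep by blast
  ultimately show ?thesis
    using cube.T.has_dim_lin_indpt[OF _ cube.T.part_submodule, of 0 p] assms
    by (simp add: tensor_cube_def) metis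
qed

end

lemma of_nat_prime_neq_zero:
  assumes "prime p" "CHAR('f::field) \<noteq> p"
  shows "of_nat p \<noteq> (0 :: 'f)"
proof
  assume "of_nat p = (0 :: 'f)"
  then have "CHAR('f) dvd p"
    by (simp only: of_nat_eq_0_iff_char_dvd)
  then have "CHAR('f) = 1"
    using assms by (auto simp: prime_nat_iff)
  then show False
    by simp
qed

subsection \<open>The dimension bound\<close>

lemma has_dim_unique: "\<lbrakk>has_dim L W k; has_dim L W k'\<rbrakk> \<Longrightarrow> k = k'"
  by (simp add: has_dim_def)

context lie_superalgebra
begin

text \<open>A prescribed \<open>v\<close> outside \<open>D\<close> can be made one of the
  complementing vectors. This places the vanishing symbols with right factor \<open>v\<close> among
  those that are counted.\<close>

lemma complement_exists:
  assumes W: "submodule class_ring W L" "has_dim L W k"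
    and D: "submodule class_ring D L" "has_dim L D r" "D \<subseteq> W"
    and "v \<in> W"
  shows "\<exists>A X. finite A \<and> finite X \<and> A \<subseteq> D \<and> X \<subseteq> W \<and> card A = r \<and> span A = D \<and>
    r + card X \<le> k \<and> span (A \<union> X) = W \<and> (v \<notin> D \<longrightarrow> v \<in> X)"
proof -
  obtain A where A: "finite A" "A \<subseteq> D" "card A = r" "lin_indpt A" "span A = D"
    using has_dim_basis[OF D(2,1)] by blast
  have Ac: "A \<subseteq> carrier L" and vc: "v \<in> carrier L"
    using A D submodule.subset[OF W(1)] assms(6) by blast+
  show ?thesis
  proof (cases "v \<in> D")
    case True
    obtain X where "finite X" "X \<subseteq> W" "card A + card X \<le> k" "span (A \<union> X) = W"
      using has_dim_extend[OF W(2,1) A(1) _ A(4)] A(2) D(3) by blast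
    then show ?thesis
      using A True by blast
  next
    case False
    then have "v \<notin> A"
      using A by blast
    then have "lin_indpt (A \<union> {v})"
      using lin_dep_iff_in_span[OF Ac A(4) vc] A(5) False by blast
    then obtain X where X: "finite X" "X \<subseteq> W" "card (A \<union> {v}) + card X \<le> k"
      "span (A \<union> {v} \<union> X) = W"
      using has_dim_extend[OF W(2,1), of "A \<union> {v}"] A(1,2) D(3) assms(6) by blast
    \<comment> \<open>\<open>v\<close> is first counted with the independent set
      \<open>A \<union> {v}\<close> and then moved over to \<open>X\<close>, so the bound
      \<open>k\<close> is unaffected.\<close>
    have "card (insert v X) \<le> Suc (card X)" "card (A \<union> {v}) = Suc r"
      using A(1,3) \<open>v \<notin> A\<close> X(1) by (simp_all add: card_insert_if)
    then have "r + card (insert v X) \<le> k"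
      using X(3) by linarith
    then show ?thesis
      using A X assms(6) by (intro exI[of _ A] exI[of _ "insert v X"]) (simp add: Un_insert_right)
  qed
qed

lemma span_Un_decompose:
  assumes "A \<subseteq> carrier L" "X \<subseteq> carrier L" "x \<in> span (A \<union> X)"
  shows "\<exists>u\<in>span X. \<exists>c\<in>span A. x = u \<oplus>\<^bsub>L\<^esub> c"
proof -
  have "x \<in> submodule_sum (span X) (span A)"
    using assms span_union_is_sum[of X A] by (simp add: Un_commute)
  then show ?thesis
    by (auto simp: submodule_sum_def)
qed

end

context lie_square
begin

text \<open>The spanning set \<open>S\<close> of the square takes the place of \<open>B\<close> in
  the second stage, with the same \<open>X\<close>. One symbol saved in the square lowers the bound
  for the triple product by \<open>l\<close>.\<close>

lemma cube_dim_bound: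
  assumes nil: "nilpotent L"
    and B: "\<And>a. finite (B a)" "\<And>a. B a \<subseteq> part L a" "\<And>a. part L a \<subseteq> span (B a)"
    and X: "\<And>b. finite (X b)" "\<And>b. X b \<subseteq> part L b"
      "\<And>b n. n \<in> part L b \<Longrightarrow> \<exists>x\<in>span (X b). \<exists>c\<in>lower_central L 1. n = x \<oplus>\<^bsub>L\<^esub> c"
  defines "k \<equiv> card (B 0) + card (B 1)" and "l \<equiv> card (X 0) + card (X 1)"
  shows "\<exists>p q. has_superdim (tensor_cube L) p q \<and> p + q \<le> k * l\<^sup>2 \<and>
    ((\<exists>a b. \<exists>m\<in>B a. \<exists>n\<in>X b. m \<otimes>\<^sub>b n = \<zero>\<^bsub>TS\<^esub>) \<longrightarrow> p + q < k * l\<^sup>2)"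
proof -
  define S where "S = sq.tensor_set B X"
  have S: "finite (S d)" "S d \<subseteq> part TS d" "part TS d \<subseteq> sq.T.span (S d)" for d
    using sq.card_tensor_set(1)[of B X d, OF B(1) X(1)] sq.tensor_set_part[of B X d, OF B(2) X(2)]
      sq.tensor_set_span[of B X d, OF nil B(2,3) X(2,3)]
    by (simp_all add: S_def)
  define R where "R = cube.tensor_set S X"
  have R: "finite (R d)" "R d \<subseteq> part (tensor_cube L) d"
    "part (tensor_cube L) d \<subseteq> cube.T.span (R d)" for d
    using cube.card_tensor_set(1)[of S X d, OF S(1) X(1)] cube.tensor_set_part[of S X d, OF S(2) X(2)]
      cube.tensor_set_span[of S X d, OF nil S(2,3) X(2,3)]
    by (simp_all add: R_def tensor_cube_def)
  obtain p q where pq: "p \<le> card (R 0)" "q \<le> card (R 1)" "has_superdim (tensor_cube L) p q"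
    using cube.T.has_dim_span[OF cube.T.part_submodule R(1) R(2)[unfolded tensor_cube_def]
        R(3)[unfolded tensor_cube_def]]
    by (metis has_superdim_def tensor_cube_def)
  have le: "card (R 0) + card (R 1) \<le> (card (S 0) + card (S 1)) * l"
    using cube.card_tensor_set(2)[of S X, OF S(1) X(1)] by (simp add: R_def l_def)
  have Sk: "card (S 0) + card (S 1) \<le> k * l"
    using sq.card_tensor_set(2)[of B X, OF B(1) X(1)] by (simp add: S_def k_def l_def)
  have "p + q \<le> k * l\<^sup>2"
  proof -
    have "k * l * l = k * l\<^sup>2"
      by (simp add: power2_eq_square)
    then show ?thesis
      using pq le mult_le_mono1[OF Sk, of l] by linarith
  qed
  moreover have "p + q < k * l\<^sup>2" if z: "m \<in> B a" "n \<in> X b" "m \<otimes>\<^sub>b n = \<zero>\<^bsub>TS\<^esub>" for a b m n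
  proof -
    have "card (S 0) + card (S 1) < k * l"
      using sq.card_tensor_set(3)[of B X, OF B(1) X(1) z] by (simp add: S_def k_def l_def)
    \<comment> \<open>\<open>X\<close> contains \<open>n\<close>, so the strict inequality survives
      multiplication by \<open>l\<close>.\<close>
    moreover have "0 < l"
      using z(2) X(1)[of b] card_gt_0_iff[of "X b"] by (cases b) (auto simp: l_def)
    ultimately have "(card (S 0) + card (S 1)) * l < k * l\<^sup>2"
      by (simp add: power2_eq_square flip: mult.assoc)
    then show ?thesis
      using pq le by linarith
  qed
  ultimately show ?thesis
    using pq(3) by blast
qed

text \<open>For odd \<open>y\<close> the two bracket relations give
  \<open>[y,y] \<otimes> y = 2 (y \<otimes> [y,y]) = 4 ([y,y] \<otimes> y)\<close>.\<close>

lemma odd_square_tensor_zero: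
  assumes "y \<in> part L 1" "(3 :: 'f) \<noteq> 0"
  shows "bracket L y y \<otimes>\<^sub>b y = \<zero>\<^bsub>TS\<^esub>"
proof -
  let ?t = "bracket L y y \<otimes>\<^sub>b y" and ?u = "y \<otimes>\<^sub>b bracket L y y"
  have c: "?t \<in> carrier TS" "?u \<in> carrier TS"
    using assms part_carrier by auto
  have "?t = ?u \<oplus>\<^bsub>TS\<^esub> ?u" "?u = ?t \<oplus>\<^bsub>TS\<^esub> ?t"
    using sq.bitensor_bracket_left[OF assms(1,1,1)] sq.bitensor_bracket_right[OF assms(1,1,1)] c
    by simp_all
  then have "?t = (?t \<oplus>\<^bsub>TS\<^esub> ?t) \<oplus>\<^bsub>TS\<^esub> (?t \<oplus>\<^bsub>TS\<^esub> ?t)"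
    by simp
  also have "\<dots> = (1 + 1 + (1 + 1)) \<odot>\<^bsub>TS\<^esub> ?t"
    using c by (simp only: sq.T.scale_distrib_left sq.T.scale_1)
  finally have t: "?t = (1 + 3) \<odot>\<^bsub>TS\<^esub> ?t"
    by simp
  have "3 \<odot>\<^bsub>TS\<^esub> ?t = ((1 + 3) + (- 1)) \<odot>\<^bsub>TS\<^esub> ?t"
    by simp
  also have "\<dots> = (1 + 3) \<odot>\<^bsub>TS\<^esub> ?t \<oplus>\<^bsub>TS\<^esub> (- 1) \<odot>\<^bsub>TS\<^esub> ?t"
    using c by (simp only: sq.T.scale_distrib_left)
  also have "\<dots> = \<zero>\<^bsub>TS\<^esub>"
    using c t[symmetric] by (simp only: sq.T.add_scale_minus)
  finally show ?thesis
    using sq.T.scale_cancel c(1) assms(2) by blast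
qed

end

subsection \<open>One-dimensional even derived subalgebra\<close>

context lie_superalgebra
begin

lemma even_bracket_self:
  assumes "(2 :: 'f) \<noteq> 0" "u \<in> part L 0"
  shows "bracket L u u = \<zero>\<^bsub>L\<^esub>"
proof -
  have uc: "bracket L u u \<in> carrier L"
    using part_carrier[OF assms(2)] by simp
  have "2 \<odot>\<^bsub>L\<^esub> bracket L u u = bracket L u u \<oplus>\<^bsub>L\<^esub> bracket L u u"
    using scale_distrib_left[OF uc, of 1 1] uc by simp
  also have "\<dots> = \<zero>\<^bsub>L\<^esub>"
    using super_skew[OF assms(2,2)] add_scale_minus[OF uc] by simp
  finally show ?thesis
    using scale_cancel assms(1) uc by blast
qed

text \<open>The map \<open>g\<close> from the model to \<open>L\<close> preserves brackets because
  [x,y] is central. Linear independence comes from the bracket itself: bracketing with y and with x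
  reads off the first two coefficients, and the third remains in front of a nonzero vector.\<close>

lemma heisenberg_isomorphic:
  assumes x: "x \<in> part L 0" "y \<in> part L 0" "bracket L x y \<noteq> \<zero>\<^bsub>L\<^esub>"
    and two: "(2 :: 'f) \<noteq> 0"
    and central: "\<And>u. u \<in> carrier L \<Longrightarrow> bracket L (bracket L x y) u = \<zero>\<^bsub>L\<^esub>"
      "\<And>u. u \<in> carrier L \<Longrightarrow> bracket L u (bracket L x y) = \<zero>\<^bsub>L\<^esub>"
    and gen: "\<And>d w. w \<in> part L d \<Longrightarrow> w \<in> span {x, y, bracket L x y}"
  shows "lie_isomorphic L (heisenberg :: ('f, 'f \<times> 'f \<times> 'f) superalgebra)"
proof -
  define z where "z = bracket L x y"
  define g where "g = (\<lambda>(a, b, c). (a \<odot>\<^bsub>L\<^esub> x \<oplus>\<^bsub>L\<^esub> b \<odot>\<^bsub>L\<^esub> y) \<oplus>\<^bsub>L\<^esub> c \<odot>\<^bsub>L\<^esub> z)"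
  have c: "x \<in> carrier L" "y \<in> carrier L" "z \<in> carrier L"
    using x part_carrier by (auto simp: z_def)
  note self = even_bracket_self[OF two]
  have yx: "bracket L y x = (- 1) \<odot>\<^bsub>L\<^esub> z"
    using super_skew[OF x(2,1)] by (simp add: z_def)
  have g_closed: "g v \<in> carrier L" for v
    using c by (auto simp: g_def split: prod.split)
  have g_add: "g (v \<oplus>\<^bsub>heisenberg\<^esub> w) = g v \<oplus>\<^bsub>L\<^esub> g w" for v w
    using c by (auto simp: g_def heisenberg_def scale_distrib_left a_ac split: prod.split)
  have g_scale: "g (k \<odot>\<^bsub>heisenberg\<^esub> v) = k \<odot>\<^bsub>L\<^esub> g v" for k v
    using c by (auto simp: g_def heisenberg_def scale_distrib_right split: prod.split)
  have g_bracket: "g (bracket heisenberg v w) = bracket L (g v) (g w)" for v w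
  proof -
    obtain a b e a' b' e' where vw: "v = (a, b, e)" "w = (a', b', e')"
      by (metis prod_cases3)
    have "bracket L (g v) (g w) = (a' * b) \<odot>\<^bsub>L\<^esub> bracket L y x \<oplus>\<^bsub>L\<^esub> (a * b') \<odot>\<^bsub>L\<^esub> z"
      using c central self[OF x(1)] self[OF x(2)]
      by (simp add: vw g_def bracket_linear scale_distrib_right mult.commute flip: z_def)
    also have "\<dots> = (a * b' - b * a') \<odot>\<^bsub>L\<^esub> z"
      using c by (simp add: yx mult.commute[of a'] flip: scale_distrib_left)
    finally show ?thesis
      using c by (simp add: vw heisenberg_def g_def)
  qed
  have g_inj: "inj g"
  proof -
    have "v = (0, 0, 0)" if "g v = \<zero>\<^bsub>L\<^esub>" for v
    proof -
      obtain a b e where v: "v = (a, b, e)"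
        by (metis prod_cases3)
      have z0: "z \<noteq> \<zero>\<^bsub>L\<^esub>"
        using x(3) by (simp add: z_def)
      have "bracket L (g v) y = a \<odot>\<^bsub>L\<^esub> z"
        using c central self[OF x(2)] by (simp add: v g_def bracket_linear flip: z_def)
      then have "a \<odot>\<^bsub>L\<^esub> z = \<zero>\<^bsub>L\<^esub>"
        using c that by simp
      then have a: "a = 0"
        using scale_cancel c(3) z0 by blast
      have "bracket L x (g v) = b \<odot>\<^bsub>L\<^esub> z"
        using c central self[OF x(1)] by (simp add: v g_def bracket_linear flip: z_def)
      then have "b \<odot>\<^bsub>L\<^esub> z = \<zero>\<^bsub>L\<^esub>"
        using c that by simp
      then have b: "b = 0"
        using scale_cancel c(3) z0 by blast
      have "e \<odot>\<^bsub>L\<^esub> z = \<zero>\<^bsub>L\<^esub>"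
        using that c by (simp add: v a b g_def)
      then have "e = 0"
        using scale_cancel c(3) z0 by blast
      then show ?thesis
        by (simp add: v a b)
    qed
    note ker = this
    show ?thesis
    proof (rule injI)
      fix v w assume vw: "g v = g w"
      have "g (v \<oplus>\<^bsub>heisenberg\<^esub> (- 1) \<odot>\<^bsub>heisenberg\<^esub> w) = \<zero>\<^bsub>L\<^esub>"
        using vw g_closed by (simp add: g_add g_scale)
      then show "v = w"
        using ker by (cases v; cases w) (force simp: heisenberg_def)
    qed
  qed
  have g_surj: "carrier L \<subseteq> range g"
  proof
    have S: "{x, y, z} \<subseteq> carrier L"
      using c by simp
    have r_add: "u \<oplus>\<^bsub>L\<^esub> v \<in> range g" if uv: "u \<in> range g" "v \<in> range g" for u v
    proof -
      obtain u' v' where "u = g u'" "v = g v'"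
        using uv by blast
      then show ?thesis
        using g_add[of u' v'] by (simp flip: g_add)
    qed
    have r_scale: "k \<odot>\<^bsub>L\<^esub> u \<in> range g" if u: "u \<in> range g" for k u
    proof -
      obtain u' where "u = g u'"
        using u by blast
      then show ?thesis
        by (simp flip: g_scale)
    qed
    have r_zero: "\<zero>\<^bsub>L\<^esub> \<in> range g"
      by (rule range_eqI[of _ _ "(0, 0, 0)"]) (use c in \<open>simp add: g_def\<close>)
    have r_base: "x \<in> range g" "y \<in> range g" "z \<in> range g"
      by (rule range_eqI[of _ _ "(1, 0, 0)"] range_eqI[of _ _ "(0, 1, 0)"]
          range_eqI[of _ _ "(0, 0, 1)"], use c in \<open>simp add: g_def\<close>)+
    fix w assume "w \<in> carrier L"
    then show "w \<in> range g"
    proof (induction rule: carrier_induct)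
      case (part d w)
      then have "w \<in> span {x, y, z}"
        using gen by (simp add: z_def)
      then show ?case
        using S
      proof (induction rule: span_induct)
        case (base w)
        then show ?case using r_base by blast
      qed (rule r_zero r_add r_scale; assumption)+
    qed (rule r_add)
  qed
  then have bij: "bij_betw g UNIV (carrier L)"
    using g_inj g_closed by (auto simp: bij_betw_def)
  define f where "f = inv_into UNIV g"
  have fg: "f (g v) = v" for v
    using g_inj by (simp add: f_def)
  have gf: "g (f u) = u" if "u \<in> carrier L" for u
    using g_surj that by (auto simp: f_def f_inv_into_f)
  have g_even: "g v \<in> part L 0" for v
    using x bracket_degree[OF x(1,2)] by (auto simp: g_def z_def split: prod.split)
  have f0: "f \<zero>\<^bsub>L\<^esub> = (0, 0, 0)"
    using fg[of "(0, 0, 0)"] c by (simp add: g_def)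
  \<comment> \<open>\<open>g\<close> is onto and has even values, so an odd element is even as well
    and vanishes.\<close>
  have odd: "u = \<zero>\<^bsub>L\<^esub>" if "u \<in> part L 1" for u
    using part_both[of u 0 1] that g_even[of "f u"] gf[OF part_carrier[OF that]] by simp
  have "f \<in> lie_hom L heisenberg"
    unfolding lie_hom_iff
  proof (intro conjI ballI allI)
    show "f u \<in> part heisenberg d" if "u \<in> part L d" for d u
      using that odd f0 by (cases d) (auto simp: heisenberg_def)
    show "f u \<in> carrier heisenberg" for u
      by (simp add: heisenberg_def)
    show "f (u \<oplus>\<^bsub>L\<^esub> v) = f u \<oplus>\<^bsub>heisenberg\<^esub> f v" if "u \<in> carrier L" "v \<in> carrier L" for u v
      using g_add[of "f u" "f v"] fg that by (metis gf)
    show "f (k \<odot>\<^bsub>L\<^esub> u) = k \<odot>\<^bsub>heisenberg\<^esub> f u" if "u \<in> carrier L" for k u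
      using g_scale[of k "f u"] fg that by (metis gf)
    show "f (bracket L u v) = bracket heisenberg (f u) (f v)" if "u \<in> carrier L" "v \<in> carrier L" for u v
      using g_bracket[of "f u" "f v"] fg that by (metis gf)
  qed
  moreover have "bij_betw f (carrier L) (carrier heisenberg)"
    using bij_betw_inv_into[OF bij] by (simp add: f_def heisenberg_def)
  ultimately show ?thesis
    by (auto simp: lie_isomorphic_def)
qed

end

section \<open>Consequences of nilpotency, and the derived subalgebra inside L\<close>

context lie_superalgebra
begin

text \<open>From [z,y] = c z with c invertible, z moves from each term of the descending central
  series into the next, so it lies in all of them.\<close>

lemma nilpotent_bracket_eigenvector:
  assumes "nilpotent L" "z \<in> carrier L" "y \<in> carrier L" "bracket L z y = c \<odot>\<^bsub>L\<^esub> z" "c \<noteq> 0"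
  shows "z = \<zero>\<^bsub>L\<^esub>"
proof -
  have "z \<in> lower_central L k" for k
  proof (induction k)
    case 0
    show ?case using assms(2) by simp
  next
    case (Suc k)
    have "c \<odot>\<^bsub>L\<^esub> z \<in> lower_central L (Suc k)"
      using lower_central_bracket[OF Suc assms(3)] by (simp only: assms(4))
    then have "inverse c \<odot>\<^bsub>L\<^esub> (c \<odot>\<^bsub>L\<^esub> z) \<in> lower_central L (Suc k)"
      by (rule lower_central_scale)
    then show ?case
      using assms by (simp del: lower_central.simps)
  qed
  then show ?thesis
    using assms(1) by (auto simp: nilpotent_def)
qed

lemma derived_graded_submodule: "submodule class_ring (lower_central L 1 \<inter> part L d) L"
  using submodule.subset[OF part_submodule]
  by (intro submoduleI) (auto simp: lower_central_add lower_central_scale simp del: lower_central.simps)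

text \<open>\<open>lower_central L 1\<close> is [L,L], the index being shifted by one. The
  hypothesis on \<open>derived L\<close> becomes a statement about graded subspaces of
  \<open>L\<close>, where bases can be chosen and extended.\<close>

lemma has_superdim_derived:
  assumes "has_superdim (derived L) r s"
  shows "has_dim L (lower_central L 1 \<inter> part L 0) r" "has_dim L (lower_central L 1 \<inter> part L 1) s"
proof -
  have "part (derived L) d = lower_central L 1 \<inter> part L d" for d
    by (simp add: derived_def Let_def)
  then show "has_dim L (lower_central L 1 \<inter> part L 0) r" "has_dim L (lower_central L 1 \<inter> part L 1) s"
    using assms has_dim_derived[OF lie_superalgebra_axioms derived_graded_submodule]
    by (simp_all add: has_superdim_def del: lower_central.simps)
qed

end

section \<open>The bound in superdimensions, and the dichotomy for a derived subalgebra spanned by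
  one even element\<close>

context lie_square
begin

text \<open>In each degree the role of \<open>B\<close> is played by a basis \<open>A\<close> of the
  part of [L,L] together with a complement \<open>X\<close>. For the strict bound, [L,L] is nonzero,
  so some \<open>A\<close> has an element, \<open>X\<close> contains \<open>v\<close>, and their
  symbol vanishes.\<close>

lemma cube_dim_bound_superdim:
  assumes nil: "nilpotent L" and L: "has_superdim L m n" and D: "has_superdim (derived L) r s"
  shows "\<exists>p q. has_superdim (tensor_cube L) p q \<and> p + q \<le> (m + n) * (m + n - (r + s))\<^sup>2"
    and "\<lbrakk>v \<in> part L d; v \<notin> lower_central L 1;
      \<And>z b. z \<in> lower_central L 1 \<inter> part L b \<Longrightarrow> z \<otimes>\<^sub>b v = \<zero>\<^bsub>TS\<^esub>; r + s > 0\<rbrakk> \<Longrightarrow>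
      \<exists>p q. has_superdim (tensor_cube L) p q \<and> p + q < (m + n) * (m + n - (r + s))\<^sup>2"
proof -
  define k where "k d = (if d = 0 then m else n)" for d :: bit
  define r' where "r' d = (if d = 0 then r else s)" for d :: bit
  let ?D = "\<lambda>d. lower_central L 1 \<inter> part L d"
  have dims: "has_dim L (part L d) (k d)" "has_dim L (?D d) (r' d)" for d
    using L has_superdim_derived[OF D] by (cases d; simp add: has_superdim_def k_def r'_def)+
  have *: "\<exists>A X. \<forall>d. finite (A d) \<and> finite (X d) \<and> A d \<subseteq> ?D d \<and> X d \<subseteq> part L d \<and>
      card (A d) = r' d \<and> span (A d) = ?D d \<and> r' d + card (X d) \<le> k d \<and>
      span (A d \<union> X d) = part L d \<and> (w \<in> part L d \<and> w \<notin> ?D d \<longrightarrow> w \<in> X d)" for w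
  proof -
    have "\<forall>d. \<exists>A X. finite A \<and> finite X \<and> A \<subseteq> ?D d \<and> X \<subseteq> part L d \<and> card A = r' d \<and>
      span A = ?D d \<and> r' d + card X \<le> k d \<and> span (A \<union> X) = part L d \<and>
      (w \<in> part L d \<and> w \<notin> ?D d \<longrightarrow> w \<in> X)"
    proof
      fix d
      \<comment> \<open>\<open>complement_exists\<close> wants a vector of \<open>part L d\<close>.
        In a degree to which \<open>w\<close> does not belong, zero stands in; it lies in the
        derived part and imposes no condition.\<close>
      define u where "u = (if w \<in> part L d then w else \<zero>\<^bsub>L\<^esub>)"
      have "u \<in> part L d"
        by (simp add: u_def)
      note complement_exists[OF part_submodule dims(1) derived_graded_submodule dims(2) Int_lower2 this]
      moreover have "w \<in> part L d \<Longrightarrow> u = w"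
        by (simp add: u_def)
      ultimately show "\<exists>A X. finite A \<and> finite X \<and> A \<subseteq> ?D d \<and> X \<subseteq> part L d \<and> card A = r' d \<and>
        span A = ?D d \<and> r' d + card X \<le> k d \<and> span (A \<union> X) = part L d \<and>
        (w \<in> part L d \<and> w \<notin> ?D d \<longrightarrow> w \<in> X)"
        by metis
    qed
    from choice[OF this] obtain A where "\<forall>d. \<exists>X. finite (A d) \<and> finite X \<and> A d \<subseteq> ?D d \<and>
      X \<subseteq> part L d \<and> card (A d) = r' d \<and> span (A d) = ?D d \<and> r' d + card X \<le> k d \<and>
      span (A d \<union> X) = part L d \<and> (w \<in> part L d \<and> w \<notin> ?D d \<longrightarrow> w \<in> X)" ..
    from choice[OF this] show ?thesis
      by (rule exI[of _ A])
  qed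
  have main: "\<exists>p q. has_superdim (tensor_cube L) p q \<and> p + q \<le> (m + n) * (m + n - (r + s))\<^sup>2 \<and>
      ((\<exists>a b. \<exists>u\<in>A a. \<exists>w\<in>X b. u \<otimes>\<^sub>b w = \<zero>\<^bsub>TS\<^esub>) \<longrightarrow> p + q < (m + n) * (m + n - (r + s))\<^sup>2)"
    if AX: "\<And>d. finite (A d) \<and> finite (X d) \<and> A d \<subseteq> ?D d \<and> X d \<subseteq> part L d \<and>
      card (A d) = r' d \<and> span (A d) = ?D d \<and> r' d + card (X d) \<le> k d \<and>
      span (A d \<union> X d) = part L d" for A X
  proof -
    let ?B = "\<lambda>d. A d \<union> X d"
    let ?kk = "card (?B 0) + card (?B 1)" and ?l = "card (X 0) + card (X 1)"
    have "\<exists>x\<in>span (X b). \<exists>c\<in>lower_central L 1. u = x \<oplus>\<^bsub>L\<^esub> c" if "u \<in> part L b" for u b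
    proof -
      have "A b \<subseteq> carrier L" "X b \<subseteq> carrier L"
        using AX[of b] part_carrier by blast+
      then show ?thesis
        using span_Un_decompose[of "A b" "X b" u] AX[of b] that by blast
    qed
    with AX obtain p q where pq: "has_superdim (tensor_cube L) p q" "p + q \<le> ?kk * ?l\<^sup>2"
      "(\<exists>a b. \<exists>u\<in>?B a. \<exists>w\<in>X b. u \<otimes>\<^sub>b w = \<zero>\<^bsub>TS\<^esub>) \<longrightarrow> p + q < ?kk * ?l\<^sup>2"
      using cube_dim_bound[OF nil, of ?B X] by (auto simp del: lower_central.simps)
    have "card (?B d) \<le> k d" for d
      using card_Un_le[of "A d" "X d"] AX[of d] by linarith
    from this[of 0] this[of 1] have kk: "?kk \<le> m + n"
      by (simp add: k_def)
    have l: "?l \<le> m + n - (r + s)"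
    proof -
      have "r + card (X 0) \<le> m" "s + card (X 1) \<le> n"
        using AX[of 0] AX[of 1] by (simp_all add: k_def r'_def)
      then show ?thesis by linarith
    qed
    have "?kk * ?l\<^sup>2 \<le> (m + n) * (m + n - (r + s))\<^sup>2"
      using kk l by (intro mult_le_mono power_mono) auto
    with pq show ?thesis
      by (meson UnI1 le_trans less_le_trans)
  qed
  show "\<exists>p q. has_superdim (tensor_cube L) p q \<and> p + q \<le> (m + n) * (m + n - (r + s))\<^sup>2"
    using *[of "\<zero>\<^bsub>L\<^esub>"] main by meson
  assume v: "v \<in> part L d" "v \<notin> lower_central L 1" "r + s > 0"
    and z: "\<And>z b. z \<in> lower_central L 1 \<inter> part L b \<Longrightarrow> z \<otimes>\<^sub>b v = \<zero>\<^bsub>TS\<^esub>"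
  obtain A X where AX: "\<And>d. finite (A d) \<and> finite (X d) \<and> A d \<subseteq> ?D d \<and> X d \<subseteq> part L d \<and>
      card (A d) = r' d \<and> span (A d) = ?D d \<and> r' d + card (X d) \<le> k d \<and>
      span (A d \<union> X d) = part L d" "\<And>d. v \<in> part L d \<and> v \<notin> ?D d \<longrightarrow> v \<in> X d"
    using *[of v] by meson
  have "A 0 \<noteq> {} \<or> A 1 \<noteq> {}"
    using AX(1)[of 0] AX(1)[of 1] v(3) by (auto simp: r'_def)
  then obtain b where "A b \<noteq> {}"
    by blast
  then obtain u where "u \<in> A b" by blast
  then have "\<exists>a b. \<exists>u\<in>A a. \<exists>w\<in>X b. u \<otimes>\<^sub>b w = \<zero>\<^bsub>TS\<^esub>"
    using z[of u b] AX(1)[of b] AX(2)[of d] v(1,2) by blast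
  then show "\<exists>p q. has_superdim (tensor_cube L) p q \<and> p + q < (m + n) * (m + n - (r + s))\<^sup>2"
    using main[OF AX(1)] by blast
qed

lemma heisenberg_or_tensor_zero:
  assumes nil: "nilpotent L" and nab: "\<not> abelian L" and three: "(3 :: 'f) \<noteq> 0"
    and D0: "lower_central L 1 \<inter> part L 0 = {c \<odot>\<^bsub>L\<^esub> z | c. True}" and z: "z \<in> carrier L"
    and D1: "lower_central L 1 \<inter> part L 1 = {\<zero>\<^bsub>L\<^esub>}"
  shows "lie_isomorphic L (heisenberg :: ('f, 'f \<times> 'f \<times> 'f) superalgebra) \<or>
    (\<exists>d. \<exists>v\<in>part L d. v \<notin> lower_central L 1 \<and>
      (\<forall>b. \<forall>u \<in> lower_central L 1 \<inter> part L b. u \<otimes>\<^sub>b v = \<zero>\<^bsub>TS\<^esub>))"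
proof -
  note [simp del] = lower_central.simps
  have in_D: "bracket L x y \<in> lower_central L 1" if "x \<in> carrier L" "y \<in> carrier L" for x y
    using lower_central_bracket[of x 0 y] that by (simp add: lower_central.simps(1))
  \<comment> \<open>The odd part of [L,L] is zero and projections stay in [L,L], so [L,L] is the
    line of z.\<close>
  have Dz: "\<exists>c. u = c \<odot>\<^bsub>L\<^esub> z" if u: "u \<in> lower_central L 1" for u
  proof -
    have uc: "u \<in> carrier L"
      using u lower_central_carrier by blast
    have "proj 1 u = \<zero>\<^bsub>L\<^esub>"
      using D1 lower_central_proj[OF u, of 1] proj_part[OF uc, of 1] by blast
    moreover obtain c where "proj 0 u = c \<odot>\<^bsub>L\<^esub> z"
      using D0 lower_central_proj[OF u, of 0] proj_part[OF uc, of 0] by blast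
    ultimately show ?thesis
      using proj_sum[OF uc] z by auto
  qed
  have z_in: "z \<in> lower_central L 1" "z \<in> part L 0"
    using D0 z scale_1[OF z] by (metis (mono_tags, lifting) Int_iff mem_Collect_eq)+
  have odd0: "bracket L x y = \<zero>\<^bsub>L\<^esub>" if "x \<in> part L a" "y \<in> part L b" "a + b = 1" for x y a b
    using bracket_degree[OF that(1,2)] in_D[of x y] that D1 part_carrier by auto
  \<comment> \<open>The bracket is a multiple of z; a nonzero factor would make z an eigenvector,
    hence zero by nilpotency.\<close>
  have central_left: "bracket L z y = \<zero>\<^bsub>L\<^esub>" if y: "y \<in> carrier L" for y
  proof -
    obtain c where c: "bracket L z y = c \<odot>\<^bsub>L\<^esub> z"
      using Dz[OF in_D[OF z y]] by blast
    show ?thesis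
      using nilpotent_bracket_eigenvector[OF nil z y c] c z y by (cases "c = 0") auto
  qed
  have central_right: "bracket L y z = \<zero>\<^bsub>L\<^esub>" if "y \<in> carrier L" for y
    using that
  proof (induction rule: carrier_induct)
    case (part d y)
    then show ?case
      using super_skew[OF part z_in(2)] central_left part_carrier by simp
  qed (use z in \<open>simp add: bracket_add_left\<close>)
  \<comment> \<open>[L,L] is a line, so one nonzero \<open>w\<close> whose symbol with
    \<open>v\<close> vanishes forces the same for all elements of [L,L].\<close>
  have tensor_zero: "u \<otimes>\<^sub>b v = \<zero>\<^bsub>TS\<^esub>"
    if w: "w \<in> lower_central L 1" "w \<noteq> \<zero>\<^bsub>L\<^esub>" "w \<otimes>\<^sub>b v = \<zero>\<^bsub>TS\<^esub>" and v: "v \<in> carrier L"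
      and u: "u \<in> lower_central L 1" for u v w
  proof -
    obtain c where c: "w = c \<odot>\<^bsub>L\<^esub> z"
      using Dz[OF w(1)] by blast
    then have "c \<noteq> 0"
      using w(2) z by auto
    then have "z \<otimes>\<^sub>b v = \<zero>\<^bsub>TS\<^esub>"
      using w(3) c v z sq.T.scale_cancel[of c "z \<otimes>\<^sub>b v"] by (simp add: sq.bitensor_scale_left)
    moreover obtain e where "u = e \<odot>\<^bsub>L\<^esub> z"
      using Dz[OF u] by blast
    ultimately show ?thesis
      using v z by (simp add: sq.bitensor_scale_left)
  qed
  \<comment> \<open>Both terms of \<open>bracket_left\<close> have the right factor 0.\<close>
  have orthogonal: "bracket L x y \<otimes>\<^sub>b v = \<zero>\<^bsub>TS\<^esub>"
    if "x \<in> part L a" "y \<in> part L b" "v \<in> part L d" "bracket L x v = \<zero>\<^bsub>L\<^esub>" "bracket L y v = \<zero>\<^bsub>L\<^esub>"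
    for x y v a b d
    using sq.bitensor_bracket_left[OF that(1-3)] that part_carrier by simp
  show ?thesis
  proof (cases "\<exists>y\<in>part L 1. bracket L y y \<noteq> \<zero>\<^bsub>L\<^esub>")
    case True
    then obtain y where y: "y \<in> part L 1" "bracket L y y \<noteq> \<zero>\<^bsub>L\<^esub>"
      by blast
    have yc: "y \<in> carrier L"
      using y part_carrier by blast
    have "y \<notin> lower_central L 1"
    proof
      assume "y \<in> lower_central L 1"
      then have "y = \<zero>\<^bsub>L\<^esub>"
        using y(1) D1 by blast
      then show False
        using y(2) yc by simp
    qed
    moreover have "u \<otimes>\<^sub>b y = \<zero>\<^bsub>TS\<^esub>" if "u \<in> lower_central L 1" for u
      using tensor_zero[OF in_D[OF yc yc] y(2) odd_square_tensor_zero[OF y(1) three] yc that] .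
    ultimately show ?thesis
      using y(1) by blast
  next
    case False
    \<comment> \<open>Polarization: the bracket is symmetric on the odd part, so vanishing squares
      make it vanish, as 2 is invertible.\<close>
    have odd: "bracket L x y = \<zero>\<^bsub>L\<^esub>" if "x \<in> part L 1" "y \<in> part L 1" for x y
    proof -
      note c = that[THEN part_carrier]
      have bc: "bracket L x y \<in> carrier L"
        using c by simp
      have "bracket L y x = bracket L x y"
        using super_skew[OF that(2,1)] c by simp
      moreover have "bracket L x x = \<zero>\<^bsub>L\<^esub>" "bracket L y y = \<zero>\<^bsub>L\<^esub>"
        "bracket L (x \<oplus>\<^bsub>L\<^esub> y) (x \<oplus>\<^bsub>L\<^esub> y) = \<zero>\<^bsub>L\<^esub>"
        using False that by auto
      ultimately have "bracket L x y \<oplus>\<^bsub>L\<^esub> bracket L x y = \<zero>\<^bsub>L\<^esub>"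
        using c by (simp add: bracket_linear)
      then have "2 \<odot>\<^bsub>L\<^esub> bracket L x y = \<zero>\<^bsub>L\<^esub>"
        using scale_distrib_left[OF bc, of 1 1] bc by simp
      then show ?thesis
        using scale_cancel two bc by blast
    qed
    have "\<exists>x\<in>part L 0. \<exists>y\<in>part L 0. bracket L x y \<noteq> \<zero>\<^bsub>L\<^esub>"
    proof (rule ccontr)
      assume "\<not> ?thesis"
      then have h: "bracket L x y = \<zero>\<^bsub>L\<^esub>" if "x \<in> part L a" "y \<in> part L b" for x y a b
        using that odd odd0[of x a y b] by (cases a; cases b) auto
      have "bracket L x y = \<zero>\<^bsub>L\<^esub>" if "x \<in> carrier L" "y \<in> carrier L" for x y
      proof -
        have "bracket L (proj 0 x \<oplus>\<^bsub>L\<^esub> proj 1 x) (proj 0 y \<oplus>\<^bsub>L\<^esub> proj 1 y) = \<zero>\<^bsub>L\<^esub>"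
          using that h[OF proj_part proj_part] by (simp add: bracket_linear)
        then show ?thesis
          using that by (simp add: proj_sum)
      qed
      then show False
        using nab by (simp add: abelian_def)
    qed
    then obtain x y where xy: "x \<in> part L 0" "y \<in> part L 0" "bracket L x y \<noteq> \<zero>\<^bsub>L\<^esub>"
      by blast
    note c = xy(1,2)[THEN part_carrier]
    define t where "t = bracket L x y"
    have t: "t \<in> carrier L" "t \<in> lower_central L 1"
      using c in_D by (simp_all add: t_def)
    obtain k where k: "t = k \<odot>\<^bsub>L\<^esub> z"
      using Dz[OF t(2)] by blast
    then have k0: "k \<noteq> 0"
      using xy(3) z by (auto simp: t_def)
    have zt: "z = inverse k \<odot>\<^bsub>L\<^esub> t"
      using k k0 z by simp
    have Dt: "\<exists>e. u = e \<odot>\<^bsub>L\<^esub> t" if "u \<in> lower_central L 1" for u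
      using Dz[OF that] t(1) unfolding zt by auto
    have tu: "bracket L t u = \<zero>\<^bsub>L\<^esub>" "bracket L u t = \<zero>\<^bsub>L\<^esub>" if "u \<in> carrier L" for u
      using that central_left central_right z unfolding k by (simp_all add: bracket_linear)
    note self = even_bracket_self[OF two]
    have yx: "bracket L y x = (- 1) \<odot>\<^bsub>L\<^esub> t"
      using super_skew[OF xy(2,1)] by (simp add: t_def)
    show ?thesis
    proof (cases "\<forall>d. part L d \<subseteq> span {x, y, t}")
      case True
      then have "lie_isomorphic L (heisenberg :: ('f, 'f \<times> 'f \<times> 'f) superalgebra)"
        using heisenberg_isomorphic[OF xy two] tu by (auto simp: t_def)
      then show ?thesis ..
    next
      case False
      then obtain d w where w: "w \<in> part L d" "w \<notin> span {x, y, t}"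
        by blast
      have wc: "w \<in> carrier L"
        using w part_carrier by blast
      have S: "{x, y, t} \<subseteq> carrier L"
        using c t by simp
      have span: "x \<in> span {x, y, t}" "y \<in> span {x, y, t}" "t \<in> span {x, y, t}"
        using span_mem[OF S] by auto
      have span_scale: "e \<odot>\<^bsub>L\<^esub> u \<in> span {x, y, t}" if "u \<in> span {x, y, t}" for e u
        using submodule.smult_closed[OF span_is_submodule[OF S], of e u] that by simp
      \<comment> \<open>An odd \<open>w\<close> commutes with the even \<open>x\<close> and
        \<open>y\<close>, because brackets of mixed degree vanish by \<open>odd0\<close>; this is
        the third property.\<close>
      obtain e g where eg: "bracket L x w = e \<odot>\<^bsub>L\<^esub> t" "bracket L y w = g \<odot>\<^bsub>L\<^esub> t"
        "d = 1 \<Longrightarrow> e = 0 \<and> g = 0"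
      proof (cases "d = 0")
        case True
        then show ?thesis
          using that Dt[OF in_D[OF c(1) wc]] Dt[OF in_D[OF c(2) wc]] by auto
      next
        case False
        then show ?thesis
          using that[of 0 0] odd0[OF xy(1) w(1)] odd0[OF xy(2) w(1)] t by simp
      qed
      \<comment> \<open>The coefficients solve [x,v] = [y,v] = 0: [x,y] = t cancels e t, and [y,x] =
        -t cancels g t. For odd \<open>w\<close> both are 0 and \<open>v\<close> is
        \<open>w\<close>, so \<open>v\<close> is homogeneous in every case.\<close>
      define v where "v = w \<oplus>\<^bsub>L\<^esub> (g \<odot>\<^bsub>L\<^esub> x \<oplus>\<^bsub>L\<^esub> (- e) \<odot>\<^bsub>L\<^esub> y)"
      have v: "v \<in> part L d"
        using w(1) xy(1,2) eg(3) c wc by (cases d) (simp_all add: v_def)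
      have u: "g \<odot>\<^bsub>L\<^esub> x \<oplus>\<^bsub>L\<^esub> (- e) \<odot>\<^bsub>L\<^esub> y \<in> span {x, y, t}"
        using span span_scale span_add1[OF S] by blast
      have v_span: "v \<notin> span {x, y, t}"
        using w(2) span_add[OF S u wc] a_comm[OF wc span_closed[OF S u]] by (simp add: v_def)
      have vD: "v \<notin> lower_central L 1"
      proof
        assume "v \<in> lower_central L 1"
        from Dt[OF this] show False
          using v_span span(3) span_scale by blast
      qed
      have "bracket L x v = \<zero>\<^bsub>L\<^esub>" "bracket L y v = \<zero>\<^bsub>L\<^esub>"
        using c wc t self[OF xy(1)] self[OF xy(2)] eg(1,2) yx
        by (simp_all add: v_def bracket_linear flip: t_def)
      then have "t \<otimes>\<^sub>b v = \<zero>\<^bsub>TS\<^esub>"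
        unfolding t_def by (rule orthogonal[OF xy(1,2) v])
      then have "u \<otimes>\<^sub>b v = \<zero>\<^bsub>TS\<^esub>" if "u \<in> lower_central L 1" for u
        using tensor_zero[OF t(2) _ _ part_carrier[OF v] that] xy(3) by (simp add: t_def)
      with v vD show ?thesis
        by blast
    qed
  qed
qed

end

text \<open>The upper bound is what the squeeze p + q \<le> 3 * 2^2 = 12 \<le> p in the theorem asks
  for.\<close>

lemma (in heisenberg_iso) heisenberg_dim_le:
  assumes "has_superdim L m n"
  shows "m + n \<le> 3"
proof -
  obtain x y z where xyz: "x \<in> carrier L" "y \<in> carrier L" "z \<in> carrier L"
    and co: "\<alpha> x = 1" "\<beta> x = 0" "\<gamma> x = 0" "\<alpha> y = 0" "\<beta> y = 1" "\<gamma> y = 0"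
      "\<alpha> z = 0" "\<beta> z = 0" "\<gamma> z = 1"
    by (rule coord_basis)
  have S: "{x, y, z} \<subseteq> carrier L"
    using xyz by simp
  have "u \<in> span {x, y, z}" if "u \<in> carrier L" for u
  proof -
    let ?w = "(\<alpha> u \<odot>\<^bsub>L\<^esub> x \<oplus>\<^bsub>L\<^esub> \<beta> u \<odot>\<^bsub>L\<^esub> y) \<oplus>\<^bsub>L\<^esub> \<gamma> u \<odot>\<^bsub>L\<^esub> z"
    have "f u = f ?w"
      using xyz by (simp add: f_eq co)
    then have "u = ?w"
      using f_bij that xyz by (auto simp: bij_betw_def dest!: inj_onD)
    moreover have "c \<odot>\<^bsub>L\<^esub> v \<in> span {x, y, z}" if "v \<in> {x, y, z}" for c v
      using submodule.smult_closed[OF span_is_submodule[OF S], of c v] span_mem[OF S that] by simp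
    then have "?w \<in> span {x, y, z}"
      using span_add1[OF S] by blast
    ultimately show ?thesis by simp
  qed
  then have "part L 0 \<subseteq> span {x, y, z}"
    using part_carrier by blast
  moreover have "{x, y, z} \<subseteq> part L 0"
    using S by (simp add: even_eq_carrier)
  ultimately obtain k where "k \<le> card {x, y, z}" "has_dim L (part L 0) k"
    using has_dim_span[OF part_submodule] by (meson finite.emptyI finite.insertI)
  then have "m \<le> card {x, y, z}"
    using assms has_dim_unique by (metis has_superdim_def)
  also have "\<dots> \<le> 3"
    by (simp add: card_insert_if)
  finally have "m \<le> 3" .
  moreover obtain k where "k \<le> card ({} :: 'a set)" "has_dim L (part L 1) k"
    using has_dim_span[OF part_submodule, of "{}" 1] by (auto simp: span_empty)
  then have "n = 0"
    using assms has_dim_unique by (metis card.empty has_superdim_def le_zero_eq)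
  ultimately show ?thesis by simp
qed

theorem theorem4p9:
  fixes L :: "('f::field, 'a) superalgebra" and m n r s :: nat
  assumes "CHAR('f) \<noteq> 2" and "CHAR('f) \<noteq> 3"
    and "lie_superalgebra L"
    and "has_superdim L m n"
    and "\<not> abelian L"
    and "nilpotent L"
    and "has_superdim (derived L) r s"
  shows "\<exists>p q. has_superdim (tensor_cube L) p q \<and>
           p + q \<le> (m + n) * (m + n - (r + s))\<^sup>2 \<and>
           (r = 1 \<and> s = 0 \<longrightarrow>
             (p + q = (m + n) * (m + n - (r + s))\<^sup>2 \<longleftrightarrow>
              lie_isomorphic L (heisenberg :: ('f, 'f \<times> 'f \<times> 'f) superalgebra)))"
proof -
  have two: "(2 :: 'f) \<noteq> 0" and three: "(3 :: 'f) \<noteq> 0"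
    using of_nat_prime_neq_zero[of 2, where 'f = 'f] of_nat_prime_neq_zero[of 3, where 'f = 'f]
      assms(1,2) by simp_all
  interpret lie_superalgebra L by fact
  interpret lie_square L
    by unfold_locales (rule two)
  let ?b = "(m + n) * (m + n - (r + s))\<^sup>2"
  obtain p q where pq: "has_superdim (tensor_cube L) p q" "p + q \<le> ?b"
    using cube_dim_bound_superdim(1)[OF assms(6,4,7)] by blast
  \<comment> \<open>The dimensions of the triple product are determined, so a strict bound for some
    pair contradicts equality for the given one.\<close>
  have unique: "p' = p \<and> q' = q" if "has_superdim (tensor_cube L) p' q'" for p' q'
    using that pq(1) has_dim_unique by (metis has_superdim_def)
  have "p + q = ?b \<longleftrightarrow> lie_isomorphic L (heisenberg :: ('f, 'f \<times> 'f \<times> 'f) superalgebra)"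
    if rs: "r = 1" "s = 0"
  proof
    assume "lie_isomorphic L (heisenberg :: ('f, 'f \<times> 'f \<times> 'f) superalgebra)"
    then obtain f :: "'a \<Rightarrow> 'f \<times> 'f \<times> 'f" where "f \<in> lie_hom L heisenberg" "bij_betw f (carrier L) UNIV"
      by (auto simp: lie_isomorphic_def heisenberg_def)
    then interpret heisenberg_iso L f
      by unfold_locales
    have "m + n \<le> 3"
      by (rule heisenberg_dim_le[OF assms(4)])
    \<comment> \<open>With r + s = 1 the bound increases with m + n and is at most 12, while the
      independent symbols give 12 \<le> p; all inequalities in between become equalities.\<close>
    then have "?b \<le> 3 * (3 - 1)\<^sup>2"
      using rs by (intro mult_le_mono power_mono) auto
    moreover have "12 \<le> p"
      using heisenberg_cube_dim pq(1) by (simp add: has_superdim_def)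
    ultimately show "p + q = ?b"
      using pq(2) by simp
  next
    assume eq: "p + q = ?b"
    note D = has_superdim_derived[OF assms(7)]
    obtain A where "A \<subseteq> lower_central L 1 \<inter> part L 0" and A: "finite A" "card A = 1"
        "span A = lower_central L 1 \<inter> part L 0"
      using has_dim_basis[OF D(1) derived_graded_submodule] rs by blast
    then have Ac: "A \<subseteq> carrier L"
      using part_carrier by blast
    obtain z where z: "A = {z}"
      using A(2) by (auto simp: card_1_singleton_iff)
    have "lower_central L 1 \<inter> part L 0 = {c \<odot>\<^bsub>L\<^esub> z | c. True}"
      using A(3) Ac finite_span[of "{z}"] by (auto simp: z lincomb_def)
    moreover obtain A' where "finite A'" "card A' = 0" "span A' = lower_central L 1 \<inter> part L 1"
      using has_dim_basis[OF D(2) derived_graded_submodule] rs by blast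
    then have "lower_central L 1 \<inter> part L 1 = {\<zero>\<^bsub>L\<^esub>}"
      using span_empty by simp
    moreover have "z \<in> carrier L"
      using Ac z by simp
    ultimately have "lie_isomorphic L (heisenberg :: ('f, 'f \<times> 'f \<times> 'f) superalgebra) \<or>
      (\<exists>d. \<exists>v\<in>part L d. v \<notin> lower_central L 1 \<and>
        (\<forall>b. \<forall>u \<in> lower_central L 1 \<inter> part L b. sq.bitensor u v = \<zero>\<^bsub>TS\<^esub>))"
      by (intro heisenberg_or_tensor_zero[OF assms(6,5) three])
    then show "lie_isomorphic L (heisenberg :: ('f, 'f \<times> 'f \<times> 'f) superalgebra)"
    proof (elim disjE exE bexE conjE)
      fix d v assume "v \<in> part L d" "v \<notin> lower_central L 1"
        "\<forall>b. \<forall>u \<in> lower_central L 1 \<inter> part L b. sq.bitensor u v = \<zero>\<^bsub>TS\<^esub>"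
      then have "\<exists>p q. has_superdim (tensor_cube L) p q \<and> p + q < ?b"
        using rs by (intro cube_dim_bound_superdim(2)[OF assms(6,4,7)]) auto
      then show ?thesis
        using unique eq by auto
    qed
  qed
  with pq show ?thesis
    by blast
qed

end
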